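(* Let $\mathcal{E}(r_0)=\mathcal{E}^n_{\sigma,N}(r_0)$, $r_0\ge 0$, be a warped cylindrical end. Let $h,G:(0,+\infty)\to\mathbb{R}$ be two given $C^2$ functions. Then, for every $v\in C^\infty_c(\mathcal{E}(r_0))$, the following Carleman-type estimate holds: $$\int_{\mathcal{E}(r_0)}v^2\,k_1\,e^h\,d\mu_M+\int_{\mathcal{E}(r_0)}|\nabla v|^2\,k_2\,e^h\,d\mu_M\le\int_{\mathcal{E}(r_0)}(\Delta v)^2\,e^h\,d\mu_M,$$ where $k_1$ and $k_2$ are such that $$k_2\le 2\min\left\{\left[2F^2-2(n-1)\frac{F\sigma'}{\sigma}+F'+FG'\right]\ ;\ \left[-F'-FG'+2\frac{F\sigma'}{\sigma}\right]\right\}$$ and $$k_1\le 2(A'+AG')-k_2F^2-G'k_2F-k_2'F-k_2F',$$ with $$A(r):=F^3-\frac{F\,(\sigma^{n-1}F)'}{\sigma^{n-1}}\qquad\text{and}\qquad F:=\frac12\left[h'+(n-1)\frac{\sigma'}{\sigma}-G'\right].$$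
   Context: A warped cylindrical end is an $n$-dimensional ($n\ge2$) warped product manifold of the form $\mathcal{E}(r_0)=\mathcal{E}^n_{\sigma,N}(r_0)=\big((r_0,+\infty)\times N,\ g=dr\otimes dr+\sigma(r)^2g_N\big)$, $r_0\ge 0$, where $(N,g_N)$ is a complete (not necessarily compact) $(n-1)$-dimensional Riemannian manifold without boundary and $\sigma:(r_0,+\infty)\to(0,+\infty)$ is a smooth function. $\mu_M$ denotes the Riemannian measure of $g$, $\nabla$ the gradient and $\Delta=\operatorname{div}\nabla$ the (negative definite) Laplacian of $g$. Functions of $r$ alone (such as $h,k_1,k_2$) are regarded as functions on $\mathcal{E}(r_0)$ via $(r,x)\mapsto r$, and $'$ denotes $d/dr$.
   Formalization: Since h, G of class C² do not guarantee that A' exists, it is additionally assumed that A and k_2 are differentiable on (r_0,∞) and that k_1 is locally integrable there, so that A', k_2' and the integral of v²k_1e^h are meaningful. *)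

theory Defs
  imports "HOL-Analysis.Analysis"
begin

text \<open>For open \<open>S\<close>: \<open>f\<close> is of class C^k on \<open>S\<close>, resp. smooth on \<open>S\<close>.\<close>

primrec Ck_on :: "nat \<Rightarrow> 'a::real_normed_vector set \<Rightarrow> ('a \<Rightarrow> 'b::real_normed_vector) \<Rightarrow> bool" where
  "Ck_on 0 S f \<longleftrightarrow> continuous_on S f"
| "Ck_on (Suc k) S f \<longleftrightarrow>
     (\<forall>x\<in>S. f differentiable (at x)) \<and>
     (\<forall>w. Ck_on k S (\<lambda>x. frechet_derivative f (at x) w))"

definition smooth_on :: "'a::real_normed_vector set \<Rightarrow> ('a \<Rightarrow> 'b::real_normed_vector) \<Rightarrow> bool" where
  "smooth_on S f \<longleftrightarrow> (\<forall>k. Ck_on k S f)"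

text \<open>
  A Riemannian manifold modelled on the Euclidean space \<open>'e\<close> is given by an atlas of charts,
  indexed by \<open>chart_idx\<close>, and by the coordinate expression of the metric in each chart:
  \<open>rmetric M i p u w\<close> is the value of the metric at \<open>p\<close> on the tangent vectors whose
  components in chart \<open>i\<close> are \<open>u\<close> and \<open>w\<close>. All vector fields below are likewise given by
  their components in each chart. The underlying set is the union of the chart domains; the
  chart maps and the metric are irrelevant outside these domains.
\<close>

record ('i, 'a, 'e) riem_atlas =
  chart_idx :: "'i set"
  chart_dom :: "'i \<Rightarrow> 'a set"
  chart_map :: "'i \<Rightarrow> 'a \<Rightarrow> 'e"
  rmetric :: "'i \<Rightarrow> 'a \<Rightarrow> 'e \<Rightarrow> 'e \<Rightarrow> real"

definition points :: "('i, 'a, 'e) riem_atlas \<Rightarrow> 'a set" where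
  "points M = (\<Union>i\<in>chart_idx M. chart_dom M i)"

definition chart_inv :: "('i, 'a, 'e) riem_atlas \<Rightarrow> 'i \<Rightarrow> 'e \<Rightarrow> 'a" where
  "chart_inv M i = inv_into (chart_dom M i) (chart_map M i)"

definition chart_img :: "('i, 'a, 'e) riem_atlas \<Rightarrow> 'i \<Rightarrow> 'e set" where
  "chart_img M i = chart_map M i ` chart_dom M i"

definition transition :: "('i, 'a, 'e) riem_atlas \<Rightarrow> 'i \<Rightarrow> 'i \<Rightarrow> 'e \<Rightarrow> 'e" where
  "transition M i j = chart_map M j \<circ> chart_inv M i"

definition chart_at :: "('i, 'a, 'e) riem_atlas \<Rightarrow> 'a \<Rightarrow> 'i" where
  "chart_at M p = (SOME i. i \<in> chart_idx M \<and> p \<in> chart_dom M i)"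

definition smooth_manifold ::
  "('i, 'a::{t2_space, second_countable_topology}, 'e::euclidean_space) riem_atlas \<Rightarrow> bool" where
  "smooth_manifold M \<longleftrightarrow>
     (\<forall>i\<in>chart_idx M.
        open (chart_dom M i) \<and> open (chart_img M i) \<and>
        homeomorphism (chart_dom M i) (chart_img M i) (chart_map M i) (chart_inv M i)) \<and>
     (\<forall>i\<in>chart_idx M. \<forall>j\<in>chart_idx M.
        smooth_on (chart_map M i ` (chart_dom M i \<inter> chart_dom M j)) (transition M i j))"

definition riemannian_manifold ::
  "('i, 'a::{t2_space, second_countable_topology}, 'e::euclidean_space) riem_atlas \<Rightarrow> bool" where
  "riemannian_manifold M \<longleftrightarrow>
     smooth_manifold M \<and>
     (\<forall>i\<in>chart_idx M. \<forall>p\<in>chart_dom M i.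
        bilinear (rmetric M i p) \<and>
        (\<forall>u w. rmetric M i p u w = rmetric M i p w u) \<and>
        (\<forall>u. u \<noteq> 0 \<longrightarrow> rmetric M i p u u > 0)) \<and>
     (\<forall>i\<in>chart_idx M. \<forall>u w.
        smooth_on (chart_img M i) (\<lambda>x. rmetric M i (chart_inv M i x) u w)) \<and>
     (\<forall>i\<in>chart_idx M. \<forall>j\<in>chart_idx M. \<forall>p\<in>chart_dom M i \<inter> chart_dom M j. \<forall>u w.
        let D = frechet_derivative (transition M i j) (at (chart_map M i p))
        in rmetric M i p u w = rmetric M j p (D u) (D w))"

subsection \<open>Completeness\<close>

definition curve_speed :: "('i, 'a, 'e::euclidean_space) riem_atlas \<Rightarrow> (real \<Rightarrow> 'a) \<Rightarrow> real \<Rightarrow> real" where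
  "curve_speed M \<gamma> t =
     (let i = chart_at M (\<gamma> t); u = vector_derivative (chart_map M i \<circ> \<gamma>) (at t)
      in sqrt (rmetric M i (\<gamma> t) u u))"

definition curve_length :: "('i, 'a, 'e::euclidean_space) riem_atlas \<Rightarrow> (real \<Rightarrow> 'a) \<Rightarrow> ennreal" where
  "curve_length M \<gamma> = (\<integral>\<^sup>+ t \<in> {0..1}. ennreal (curve_speed M \<gamma> t) \<partial>lborel)"

definition piecewise_C1_curve ::
  "('i, 'a::topological_space, 'e::euclidean_space) riem_atlas \<Rightarrow> (real \<Rightarrow> 'a) \<Rightarrow> bool" where
  "piecewise_C1_curve M \<gamma> \<longleftrightarrow>
     continuous_on {0..1} \<gamma> \<and> \<gamma> ` {0..1} \<subseteq> points M \<and>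
     (\<exists>S. finite S \<and> (\<forall>i\<in>chart_idx M.
        (chart_map M i \<circ> \<gamma>) C1_differentiable_on {t \<in> {0<..<1} - S. \<gamma> t \<in> chart_dom M i}))"

text \<open>The distance is \<open>\<infinity>\<close> between points of different components.\<close>

definition riem_dist ::
  "('i, 'a::topological_space, 'e::euclidean_space) riem_atlas \<Rightarrow> 'a \<Rightarrow> 'a \<Rightarrow> ennreal" where
  "riem_dist M p q =
     (INF \<gamma> \<in> {\<gamma>. piecewise_C1_curve M \<gamma> \<and> \<gamma> 0 = p \<and> \<gamma> 1 = q}. curve_length M \<gamma>)"

definition riem_complete ::
  "('i, 'a::topological_space, 'e::euclidean_space) riem_atlas \<Rightarrow> bool" where
  "riem_complete M \<longleftrightarrow>
     (\<forall>X :: nat \<Rightarrow> 'a.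
        range X \<subseteq> points M \<and>
        (\<forall>\<epsilon>>0. \<exists>K. \<forall>m\<ge>K. \<forall>k\<ge>K. riem_dist M (X m) (X k) < \<epsilon>)
        \<longrightarrow> (\<exists>p\<in>points M. (\<lambda>k. riem_dist M (X k) p) \<longlonglongrightarrow> 0))"

subsection \<open>Gradient, divergence, Laplacian, measure, test functions\<close>

definition rgrad ::
  "('i, 'a, 'e::euclidean_space) riem_atlas \<Rightarrow> ('a \<Rightarrow> real) \<Rightarrow> 'i \<Rightarrow> 'a \<Rightarrow> 'e" where
  "rgrad M f i p =
     (THE u. \<forall>w. rmetric M i p u w =
        frechet_derivative (f \<circ> chart_inv M i) (at (chart_map M i p)) w)"

text \<open>The squared length of a vector field.\<close>

definition rnorm2 ::
  "('i, 'a, 'e::euclidean_space) riem_atlas \<Rightarrow> ('i \<Rightarrow> 'a \<Rightarrow> 'e) \<Rightarrow> 'a \<Rightarrow> real" where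
  "rnorm2 M X p = (let i = chart_at M p in rmetric M i p (X i p) (X i p))"

text \<open>The determinant of the matrix of the metric (Leibniz formula), and the volume density
  in the coordinates of chart \<open>i\<close>.\<close>

definition metric_det ::
  "('i, 'a, 'e::euclidean_space) riem_atlas \<Rightarrow> 'i \<Rightarrow> 'a \<Rightarrow> real" where
  "metric_det M i p =
     (\<Sum>\<pi> | \<pi> permutes (Basis :: 'e set).
        of_int (sign \<pi>) * (\<Prod>b\<in>Basis. rmetric M i p b (\<pi> b)))"

definition vol_density ::
  "('i, 'a, 'e::euclidean_space) riem_atlas \<Rightarrow> 'i \<Rightarrow> 'e \<Rightarrow> real" where
  "vol_density M i x = sqrt (metric_det M i (chart_inv M i x))"

definition rdiv ::
  "('i, 'a, 'e::euclidean_space) riem_atlas \<Rightarrow> ('i \<Rightarrow> 'a \<Rightarrow> 'e) \<Rightarrow> 'a \<Rightarrow> real" where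
  "rdiv M X p =
     (let i = chart_at M p; x = chart_map M i p
      in (\<Sum>b\<in>Basis. frechet_derivative
            (\<lambda>y. vol_density M i y * (X i (chart_inv M i y) \<bullet> b)) (at x) b) / vol_density M i x)"

definition laplacian ::
  "('i, 'a, 'e::euclidean_space) riem_atlas \<Rightarrow> ('a \<Rightarrow> real) \<Rightarrow> 'a \<Rightarrow> real" where
  "laplacian M f = rdiv M (rgrad M f)"

text \<open>The Riemannian measure is the unique Borel measure with density \<open>vol_density\<close> with
  respect to Lebesgue measure in the coordinates of every chart.\<close>

definition is_riemannian_measure ::
  "('i, 'a::topological_space, 'e::euclidean_space) riem_atlas \<Rightarrow> 'a measure \<Rightarrow> bool" where
  "is_riemannian_measure M \<mu> \<longleftrightarrow>
     space \<mu> = points M \<and> sets \<mu> = sets (restrict_space borel (points M)) \<and>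
     (\<forall>i\<in>chart_idx M. \<forall>B\<in>sets borel. B \<subseteq> chart_dom M i \<longrightarrow>
        emeasure \<mu> B = (\<integral>\<^sup>+ x \<in> chart_map M i ` B. ennreal (vol_density M i x) \<partial>lborel))"

definition test_function ::
  "('i, 'a::topological_space, 'e::euclidean_space) riem_atlas \<Rightarrow> ('a \<Rightarrow> real) \<Rightarrow> bool" where
  "test_function M f \<longleftrightarrow>
     (\<forall>i\<in>chart_idx M. smooth_on (chart_img M i) (f \<circ> chart_inv M i)) \<and>
     (\<exists>K. compact K \<and> K \<subseteq> points M \<and> (\<forall>p\<in>points M - K. f p = 0))"

subsection \<open>Warped cylindrical ends\<close>

text \<open>The charts of \<open>(r\<^sub>0, \<infinity>) \<times> N\<close> are the products of the identity with the charts of \<open>N\<close>;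
  its dimension is \<open>DIM(real \<times> 'e) = DIM('e) + 1\<close>.\<close>

definition warped_end ::
  "real \<Rightarrow> (real \<Rightarrow> real) \<Rightarrow> ('i, 'a, 'e) riem_atlas \<Rightarrow> ('i, real \<times> 'a, real \<times> 'e) riem_atlas" where
  "warped_end r\<^sub>0 \<sigma> N =
     \<lparr> chart_idx = chart_idx N,
       chart_dom = (\<lambda>i. {r\<^sub>0<..} \<times> chart_dom N i),
       chart_map = (\<lambda>i. map_prod id (chart_map N i)),
       rmetric = (\<lambda>i (r, x) (s, u) (t, w). s * t + (\<sigma> r)\<^sup>2 * rmetric N i x u w) \<rparr>"

lemma points_warped_end: "points (warped_end r\<^sub>0 \<sigma> N) = {r\<^sub>0<..} \<times> points N"
  by (auto simp: points_def warped_end_def)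

end

theory Submission
  imports Defs
begin

text \<open>
  For \<open>b = - 2 F (\<partial>\<^sub>r v + F v)\<close> and \<open>\<psi> = b e\<^sup>h\<close> the inequality
  \<open>(\<Delta>v)\<^sup>2 \<ge> 2 b \<Delta>v - b\<^sup>2\<close> and Green's formula bound the right-hand side from below by
  \<open>- 2 \<integral>\<langle>\<nabla>v, \<nabla>\<psi>\<rangle> - \<integral>b\<^sup>2 e\<^sup>h\<close>, which contains only first derivatives of \<open>v\<close> and their radial
  derivatives. By Fubini it remains to prove a one-dimensional inequality on every ray
  \<open>(r\<^sub>0, \<infinity>) \<times> {x}\<close>, where the difference of the two sides is an exact derivative plus a sum of
  squares with nonnegative coefficients.

  Green's formula is obtained in a chart from translation invariance of Lebesgue measure and globally
  from a partition of unity. The independence of the Laplacian from the chart follows from the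
  weak formulation.
\<close>

subsection \<open>Functions of class C^k\<close>

text \<open>The factor \<open>b\<close> comes from conjugation. For \<open>\<phi>' = F\<close> and
  \<open>u = e\<^sup>\<phi> v\<close>, the operator that sends \<open>u\<close> to
  \<open>e\<^sup>\<phi> \<Delta>v\<close> has first-order part
  \<open>- 2 F \<partial>\<^sub>r u\<close>; divided by \<open>e\<^sup>\<phi>\<close>, this is
  \<open>b\<close>. The inequality drops the square of what remains of \<Delta>v after
  \<open>b\<close> is subtracted and keeps the cross term. The normalisation of \<open>F\<close>
  says that the radial weight \<open>\<sigma>\<^sup>m e\<^sup>h\<close> has logarithmic derivative
  \<open>2 F + G'\<close>. So \<open>G\<close> measures how far the weight is from the square of the
  conjugating factor. Regularity shapes the proof. As \<open>h\<close> and \<open>G\<close> are only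
  C^2, \<open>F\<close> and therefore \<psi> are only C^1, which allows one integration by parts
  against \<Delta>v on the manifold. All further ones take place on rays, where \<open>v\<close>
  supplies its own derivatives and \<open>A\<close> and \<open>k\<^sub>2\<close> are differentiated
  once. A second obstacle is that \<open>laplacian\<close> is evaluated in a chart picked by
  \<open>SOME\<close>, which may jump from point to point. Even its continuity, and so the
  integrability of its square, rests on independence of the chart.\<close>

abbreviation C1_on :: "'a::real_normed_vector set \<Rightarrow> ('a \<Rightarrow> 'b::real_normed_vector) \<Rightarrow> bool" where
  "C1_on \<equiv> Ck_on (Suc 0)"

lemma frechet_derivative_eqI:
  "(f has_derivative f') (at x) \<Longrightarrow> frechet_derivative f (at x) = f'"
  using frechet_derivative_at by metis

lemma Ck_on_mono: "T \<subseteq> S \<Longrightarrow> Ck_on k S f \<Longrightarrow> Ck_on k T f"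
proof (induction k arbitrary: f)
  case 0
  then show ?case using continuous_on_subset by auto
next
  case (Suc k)
  then show ?case by auto
qed

text \<open>Openness lets equality on \<open>S\<close> pass to the derivatives, because
  \<open>frechet_derivative\<close> depends on the values in a whole neighbourhood.\<close>

lemma Ck_on_cong:
  assumes "open S" "\<And>x. x \<in> S \<Longrightarrow> f x = g x" "Ck_on k S f"
  shows "Ck_on k S g"
  using assms(2,3)
proof (induction k arbitrary: f g)
  case 0
  then show ?case using continuous_on_cong by (metis Ck_on.simps(1))
next
  case (Suc k)
  have d: "(g has_derivative frechet_derivative f (at x)) (at x)" if "x \<in> S" for x
    using Suc.prems that assms(1) frechet_derivative_works has_derivative_transform_within_open
    by (metis Ck_on.simps(2))
  show ?case
    unfolding Ck_on.simps
  proof (intro conjI ballI allI)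
    show "g differentiable at x" if "x \<in> S" for x
      using d[OF that] differentiable_def by blast
    show "Ck_on k S (\<lambda>x. frechet_derivative g (at x) w)" for w
    proof (rule Suc.IH)
      show "Ck_on k S (\<lambda>x. frechet_derivative f (at x) w)"
        using Suc.prems by simp
      show "frechet_derivative f (at x) w = frechet_derivative g (at x) w" if "x \<in> S" for x
        using d[OF that] frechet_derivative_eqI by metis
    qed
  qed
qed

lemma Ck_on_SucI:
  assumes "open S" "\<And>x. x \<in> S \<Longrightarrow> (f has_derivative f' x) (at x)"
    and "\<And>w. Ck_on k S (\<lambda>x. f' x w)"
  shows "Ck_on (Suc k) S f"
  unfolding Ck_on.simps
proof (intro conjI ballI allI)
  show "f differentiable at x" if "x \<in> S" for x
    using assms(2)[OF that] differentiable_def by blast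
  show "Ck_on k S (\<lambda>x. frechet_derivative f (at x) w)" for w
    by (rule Ck_on_cong[OF assms(1) _ assms(3)[of w]])
       (use assms(2) frechet_derivative_eqI in metis)
qed

lemma Ck_on_frechet:
  "Ck_on (Suc k) S f \<Longrightarrow> Ck_on k S (\<lambda>x. frechet_derivative f (at x) w)"
  by simp

lemma Ck_on_SucD: "Ck_on (Suc k) S f \<Longrightarrow> Ck_on k S f"
proof (induction k arbitrary: f)
  case 0
  then show ?case
    by (auto intro!: continuous_at_imp_continuous_on differentiable_imp_continuous_within)
next
  case (Suc k)
  show ?case
    unfolding Ck_on.simps(2)[of k]
  proof (intro conjI ballI allI)
    show "f differentiable at x" if "x \<in> S" for x
      using Suc.prems that by simp
    show "Ck_on k S (\<lambda>x. frechet_derivative f (at x) w)" for w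
      using Suc.prems Suc.IH Ck_on_frechet by blast
  qed
qed

lemma Ck_on_le:
  assumes "Ck_on k S f" "j \<le> k"
  shows "Ck_on j S f"
  using assms(2,1) by (induction rule: inc_induct) (blast dest: Ck_on_SucD)+

lemma Ck_on_imp_continuous_on: "Ck_on k S f \<Longrightarrow> continuous_on S f"
  using Ck_on_le[of k S f 0] by simp

lemma Ck_on_has_derivative:
  assumes "Ck_on k S f" "k > 0" "x \<in> S"
  shows "(f has_derivative frechet_derivative f (at x)) (at x)"
  using assms frechet_derivative_works by (cases k) auto

lemma smooth_on_Ck: "smooth_on S f \<Longrightarrow> Ck_on k S f"
  by (simp add: smooth_on_def)

lemma Ck_on_const: "open S \<Longrightarrow> Ck_on k S (\<lambda>x. c)"
proof (induction k arbitrary: c)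
  case 0
  then show ?case by simp
next
  case (Suc k)
  show ?case by (rule Ck_on_SucI[where f' = "\<lambda>x w. 0"]) (use Suc in auto)
qed

lemma Ck_on_linear:
  assumes "open S" "bounded_linear f"
  shows "Ck_on k S f"
proof (cases k)
  case 0
  then show ?thesis using assms by (simp add: linear_continuous_on)
next
  case (Suc j)
  show ?thesis
    unfolding Suc
    by (rule Ck_on_SucI[where f' = "\<lambda>x. f"])
       (use assms Ck_on_const in \<open>auto intro: bounded_linear_imp_has_derivative\<close>)
qed

lemma Ck_on_add:
  assumes "open S"
  shows "Ck_on k S f \<Longrightarrow> Ck_on k S g \<Longrightarrow> Ck_on k S (\<lambda>x. f x + g x)"
proof (induction k arbitrary: f g)
  case 0
  then show ?case by (auto intro: continuous_on_add)
next
  case (Suc k)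
  show ?case
  proof (rule Ck_on_SucI[OF assms])
    show "((\<lambda>x. f x + g x) has_derivative
      (\<lambda>w. frechet_derivative f (at x) w + frechet_derivative g (at x) w)) (at x)" if "x \<in> S" for x
      using that Suc.prems by (auto intro!: has_derivative_add Ck_on_has_derivative[of "Suc k" S])
    show "Ck_on k S (\<lambda>x. frechet_derivative f (at x) w + frechet_derivative g (at x) w)" for w
      by (rule Suc.IH) (use Suc.prems in auto)
  qed
qed

lemma Ck_on_sum:
  assumes "open S" "\<And>i. i \<in> I \<Longrightarrow> Ck_on k S (f i)"
  shows "Ck_on k S (\<lambda>x. \<Sum>i\<in>I. f i x)"
  using assms(2)
  by (induction I rule: infinite_finite_induct) (auto intro: Ck_on_const Ck_on_add assms(1))

lemma Ck_on_bilinear: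
  assumes "open S" "bounded_bilinear prd"
  shows "Ck_on k S f \<Longrightarrow> Ck_on k S g \<Longrightarrow> Ck_on k S (\<lambda>x. prd (f x) (g x))"
proof (induction k arbitrary: f g)
  case 0
  then show ?case by (auto intro: bounded_bilinear.continuous_on[OF assms(2)])
next
  case (Suc k)
  show ?case
  proof (rule Ck_on_SucI[OF assms(1)])
    show "((\<lambda>x. prd (f x) (g x)) has_derivative
      (\<lambda>w. prd (f x) (frechet_derivative g (at x) w) + prd (frechet_derivative f (at x) w) (g x))) (at x)"
      if "x \<in> S" for x
      using that Suc.prems
      by (intro bounded_bilinear.FDERIV[OF assms(2)] Ck_on_has_derivative[of "Suc k" S]) auto
    show "Ck_on k S (\<lambda>x. prd (f x) (frechet_derivative g (at x) w)
        + prd (frechet_derivative f (at x) w) (g x))" for w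
      using Suc.IH Suc.prems Ck_on_SucD[OF Suc.prems(1)] Ck_on_SucD[OF Suc.prems(2)]
        Ck_on_frechet[OF Suc.prems(1), of w] Ck_on_frechet[OF Suc.prems(2), of w]
      by (intro Ck_on_add[OF assms(1)]) blast+
  qed
qed

lemma Ck_on_mult:
  fixes f g :: "'a::real_normed_vector \<Rightarrow> 'b::real_normed_algebra"
  shows "open S \<Longrightarrow> Ck_on k S f \<Longrightarrow> Ck_on k S g \<Longrightarrow> Ck_on k S (\<lambda>x. f x * g x)"
  by (rule Ck_on_bilinear[OF _ bounded_bilinear_mult])

lemma Ck_on_scaleR:
  "open S \<Longrightarrow> Ck_on k S f \<Longrightarrow> Ck_on k S g \<Longrightarrow> Ck_on k S (\<lambda>x. f x *\<^sub>R g x)"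
  by (rule Ck_on_bilinear[OF _ bounded_bilinear_scaleR])

lemma Ck_on_cmult:
  fixes f :: "'a::real_normed_vector \<Rightarrow> 'b::real_normed_algebra"
  shows "open S \<Longrightarrow> Ck_on k S f \<Longrightarrow> Ck_on k S (\<lambda>x. c * f x)"
  by (intro Ck_on_mult Ck_on_const)

lemma Ck_on_uminus: "open S \<Longrightarrow> Ck_on k S f \<Longrightarrow> Ck_on k S (\<lambda>x. - f x)"
  using Ck_on_scaleR[OF _ Ck_on_const[of S k "-1::real"], of f] by simp

lemma Ck_on_diff:
  "open S \<Longrightarrow> Ck_on k S f \<Longrightarrow> Ck_on k S g \<Longrightarrow> Ck_on k S (\<lambda>x. f x - g x)"
  using Ck_on_add[of S k f "\<lambda>x. - g x"] Ck_on_uminus[of S k g] by simp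

lemma Ck_on_prod:
  fixes f :: "'i \<Rightarrow> 'a::real_normed_vector \<Rightarrow> real"
  assumes "open S" "\<And>i. i \<in> I \<Longrightarrow> Ck_on k S (f i)"
  shows "Ck_on k S (\<lambda>x. \<Prod>i\<in>I. f i x)"
  using assms(2)
  by (induction I rule: infinite_finite_induct) (auto intro: Ck_on_const Ck_on_mult assms(1))

lemma Ck_on_power:
  fixes f :: "'a::real_normed_vector \<Rightarrow> real"
  assumes "open S" "Ck_on k S f"
  shows "Ck_on k S (\<lambda>x. f x ^ m)"
  by (induction m) (auto intro: Ck_on_const Ck_on_mult assms)

lemma Ck_on_compose_linear:
  assumes "open S" "bounded_linear L"
  shows "Ck_on k S f \<Longrightarrow> L ` T \<subseteq> S \<Longrightarrow> open T \<Longrightarrow> Ck_on k T (\<lambda>x. f (L x))"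
proof (induction k arbitrary: f)
  case 0
  then show ?case
    using continuous_on_compose2 linear_continuous_on[OF assms(2)] by (metis Ck_on.simps(1))
next
  case (Suc k)
  show ?case
  proof (rule Ck_on_SucI[OF Suc.prems(3)])
    show "((\<lambda>x. f (L x)) has_derivative (\<lambda>w. frechet_derivative f (at (L x)) (L w))) (at x)"
      if "x \<in> T" for x
    proof (rule has_derivative_compose[of L L])
      show "(L has_derivative L) (at x)" using assms(2) by (rule bounded_linear_imp_has_derivative)
      show "(f has_derivative frechet_derivative f (at (L x))) (at (L x))"
        using Suc.prems that by (intro Ck_on_has_derivative[of "Suc k" S]) auto
    qed
    show "Ck_on k T (\<lambda>x. frechet_derivative f (at (L x)) (L w))" for w
      by (rule Suc.IH) (use Suc.prems in auto)
  qed
qed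

lemma Ck_on_linear_compose:
  assumes "open S" "bounded_linear L" "Ck_on k S f"
  shows "Ck_on k S (\<lambda>x. L (f x))"
  using assms(3)
proof (induction k arbitrary: f)
  case 0
  then show ?case
    using bounded_linear.continuous_on[OF assms(2)] by simp
next
  case (Suc k)
  show ?case
  proof (rule Ck_on_SucI[OF assms(1)])
    show "((\<lambda>x. L (f x)) has_derivative (\<lambda>w. L (frechet_derivative f (at x) w))) (at x)"
      if "x \<in> S" for x
      using Suc.prems that
      by (intro bounded_linear.has_derivative[OF assms(2)] Ck_on_has_derivative[of "Suc k" S]) auto
    show "Ck_on k S (\<lambda>x. L (frechet_derivative f (at x) w))" for w
      by (rule Suc.IH) (use Suc.prems in auto)
  qed
qed

lemma Ck_on_Pair:
  assumes "open S" "Ck_on k S f" "Ck_on k S g"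
  shows "Ck_on k S (\<lambda>x. (f x, g x))"
proof -
  have "Ck_on k S (\<lambda>x. (f x, 0) + (0, g x))"
    using assms bounded_linear_Pair[OF bounded_linear_ident bounded_linear_zero]
      bounded_linear_Pair[OF bounded_linear_zero bounded_linear_ident]
    by (intro Ck_on_add) (auto intro: Ck_on_linear_compose[OF assms(1)])
  then show ?thesis by simp
qed

text \<open>Glues functions given by different formulas on open sets, such as bump functions and
  products extended by 0.\<close>

lemma Ck_on_local:
  assumes "\<And>x. x \<in> S \<Longrightarrow> \<exists>T. open T \<and> x \<in> T \<and> Ck_on k T f"
  shows "Ck_on k S f"
  using assms
proof (induction k arbitrary: f)
  case 0
  then show ?case
    by (metis Ck_on.simps(1) continuous_at_imp_continuous_on continuous_on_eq_continuous_at)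
next
  case (Suc k)
  show ?case
    unfolding Ck_on.simps
  proof (intro conjI ballI allI)
    show "f differentiable at x" if "x \<in> S" for x
      using Suc.prems[OF that] by auto
    show "Ck_on k S (\<lambda>x. frechet_derivative f (at x) w)" for w
      by (rule Suc.IH) (use Suc.prems in fastforce)
  qed
qed

lemma linear_sum_Basis:
  fixes f :: "'a::euclidean_space \<Rightarrow> 'b::real_vector"
  assumes "linear f"
  shows "f w = (\<Sum>b\<in>Basis. (w \<bullet> b) *\<^sub>R f b)"
proof -
  have "f w = f (\<Sum>b\<in>Basis. (w \<bullet> b) *\<^sub>R b)"
    by (simp add: euclidean_representation)
  also have "\<dots> = (\<Sum>b\<in>Basis. (w \<bullet> b) *\<^sub>R f b)"
    by (simp add: linear_sum[OF assms] linear_cmul[OF assms])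
  finally show ?thesis .
qed

text \<open>\<open>Ck_on\<close> gives continuity of the derivative in the base point for a fixed
  direction only. Expanding a varying direction in \<open>Basis\<close> reduces the claim to
  finitely many fixed ones.\<close>

lemma C1_on_frechet_continuous:
  fixes f :: "'a::euclidean_space \<Rightarrow> 'b::real_normed_vector"
  assumes f: "C1_on T f" and "continuous_on S u" "continuous_on S w" "u ` S \<subseteq> T"
  shows "continuous_on S (\<lambda>x. frechet_derivative f (at (u x)) (w x))"
proof -
  have lin: "linear (frechet_derivative f (at (u x)))" if "x \<in> S" for x
    using f assms(4) that linear_frechet_derivative by auto
  have "continuous_on S (\<lambda>x. \<Sum>b\<in>Basis. (w x \<bullet> b) *\<^sub>R frechet_derivative f (at (u x)) b)"
  proof (intro continuous_on_sum continuous_on_scaleR continuous_intros assms)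
    show "continuous_on S (\<lambda>x. frechet_derivative f (at (u x)) b)" for b
      by (rule continuous_on_compose2[of T "\<lambda>y. frechet_derivative f (at y) b"])
         (use assms in auto)
  qed
  then show ?thesis
    by (rule continuous_on_eq) (metis lin linear_sum_Basis)
qed

lemma C1_on_compose:
  fixes f :: "'a::real_normed_vector \<Rightarrow> 'b::euclidean_space"
  assumes "open S" and f: "C1_on S f" and g: "C1_on T g" and sub: "f ` S \<subseteq> T"
  shows "C1_on S (\<lambda>x. g (f x))"
proof (rule Ck_on_SucI[OF assms(1)])
  show "((\<lambda>x. g (f x)) has_derivative
      (\<lambda>w. frechet_derivative g (at (f x)) (frechet_derivative f (at x) w))) (at x)" if "x \<in> S" for x
    by (rule has_derivative_compose[of f])
       (use assms that in \<open>auto intro: Ck_on_has_derivative[of "Suc 0"] simp del: Ck_on.simps\<close>)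
  show "Ck_on 0 S (\<lambda>x. frechet_derivative g (at (f x)) (frechet_derivative f (at x) w))" for w
    using C1_on_frechet_continuous[OF g _ _ sub] f Ck_on_imp_continuous_on[OF f] by simp
qed

lemma C1_on_realI:
  fixes f :: "real \<Rightarrow> real"
  assumes "open S" "\<And>x. x \<in> S \<Longrightarrow> (f has_real_derivative f' x) (at x)" "continuous_on S f'"
  shows "C1_on S f"
proof (rule Ck_on_SucI[OF assms(1)])
  show "(f has_derivative (*) (f' x)) (at x)" if "x \<in> S" for x
    using assms(2)[OF that] by (simp add: has_field_derivative_def)
  show "Ck_on 0 S (\<lambda>x. f' x * w)" for w
    using assms(3) by (auto intro: continuous_on_mult_right)
qed

lemma Ck_on_deriv:
  fixes f :: "real \<Rightarrow> real"
  assumes "Ck_on (Suc k) S f" "open S"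
  shows "Ck_on k S (deriv f)" "\<And>x. x \<in> S \<Longrightarrow> (f has_real_derivative deriv f x) (at x)"
proof -
  have fd: "(f has_real_derivative frechet_derivative f (at x) 1) (at x)" if "x \<in> S" for x
  proof -
    have d: "(f has_derivative frechet_derivative f (at x)) (at x)"
      using Ck_on_has_derivative[OF assms(1) _ that] by simp
    have "frechet_derivative f (at x) w = frechet_derivative f (at x) 1 * w" for w
      using linear_cmul[OF has_derivative_linear[OF d], of w 1] by (metis mult.commute mult.right_neutral real_scaleR_def)
    then have "frechet_derivative f (at x) = (*) (frechet_derivative f (at x) 1)"
      by (rule ext)
    then show ?thesis
      using d by (simp add: has_field_derivative_def)
  qed
  then have "deriv f x = frechet_derivative f (at x) 1" if "x \<in> S" for x
    using that DERIV_imp_deriv by blast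
  then show "\<And>x. x \<in> S \<Longrightarrow> (f has_real_derivative deriv f x) (at x)"
    using fd by simp
  show "Ck_on k S (deriv f)"
    by (rule Ck_on_cong[OF assms(2) _ Ck_on_frechet[OF assms(1), of 1]])
       (use fd DERIV_imp_deriv in metis)
qed

lemma C1_on_inverse:
  fixes f :: "'a::real_normed_vector \<Rightarrow> real"
  assumes "open S" "C1_on S f" "\<And>x. x \<in> S \<Longrightarrow> f x \<noteq> 0"
  shows "C1_on S (\<lambda>x. inverse (f x))"
proof (rule C1_on_compose[OF assms(1,2), of "- {0}"])
  show "C1_on (- {0::real}) inverse"
  proof (rule C1_on_realI)
    show "(inverse has_real_derivative - (inverse x ^ Suc (Suc 0))) (at x)" if "x \<in> - {0}" for x :: real
      using that by (intro DERIV_inverse) auto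
    show "continuous_on (- {0}) (\<lambda>x::real. - (inverse x ^ Suc (Suc 0)))"
      by (intro continuous_intros) auto
  qed auto
qed (use assms in auto)

lemma C1_on_divide:
  fixes f :: "'a::real_normed_vector \<Rightarrow> real"
  assumes "open S" "C1_on S g" "C1_on S f" "\<And>x. x \<in> S \<Longrightarrow> f x \<noteq> 0"
  shows "C1_on S (\<lambda>x. g x / f x)"
  unfolding divide_inverse using assms by (intro Ck_on_mult C1_on_inverse)

lemma C1_on_sqrt:
  fixes f :: "'a::real_normed_vector \<Rightarrow> real"
  assumes "open S" "C1_on S f" "\<And>x. x \<in> S \<Longrightarrow> f x > 0"
  shows "C1_on S (\<lambda>x. sqrt (f x))"
proof (rule C1_on_compose[OF assms(1,2), of "{0<..}"])
  show "C1_on {0::real<..} sqrt"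
  proof (rule C1_on_realI)
    show "(sqrt has_real_derivative inverse (sqrt x) / 2) (at x)" if "x \<in> {0<..}" for x :: real
      using that by (intro DERIV_real_sqrt) auto
    show "continuous_on {0<..} (\<lambda>x::real. inverse (sqrt x) / 2)"
      by (intro continuous_intros) auto
  qed auto
qed (use assms in auto)

lemma C1_on_exp:
  fixes f :: "'a::real_normed_vector \<Rightarrow> real"
  assumes "open S" "C1_on S f"
  shows "C1_on S (\<lambda>x. exp (f x))"
proof (rule C1_on_compose[OF assms(1,2), of UNIV])
  show "C1_on UNIV (exp :: real \<Rightarrow> real)"
    by (rule C1_on_realI[where f' = exp]) (auto intro!: continuous_intros)
qed auto

subsection \<open>Gram determinants and the Riesz representation\<close>

text \<open>Indexing square matrices by \<open>Basis\<close> makes the library's determinants and Cramer's rule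
  available on an arbitrary Euclidean space.\<close>

typedef (overloaded) ('e::euclidean_space) basis_index = "Basis :: 'e set"
  using nonempty_Basis by blast

lemma bij_Rep_basis_index:
  "bij_betw Rep_basis_index UNIV (Basis :: 'e::euclidean_space set)"
  using type_definition.Rep_range[OF type_definition_basis_index]
  by (auto simp: bij_betw_def inj_on_def Rep_basis_index_inject)

instance basis_index :: (euclidean_space) finite
proof
  show "finite (UNIV :: 'a basis_index set)"
    using bij_betw_finite[OF bij_Rep_basis_index] by auto
qed

text \<open>The index set is a parameter, so that one Leibniz sum serves \<open>Basis\<close>, the
  index type of matrices, and the basis of a product space with one vector split off.\<close>

definition gram_det :: "'a set \<Rightarrow> ('a \<Rightarrow> 'a \<Rightarrow> real) \<Rightarrow> real" where
  "gram_det S f = (\<Sum>\<pi> | \<pi> permutes S. of_int (sign \<pi>) * (\<Prod>b\<in>S. f b (\<pi> b)))"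

text \<open>Conjugation by the bijection matches the permutations of the two sets and preserves the
  sign.\<close>

lemma gram_det_reindex:
  assumes "bij_betw h S T" "finite S"
  shows "gram_det T f = gram_det S (\<lambda>a b. f (h a) (h b))"
proof -
  let ?g = "inv_into S h"
  have inj: "inj_on h S" and img: "h ` S = T" using assms(1) by (auto simp: bij_betw_def)
  have g: "bij_betw ?g T S" using assms(1) by (rule bij_betw_inv_into)
  show ?thesis
    unfolding gram_det_def
  proof (rule sum.reindex_bij_witness[where i = "map_permutation S h" and j = "map_permutation T ?g"])
    fix \<pi> assume "\<pi> \<in> {\<pi>. \<pi> permutes T}"
    then have p: "\<pi> permutes T" by simp
    show "map_permutation S h (map_permutation T ?g \<pi>) = \<pi>"
      by (rule map_permutation_compose_inv[OF g p]) (use img in \<open>auto intro: f_inv_into_f\<close>)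
    show "map_permutation T ?g \<pi> \<in> {\<pi>. \<pi> permutes S}"
      using map_permutation_permutes[OF g p] by simp
    have s: "sign (map_permutation T ?g \<pi>) = sign \<pi>"
      by (rule sign_map_permutation) (use g p assms(2) img in \<open>auto simp: bij_betw_def\<close>)
    have "h (map_permutation T ?g \<pi> x) = \<pi> (h x)" if "x \<in> S" for x
    proof -
      have "map_permutation T ?g \<pi> (?g (h x)) = ?g (\<pi> (h x))"
        by (rule map_permutation_apply) (use g that img in \<open>auto simp: bij_betw_def\<close>)
      moreover have "\<pi> (h x) \<in> T" using that img permutes_in_image[OF p, of "h x"] by blast
      ultimately show ?thesis
        using that inj img by (simp add: f_inv_into_f)
    qed
    then have "(\<Prod>b\<in>S. f (h b) (h (map_permutation T ?g \<pi> b))) = (\<Prod>b\<in>S. f (h b) (\<pi> (h b)))"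
      by simp
    also have "\<dots> = (\<Prod>b\<in>T. f b (\<pi> b))"
      using prod.reindex[OF inj, of "\<lambda>b. f b (\<pi> b)"] img by (simp add: o_def)
    finally show "of_int (sign (map_permutation T ?g \<pi>)) *
        (\<Prod>b\<in>S. f (h b) (h (map_permutation T ?g \<pi> b))) = of_int (sign \<pi>) * (\<Prod>b\<in>T. f b (\<pi> b))"
      using s by simp
  next
    fix \<pi> assume "\<pi> \<in> {\<pi>. \<pi> permutes S}"
    then have p: "\<pi> permutes S" by simp
    show "map_permutation T ?g (map_permutation S h \<pi>) = \<pi>"
      by (rule map_permutation_compose_inv[OF assms(1) p]) (use inj in auto)
    show "map_permutation S h \<pi> \<in> {\<pi>. \<pi> permutes T}"
      using map_permutation_permutes[OF assms(1) p] by simp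
  qed
qed

text \<open>A permutation that moves \<open>z\<close> contributes a vanishing factor
  \<open>f z (\<pi> z)\<close>, so only the permutations of \<open>S\<close> survive. This later
  separates the radial direction from \<open>N\<close>.\<close>

lemma gram_det_insert:
  assumes "finite S" "z \<notin> S" "\<And>b. b \<in> S \<Longrightarrow> f z b = 0"
  shows "gram_det (insert z S) f = f z z * gram_det S f"
proof -
  have "gram_det (insert z S) f
      = (\<Sum>\<pi> | \<pi> permutes S. of_int (sign \<pi>) * (\<Prod>b\<in>insert z S. f b (\<pi> b)))"
    unfolding gram_det_def
  proof (rule sum.mono_neutral_right)
    show "finite {\<pi>. \<pi> permutes insert z S}" using assms by (simp add: finite_permutations)
    show "{\<pi>. \<pi> permutes S} \<subseteq> {\<pi>. \<pi> permutes insert z S}"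
      using permutes_subset by blast
    show "\<forall>\<pi>\<in>{\<pi>. \<pi> permutes insert z S} - {\<pi>. \<pi> permutes S}.
        of_int (sign \<pi>) * (\<Prod>b\<in>insert z S. f b (\<pi> b)) = 0"
    proof
      fix \<pi> assume \<pi>: "\<pi> \<in> {\<pi>. \<pi> permutes insert z S} - {\<pi>. \<pi> permutes S}"
      then have "\<pi> z \<noteq> z" using permutes_superset[of \<pi> "insert z S" S] by auto
      moreover have "\<pi> z \<in> insert z S" using \<pi> permutes_in_image[of \<pi> "insert z S" z] by simp
      ultimately have "f z (\<pi> z) = 0" using assms(3) by auto
      then show "of_int (sign \<pi>) * (\<Prod>b\<in>insert z S. f b (\<pi> b)) = 0"
        using assms(1) by (simp add: prod_zero_iff)
    qed
  qed
  also have "\<dots> = (\<Sum>\<pi> | \<pi> permutes S. f z z * (of_int (sign \<pi>) * (\<Prod>b\<in>S. f b (\<pi> b))))"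
    using assms(1,2) by (intro sum.cong refl) (simp add: permutes_not_in)
  finally show ?thesis by (simp add: gram_det_def sum_distrib_left)
qed

lemma gram_det_scale: "gram_det S (\<lambda>a b. c * f a b) = c ^ card S * gram_det S f"
  by (simp add: gram_det_def prod.distrib sum_distrib_left mult.left_commute)

lemma C1_on_gram_det:
  assumes "open T" "\<And>a b. a \<in> S \<Longrightarrow> b \<in> S \<Longrightarrow> Ck_on k T (\<lambda>x. f x a b)"
  shows "Ck_on k T (\<lambda>x. gram_det S (f x))"
  unfolding gram_det_def
  by (intro Ck_on_sum Ck_on_cmult Ck_on_prod assms) (auto dest: permutes_in_image)

lemma det_eq_gram_det: "det A = gram_det UNIV (\<lambda>i j. A $ i $ j)"
  by (simp add: det_def gram_det_def)

definition pos_def_form :: "('e::euclidean_space \<Rightarrow> 'e \<Rightarrow> real) \<Rightarrow> bool" where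
  "pos_def_form B \<longleftrightarrow> bilinear B \<and> (\<forall>u w. B u w = B w u) \<and> (\<forall>u. u \<noteq> 0 \<longrightarrow> B u u > 0)"

definition gram_matrix :: "('e::euclidean_space \<Rightarrow> 'e \<Rightarrow> real) \<Rightarrow> real ^ 'e basis_index ^ 'e basis_index" where
  "gram_matrix B = (\<chi> i j. B (Rep_basis_index i) (Rep_basis_index j))"

lemma det_gram_matrix: "det (gram_matrix B) = gram_det Basis B"
  by (simp add: det_eq_gram_det gram_matrix_def gram_det_reindex[OF bij_Rep_basis_index finite])

lemma sum_basis_index:
  "(\<Sum>j\<in>UNIV. f (Rep_basis_index j)) = (\<Sum>b\<in>Basis. f b)"
  by (rule sum.reindex_bij_betw[OF bij_Rep_basis_index])

text \<open>Writes \<open>B u\<close> as a linear system for the components of \<open>u\<close>, for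
  use with the kernel of the Gram matrix and with Cramer's rule.\<close>

lemma gram_matrix_mult:
  fixes u :: "'e::euclidean_space"
  assumes "pos_def_form B"
  shows "gram_matrix B *v (\<chi> j. u \<bullet> Rep_basis_index j) = (\<chi> i. B u (Rep_basis_index i))"
proof -
  have "linear (B c)" for c using assms by (simp add: pos_def_form_def bilinear_def)
  then have "B c u = (\<Sum>b\<in>Basis. (u \<bullet> b) * B c b)" for c
    using linear_sum_Basis[of "B c" u] by simp
  then have "B u c = (\<Sum>b\<in>Basis. (u \<bullet> b) * B c b)" for c
    using assms by (metis pos_def_form_def)
  then show ?thesis
    using sum_basis_index[of "\<lambda>b. (u \<bullet> b) * B _ b"]
    by (simp add: vec_eq_iff matrix_vector_mult_def gram_matrix_def mult.commute[of "B _ _"])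
qed

text \<open>A kernel vector of the Gram matrix is the coordinate vector of some \<open>u\<close>
  with \<open>B u b = 0\<close> for all basis vectors \<open>b\<close>. Then
  \<open>B u u = 0\<close>, and \<open>u = 0\<close> by definiteness.\<close>

lemma pos_def_form_det_nz:
  fixes B :: "'e::euclidean_space \<Rightarrow> 'e \<Rightarrow> real"
  assumes "pos_def_form B"
  shows "gram_det Basis B \<noteq> 0"
proof -
  let ?A = "gram_matrix B"
  have "x = 0" if "?A *v x = 0" for x
  proof -
    define u where "u = (\<Sum>j\<in>UNIV. x $ j *\<^sub>R Rep_basis_index j)"
    have "x $ k = u \<bullet> Rep_basis_index k" for k
      unfolding u_def inner_sum_left
      by (subst sum.remove[of _ k])
         (auto simp: inner_Basis Rep_basis_index Rep_basis_index_inject intro!: sum.neutral)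
    then have x: "x = (\<chi> j. u \<bullet> Rep_basis_index j)" by (simp add: vec_eq_iff)
    have "B u (Rep_basis_index i) = 0" for i
      using that gram_matrix_mult[OF assms, of u] x by (simp add: vec_eq_iff)
    then have "B u b = 0" if "b \<in> Basis" for b using that by (metis Rep_basis_index_cases)
    moreover have "linear (B u)" using assms by (simp add: pos_def_form_def bilinear_def)
    ultimately have "B u u = 0" using linear_sum_Basis[of "B u" u] by simp
    then have "u = 0" using assms by (metis pos_def_form_def less_irrefl)
    then show ?thesis using x by (simp add: vec_eq_iff)
  qed
  then have "invertible ?A"
    using invertible_left_inverse matrix_left_invertible_ker by blast
  then show ?thesis by (simp add: invertible_det_nz det_gram_matrix)
qed

text \<open>The segment from the standard inner product to \<open>B\<close> stays inside the
  positive definite forms. Along it the determinant is continuous, starts at 1 and never vanishes,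
  so it cannot change sign.\<close>

lemma pos_def_form_det_pos:
  fixes B :: "'e::euclidean_space \<Rightarrow> 'e \<Rightarrow> real"
  assumes B: "pos_def_form B"
  shows "gram_det Basis B > 0"
proof (rule ccontr)
  assume neg: "\<not> gram_det Basis B > 0"
  define C where "C t u w = (1 - t) * (u \<bullet> w) + t * B u w" for t :: real and u w :: 'e
  have pd: "pos_def_form (C t)" if "t \<in> {0..1}" for t
    unfolding pos_def_form_def
  proof (intro conjI allI impI)
    have "linear (B u)" "linear (\<lambda>w. B w u)" for u
      using B by (auto simp: pos_def_form_def bilinear_def)
    then show "bilinear (C t)"
      by (auto simp: bilinear_def C_def linear_iff algebra_simps)
    show "C t u w = C t w u" for u w
      using B by (simp add: C_def pos_def_form_def inner_commute)
    show "C t u u > 0" if "u \<noteq> 0" for u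
    proof -
      have "B u u > 0" "u \<bullet> u > 0" using that B by (auto simp: pos_def_form_def)
      then show ?thesis
        using \<open>t \<in> {0..1}\<close> unfolding C_def
        by (cases "t = 0") (auto intro!: add_nonneg_pos)
    qed
  qed
  have cont: "continuous_on {0..1} (\<lambda>t. gram_det Basis (C t))"
    unfolding gram_det_def C_def by (intro continuous_intros)
  have "gram_matrix (C 0) = mat 1"
    by (auto simp: gram_matrix_def C_def mat_def vec_eq_iff inner_Basis Rep_basis_index
        Rep_basis_index_inject)
  then have "gram_det Basis (C 0) = 1" by (metis det_I det_gram_matrix)
  moreover have "C 1 = B" by (simp add: C_def fun_eq_iff)
  then have "gram_det Basis (C 1) \<le> 0" using neg by simp
  ultimately obtain t where "0 \<le> t" "t \<le> 1" "gram_det Basis (C t) = 0"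
    using IVT2'[of "\<lambda>t. gram_det Basis (C t)" 1 0 0] cont by auto
  then show False using pos_def_form_det_nz pd by auto
qed

text \<open>\<open>T\<close> encodes the functional \<open>B u\<close> as a vector through its
  values on \<open>Basis\<close>. Definiteness makes this endomorphism injective, hence surjective
  in finite dimension.\<close>

lemma pos_def_form_riesz:
  fixes B :: "'e::euclidean_space \<Rightarrow> 'e \<Rightarrow> real"
  assumes B: "pos_def_form B" and l: "linear l"
  shows "\<exists>!u. \<forall>w. B u w = l w"
proof -
  have lin: "linear (B u)" "linear (\<lambda>w. B w u)" for u
    using B by (auto simp: pos_def_form_def bilinear_def)
  define T where "T u = (\<Sum>b\<in>Basis. B u b *\<^sub>R b)" for u
  have T: "T u \<bullet> b = B u b" if "b \<in> Basis" for u b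
    using that by (simp add: T_def inner_sum_left_Basis)
  have linT: "linear T"
  proof (rule linearI)
    show "T (u + w) = T u + T w" for u w
    proof -
      have "B (u + w) b = B u b + B w b" for b using linear_add[OF lin(2)[of b]] .
      then show ?thesis by (simp add: T_def scaleR_add_left sum.distrib)
    qed
    show "T (c *\<^sub>R u) = c *\<^sub>R T u" for c u
    proof -
      have "B (c *\<^sub>R u) b = c * B u b" for b using linear_cmul[OF lin(2)[of b], of c u] by simp
      then show ?thesis by (simp add: T_def scaleR_sum_right)
    qed
  qed
  have uniq: "u = 0" if "\<forall>w. B u w = 0" for u
    using that B by (metis pos_def_form_def less_irrefl)
  have "inj T"
    unfolding linear_injective_0[OF linT]
  proof (intro allI impI)
    fix u assume "T u = 0"
    then have "B u b = 0" if "b \<in> Basis" for b using T[OF that] by (metis inner_zero_left)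
    then have "B u w = 0" for w using linear_sum_Basis[OF lin(1), of u w] by simp
    then show "u = 0" using uniq by blast
  qed
  then have "surj T" using linear_injective_imp_surjective[OF linT] by blast
  then obtain u where u: "T u = (\<Sum>b\<in>Basis. l b *\<^sub>R b)" by (metis surjD)
  have "B u b = l b" if "b \<in> Basis" for b
    using T[OF that, of u] that unfolding u by (simp add: inner_sum_left_Basis)
  then have "B u w = l w" for w
    using linear_sum_Basis[OF lin(1), of u w] linear_sum_Basis[OF l, of w] by simp
  moreover have "u' = u" if "\<forall>w. B u' w = l w" for u'
    using uniq[of "u' - u"] that calculation linear_diff[OF lin(2)] by simp
  ultimately show ?thesis by blast
qed

text \<open>By Cramer's rule each component of the representing vector is a quotient of determinants
  with C^1 entries. It yields the regularity of gradients in a chart and, with a constant form, of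
  the gradient along \<open>N\<close> as a function of \<open>r\<close>.\<close>

lemma C1_on_riesz:
  fixes B :: "'y::real_normed_vector \<Rightarrow> 'e::euclidean_space \<Rightarrow> 'e \<Rightarrow> real"
  assumes S: "open S" and B: "\<And>y. y \<in> S \<Longrightarrow> pos_def_form (B y)"
    and BC: "\<And>u w. C1_on S (\<lambda>y. B y u w)"
    and lC: "\<And>w. C1_on S (\<lambda>y. l y w)"
    and X: "\<And>y w. y \<in> S \<Longrightarrow> B y (X y) w = l y w"
  shows "C1_on S X"
proof -
  let ?R = "Rep_basis_index :: 'e basis_index \<Rightarrow> 'e"
  \<comment> \<open>The numerator in Cramer's rule: column \<open>k\<close> is replaced by the
    right-hand side.\<close>
  define num where "num k y = det (\<chi> i j. if j = k then l y (?R i) else B y (?R i) (?R j))"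
    for k y
  have num: "C1_on S (num k)" for k
    unfolding num_def det_eq_gram_det
  proof (rule C1_on_gram_det[OF S])
    show "C1_on S (\<lambda>y. (\<chi> i j. if j = k then l y (?R i) else B y (?R i) (?R j)) $ a $ b)"
      for a b
      by (cases "b = k") (simp_all add: lC BC del: Ck_on.simps)
  qed
  have den: "C1_on S (\<lambda>y. gram_det Basis (B y))"
    by (rule C1_on_gram_det[OF S BC])
  have "C1_on S (\<lambda>y. \<Sum>k\<in>UNIV. (num k y / gram_det Basis (B y)) *\<^sub>R ?R k)"
    by (intro Ck_on_sum Ck_on_scaleR Ck_on_const C1_on_divide S num den)
       (use B pos_def_form_det_nz in auto)
  then show ?thesis
  proof (rule Ck_on_cong[OF S, rotated])
    show "(\<Sum>k\<in>UNIV. (num k y / gram_det Basis (B y)) *\<^sub>R ?R k) = X y" if "y \<in> S" for y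
  proof -
    have "gram_matrix (B y) *v (\<chi> j. X y \<bullet> ?R j) = (\<chi> i. l y (?R i))"
      using gram_matrix_mult[OF B[OF that], of "X y"] X[OF that] by simp
    moreover have "det (gram_matrix (B y)) \<noteq> 0"
      using pos_def_form_det_nz[OF B[OF that]] by (simp add: det_gram_matrix)
    ultimately have "(\<chi> j. X y \<bullet> ?R j) = (\<chi> k. det (\<chi> i j. if j = k
        then (\<chi> i. l y (?R i)) $ i else gram_matrix (B y) $ i $ j) / det (gram_matrix (B y)))"
      using cramer by blast
    then have "(\<chi> j. X y \<bullet> ?R j) = (\<chi> k. num k y / gram_det Basis (B y))"
      unfolding num_def det_gram_matrix by (simp add: gram_matrix_def cong: if_cong)
    then have "X y \<bullet> ?R k = num k y / gram_det Basis (B y)" for k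
      by (simp add: vec_eq_iff)
    then have "(\<Sum>k\<in>UNIV. (num k y / gram_det Basis (B y)) *\<^sub>R ?R k) = (\<Sum>b\<in>Basis. (X y \<bullet> b) *\<^sub>R b)"
      using sum_basis_index[of "\<lambda>b. (X y \<bullet> b) *\<^sub>R b"] by simp
    then show ?thesis by (simp add: euclidean_representation)
  qed
  qed
qed

subsection \<open>Mixed partial derivatives and integrals of partial derivatives\<close>

lemma C1_on_translate_field_derivative:
  fixes f :: "'a::real_normed_vector \<Rightarrow> real"
  assumes "C1_on S f" "x + t *\<^sub>R u \<in> S"
  shows "((\<lambda>t. f (x + t *\<^sub>R u)) has_real_derivative frechet_derivative f (at (x + t *\<^sub>R u)) u) (at t)"
proof -
  have d: "(f has_derivative frechet_derivative f (at (x + t *\<^sub>R u))) (at (x + t *\<^sub>R u))"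
    using Ck_on_has_derivative[OF assms(1) _ assms(2)] by simp
  have "((\<lambda>t. f (x + t *\<^sub>R u)) has_derivative
      (\<lambda>s. frechet_derivative f (at (x + t *\<^sub>R u)) (s *\<^sub>R u))) (at t)"
    by (rule has_derivative_compose[where f = "\<lambda>t. x + t *\<^sub>R u" and g = f, OF _ d])
       (auto intro!: derivative_eq_intros)
  moreover have "frechet_derivative f (at (x + t *\<^sub>R u)) (s *\<^sub>R u)
      = frechet_derivative f (at (x + t *\<^sub>R u)) u * s" for s
    using linear_cmul[OF has_derivative_linear[OF d], of s u] by simp
  ultimately show ?thesis by (simp add: has_field_derivative_def)
qed

lemma C1_mean_value:
  fixes f :: "'a::real_normed_vector \<Rightarrow> real"
  assumes f: "C1_on S f" and "h > 0" and S: "\<And>t. 0 \<le> t \<Longrightarrow> t \<le> h \<Longrightarrow> x + t *\<^sub>R u \<in> S"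
  obtains t where "0 < t" "t < h"
    "f (x + h *\<^sub>R u) - f x = h * frechet_derivative f (at (x + t *\<^sub>R u)) u"
proof -
  have "\<exists>z. 0 < z \<and> z < h \<and> f (x + h *\<^sub>R u) - f (x + 0 *\<^sub>R u)
      = (h - 0) * frechet_derivative f (at (x + z *\<^sub>R u)) u"
    by (rule MVT2[OF \<open>h > 0\<close>]) (use C1_on_translate_field_derivative[OF f] S in auto)
  then show thesis using that by auto
qed

text \<open>Both iterated derivatives are limits of the same second difference quotient.\<close>

lemma frechet_derivative_symmetric:
  fixes f :: "'a::real_normed_vector \<Rightarrow> real"
  assumes S: "open S" and f: "Ck_on 2 S f" and x: "x \<in> S"
  shows "frechet_derivative (\<lambda>y. frechet_derivative f (at y) u) (at x) w
       = frechet_derivative (\<lambda>y. frechet_derivative f (at y) w) (at x) u"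
proof -
  define D where "D u y = frechet_derivative f (at y) u" for u y
  have f1: "C1_on S f" by (rule Ck_on_le[OF f]) simp
  have D1: "C1_on S (D u)" for u
    using f unfolding D_def by (simp add: numeral_2_eq_2)
  define DD where "DD u w y = frechet_derivative (D u) (at y) w" for u w y
  have DDc: "continuous_on S (DD u w)" for u w
    using D1 unfolding DD_def by simp
  \<comment> \<open>The mean value theorem in direction \<open>u\<close>, applied to the increment
    of \<open>f\<close> by \<open>h *\<^sub>R w\<close>, and then in direction \<open>w\<close>,
    applied to \<open>D u\<close>. The left-hand side is symmetric in \<open>u\<close> and
    \<open>w\<close>.\<close>
  have key: "\<exists>s t. 0 < s \<and> s < h \<and> 0 < t \<and> t < h \<and>
      f (x + h *\<^sub>R u + h *\<^sub>R w) - f (x + h *\<^sub>R u) - f (x + h *\<^sub>R w) + f x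
        = h * h * DD u w (x + s *\<^sub>R u + t *\<^sub>R w)"
    if h: "h > 0" and sub: "\<And>s t. 0 \<le> s \<Longrightarrow> s \<le> h \<Longrightarrow> 0 \<le> t \<Longrightarrow> t \<le> h \<Longrightarrow> x + s *\<^sub>R u + t *\<^sub>R w \<in> S"
    for h u w
  proof -
    have d: "((\<lambda>s. f (x + h *\<^sub>R w + s *\<^sub>R u) - f (x + s *\<^sub>R u)) has_real_derivative
        D u (x + h *\<^sub>R w + s *\<^sub>R u) - D u (x + s *\<^sub>R u)) (at s)" if "0 \<le> s" "s \<le> h" for s
      unfolding D_def
      by (intro DERIV_diff C1_on_translate_field_derivative[OF f1])
         (use sub[of s 0] sub[of s h] that h in \<open>auto simp: add_ac\<close>)
    obtain s where s: "0 < s" "s < h"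
      "(f (x + h *\<^sub>R w + h *\<^sub>R u) - f (x + h *\<^sub>R u)) - (f (x + h *\<^sub>R w + 0 *\<^sub>R u) - f (x + 0 *\<^sub>R u))
        = (h - 0) * (D u (x + h *\<^sub>R w + s *\<^sub>R u) - D u (x + s *\<^sub>R u))"
      using MVT2[OF h d] by blast
    obtain t where t: "0 < t" "t < h"
      "D u (x + s *\<^sub>R u + h *\<^sub>R w) - D u (x + s *\<^sub>R u) = h * frechet_derivative (D u) (at (x + s *\<^sub>R u + t *\<^sub>R w)) w"
      by (rule C1_mean_value[OF D1 h, of "x + s *\<^sub>R u" w]) (use sub s in auto)
    show ?thesis
      using s t by (intro exI[of _ s] exI[of _ t]) (auto simp: DD_def add_ac)
  qed
  have "DD u w x = DD w u x"
  proof (rule ccontr)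
    assume ne: "DD u w x \<noteq> DD w u x"
    \<comment> \<open>Half the gap: below, the two second derivatives take a common value that lies
      within \<epsilon> of each of their values at \<open>x\<close>.\<close>
    define \<epsilon> where "\<epsilon> = \<bar>DD u w x - DD w u x\<bar> / 2"
    have "\<epsilon> > 0" using ne by (simp add: \<epsilon>_def)
    have "\<forall>\<^sub>F y in at x within S. dist (DD u w y) (DD u w x) < \<epsilon>"
         "\<forall>\<^sub>F y in at x within S. dist (DD w u y) (DD w u x) < \<epsilon>"
      using DDc x \<open>\<epsilon> > 0\<close> by (auto simp: continuous_on_def tendsto_iff)
    moreover have "at x within S = at x" using S x by (rule at_within_open[rotated])
    ultimately have "\<forall>\<^sub>F y in at x. dist (DD u w y) (DD u w x) < \<epsilon> \<and> dist (DD w u y) (DD w u x) < \<epsilon> \<and> y \<in> S"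
      using eventually_at_topological S x by (fastforce intro!: eventually_conj simp: eventually_at_topological)
    then obtain \<delta> where \<delta>: "\<delta> > 0" "\<And>y. y \<noteq> x \<Longrightarrow> dist y x < \<delta> \<Longrightarrow>
        dist (DD u w y) (DD u w x) < \<epsilon> \<and> dist (DD w u y) (DD w u x) < \<epsilon> \<and> y \<in> S"
      unfolding eventually_at by auto
    then have near: "dist (DD u w y) (DD u w x) < \<epsilon> \<and> dist (DD w u y) (DD w u x) < \<epsilon> \<and> y \<in> S"
      if "dist y x < \<delta>" for y using that x \<open>\<epsilon> > 0\<close> by (cases "y = x") auto
    \<comment> \<open>Small enough for the parallelogram spanned by \<open>h *\<^sub>R u\<close> and
      \<open>h *\<^sub>R w\<close> to lie in the \<delta>-ball; the summand 1 guards against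
      \<open>u = w = 0\<close>.\<close>
    define h where "h = \<delta> / (2 * (norm u + norm w + 1))"
    have h: "h > 0" using \<delta>(1) by (simp add: h_def add_nonneg_pos)
    have small: "dist (x + s *\<^sub>R u + t *\<^sub>R w) x < \<delta>" "dist (x + t *\<^sub>R w + s *\<^sub>R u) x < \<delta>"
      if "0 \<le> s" "s \<le> h" "0 \<le> t" "t \<le> h" for s t
    proof -
      have "dist (x + s *\<^sub>R u + t *\<^sub>R w) x = norm (s *\<^sub>R u + t *\<^sub>R w)" by (simp add: dist_norm add.assoc)
      also have "\<dots> \<le> s * norm u + t * norm w" using norm_triangle_ineq[of "s *\<^sub>R u" "t *\<^sub>R w"] that by simp
      also have "\<dots> \<le> h * norm u + h * norm w" using that by (intro add_mono mult_right_mono) auto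
      also have "\<dots> \<le> h * (norm u + norm w + 1)" using h by (simp add: algebra_simps)
      also have "\<dots> = \<delta> / 2"
        using norm_ge_zero[of u] norm_ge_zero[of w] by (simp add: h_def field_simps add_nonneg_eq_0_iff)
      also have "\<dots> < \<delta>" using \<delta> by simp
      finally show "dist (x + s *\<^sub>R u + t *\<^sub>R w) x < \<delta>" .
      then show "dist (x + t *\<^sub>R w + s *\<^sub>R u) x < \<delta>" by (simp add: add_ac)
    qed
    obtain s t where st: "0 < s" "s < h" "0 < t" "t < h"
      "f (x + h *\<^sub>R u + h *\<^sub>R w) - f (x + h *\<^sub>R u) - f (x + h *\<^sub>R w) + f x
        = h * h * DD u w (x + s *\<^sub>R u + t *\<^sub>R w)"
      using key[OF h, of u w] small near by blast
    obtain s' t' where st': "0 < s'" "s' < h" "0 < t'" "t' < h"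
      "f (x + h *\<^sub>R w + h *\<^sub>R u) - f (x + h *\<^sub>R w) - f (x + h *\<^sub>R u) + f x
        = h * h * DD w u (x + s' *\<^sub>R w + t' *\<^sub>R u)"
      using key[OF h, of w u] small near by blast
    have "x + h *\<^sub>R w + h *\<^sub>R u = x + h *\<^sub>R u + h *\<^sub>R w" by (simp add: add_ac)
    then have "h * h * DD u w (x + s *\<^sub>R u + t *\<^sub>R w) = h * h * DD w u (x + s' *\<^sub>R w + t' *\<^sub>R u)"
      using st(5) st'(5) by (simp only:)
    then have "DD u w (x + s *\<^sub>R u + t *\<^sub>R w) = DD w u (x + s' *\<^sub>R w + t' *\<^sub>R u)"
      using h by simp
    moreover have "dist (DD u w (x + s *\<^sub>R u + t *\<^sub>R w)) (DD u w x) < \<epsilon>"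
      using near small st by (meson less_imp_le)
    moreover have "dist (DD w u (x + s' *\<^sub>R w + t' *\<^sub>R u)) (DD w u x) < \<epsilon>"
      using near small st' by (meson less_imp_le)
    moreover have "\<bar>a - b\<bar> \<le> dist y a + dist y b" for a b y :: real
      by (simp add: dist_real_def)
    ultimately show False unfolding \<epsilon>_def by (smt (verit) field_sum_of_halves)
  qed
  then show ?thesis by (simp add: DD_def D_def[abs_def])
qed

lemma frechet_derivative_zero_on:
  assumes "open T" "x \<in> T" "\<And>y. y \<in> T \<Longrightarrow> f y = 0"
  shows "frechet_derivative f (at x) = (\<lambda>w. 0)"
proof -
  have "(f has_derivative (\<lambda>w. 0)) (at x)"
    by (rule has_derivative_transform_within_open[of "\<lambda>x. 0" _ _ _ T]) (use assms in auto)
  then show ?thesis by (rule frechet_derivative_eqI)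
qed

text \<open>By translation invariance the difference quotients have integral zero.\<close>

lemma integral_partial_derivative_eq_0:
  fixes f :: "'a::euclidean_space \<Rightarrow> real"
  assumes f: "C1_on UNIV f" and K: "compact K" and f0: "\<And>x. x \<notin> K \<Longrightarrow> f x = 0"
  shows "(\<integral>x. frechet_derivative f (at x) u \<partial>lborel) = 0"
proof -
  let ?D = "\<lambda>x. frechet_derivative f (at x) u"
  have Dc: "continuous_on UNIV ?D" using f by simp
  have fc: "continuous_on UNIV f" using Ck_on_imp_continuous_on[OF f] .
  have D0: "?D x = 0" if "x \<notin> K" for x
    using frechet_derivative_zero_on[of "- K" x f] that f0 compact_imp_closed[OF K]
    by (simp add: open_Compl)
  have "bounded (?D ` K)"
    using K Dc by (intro compact_imp_bounded compact_continuous_image) (auto intro: continuous_on_subset)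
  then obtain C where C: "C > 0" "\<And>x. x \<in> K \<Longrightarrow> norm (?D x) \<le> C"
    unfolding bounded_pos by auto
  then have C': "\<bar>?D x\<bar> \<le> C" for x using D0 by (cases "x \<in> K") auto
  obtain R where R: "R > 0" "\<And>x. x \<in> K \<Longrightarrow> norm x \<le> R"
    using compact_imp_bounded[OF K] unfolding bounded_pos by auto
  define h where "h n = inverse (real (Suc n))" for n
  have h: "0 < h n" "h n \<le> 1" for n by (auto simp: h_def field_simps)
  define s where "s n x = inverse (h n) * (f (x + h n *\<^sub>R u) - f x)" for n x
  have fint: "integrable lborel f"
  proof -
    have "integrable lborel (\<lambda>x. indicator K x *\<^sub>R f x)"
      using K fc by (intro borel_integrable_compact) (auto intro: continuous_on_subset)
    moreover have "(\<lambda>x. indicator K x *\<^sub>R f x) = f" using f0 by (auto simp: fun_eq_iff indicator_def)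
    ultimately show ?thesis by simp
  qed
  have tr: "integrable lborel (\<lambda>x. f (x + c)) \<and> (\<integral>x. f (x + c) \<partial>lborel) = (\<integral>x. f x \<partial>lborel)" for c
  proof -
    have meas: "(+) c \<in> measurable lborel borel" "f \<in> borel_measurable borel"
      using fc by (auto intro: borel_measurable_continuous_onI)
    have "integrable (distr lborel borel ((+) c)) f" using fint by (simp add: lborel_distr_plus)
    then have "integrable lborel (\<lambda>x. f (c + x))" using meas by (simp add: integrable_distr_eq)
    moreover have "(\<integral>x. f x \<partial>(distr lborel borel ((+) c))) = (\<integral>x. f (c + x) \<partial>lborel)"
      by (rule integral_distr[OF meas])
    ultimately show ?thesis by (simp add: lborel_distr_plus add.commute)
  qed
  have s0: "(\<integral>x. s n x \<partial>lborel) = 0" for n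
    using tr[of "h n *\<^sub>R u"] fint by (simp add: s_def)
  have lim: "(\<lambda>n. s n x) \<longlonglongrightarrow> ?D x" for x
  proof -
    have "((\<lambda>t. f (x + t *\<^sub>R u)) has_real_derivative ?D (x + 0 *\<^sub>R u)) (at 0)"
      by (rule C1_on_translate_field_derivative[OF f]) auto
    then have "((\<lambda>t. (f (x + t *\<^sub>R u) - f x) / t) \<longlongrightarrow> ?D x) (at 0)"
      by (simp add: has_field_derivative_iff)
    moreover have "filterlim h (at 0) sequentially"
      using LIMSEQ_inverse_real_of_nat by (simp add: filterlim_at h_def[abs_def])
    ultimately have "((\<lambda>n. (f (x + h n *\<^sub>R u) - f x) / h n) \<longlongrightarrow> ?D x) sequentially"
      by (rule filterlim_compose)
    then show ?thesis by (simp add: s_def divide_inverse mult.commute)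
  qed
  \<comment> \<open>By the mean value theorem the quotient is a derivative at
    \<open>x + t *\<^sub>R u\<close> with \<open>t < h n \<le> 1\<close>. So all quotients are
    bounded by \<open>C\<close> and vanish outside the ball of radius \<open>R + norm u\<close>,
    which gives one dominating function.\<close>
  have bound: "norm (s n x) \<le> C * indicator (cball 0 (R + norm u)) x" for n x
  proof -
    obtain t where t: "0 < t" "t < h n" "f (x + h n *\<^sub>R u) - f x = h n * ?D (x + t *\<^sub>R u)"
      by (rule C1_mean_value[OF f h(1)[of n], of x u]) auto
    then have s: "s n x = ?D (x + t *\<^sub>R u)" using h(1)[of n] by (simp add: s_def)
    show ?thesis
    proof (cases "x + t *\<^sub>R u \<in> K")
      case True
      have "norm x \<le> norm (x + t *\<^sub>R u) + norm (t *\<^sub>R u)"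
        using norm_triangle_ineq4[of "x + t *\<^sub>R u" "t *\<^sub>R u"] by simp
      also have "\<dots> \<le> R + norm u"
        using R(2)[OF True] t h(2)[of n] by (intro add_mono) (auto intro: mult_left_le_one_le)
      finally show ?thesis using s C' by simp
    next
      case False
      then show ?thesis using s D0 C(1) by simp
    qed
  qed
  have "(\<lambda>n. \<integral>x. s n x \<partial>lborel) \<longlonglongrightarrow> (\<integral>x. ?D x \<partial>lborel)"
  proof (rule integral_dominated_convergence)
    show "?D \<in> borel_measurable lborel"
      using Dc by (simp add: borel_measurable_continuous_onI)
    show "s n \<in> borel_measurable lborel" for n
      unfolding s_def using fc by (auto intro!: borel_measurable_continuous_onI continuous_intros continuous_on_compose2[OF fc])
    show "integrable lborel (\<lambda>x::'a. C * indicator (cball 0 (R + norm u)) x)"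
      by (intro integrable_mult_right integrable_real_indicator) (use emeasure_lborel_cball_finite[of "0::'a"] in auto)
  qed (use lim bound in auto)
  then show ?thesis using s0 by (simp add: LIMSEQ_const_iff)
qed

subsection \<open>Charts and functions of class C^1\<close>

lemma
  assumes "smooth_manifold M" "i \<in> chart_idx M"
  shows open_chart_dom: "open (chart_dom M i)"
    and open_chart_img: "open (chart_img M i)"
    and chart_inv_chart_map: "\<And>p. p \<in> chart_dom M i \<Longrightarrow> chart_inv M i (chart_map M i p) = p"
    and chart_map_chart_inv: "\<And>y. y \<in> chart_img M i \<Longrightarrow> chart_map M i (chart_inv M i y) = y"
    and chart_map_in_img: "\<And>p. p \<in> chart_dom M i \<Longrightarrow> chart_map M i p \<in> chart_img M i"
    and chart_inv_in_dom: "\<And>y. y \<in> chart_img M i \<Longrightarrow> chart_inv M i y \<in> chart_dom M i"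
    and continuous_on_chart_map: "continuous_on (chart_dom M i) (chart_map M i)"
    and continuous_on_chart_inv: "continuous_on (chart_img M i) (chart_inv M i)"
  using assms unfolding smooth_manifold_def homeomorphism_def by blast+

lemma chart_dom_subset_points: "i \<in> chart_idx M \<Longrightarrow> chart_dom M i \<subseteq> points M"
  by (auto simp: points_def)

lemma open_points: "smooth_manifold M \<Longrightarrow> open (points M)"
  unfolding points_def by (intro open_UN ballI open_chart_dom)

lemma chart_at:
  assumes "p \<in> points M"
  shows "chart_at M p \<in> chart_idx M" "p \<in> chart_dom M (chart_at M p)"
proof -
  have "\<exists>i. i \<in> chart_idx M \<and> p \<in> chart_dom M i" using assms by (auto simp: points_def)
  from someI_ex[OF this] show "chart_at M p \<in> chart_idx M" "p \<in> chart_dom M (chart_at M p)"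
    unfolding chart_at_def by auto
qed

lemma open_chart_preimage:
  assumes "smooth_manifold M" "i \<in> chart_idx M" "open U"
  shows "open {y \<in> chart_img M i. chart_inv M i y \<in> U}"
proof -
  have "open (chart_img M i \<inter> chart_inv M i -` U)"
    using continuous_open_preimage[OF continuous_on_chart_inv[OF assms(1,2)] open_chart_img[OF assms(1,2)] assms(3)] .
  moreover have "chart_img M i \<inter> chart_inv M i -` U = {y \<in> chart_img M i. chart_inv M i y \<in> U}" by auto
  ultimately show ?thesis by simp
qed

lemma chart_map_image_eq:
  assumes "smooth_manifold M" "i \<in> chart_idx M"
  shows "chart_map M i ` (chart_dom M i \<inter> U) = {y \<in> chart_img M i. chart_inv M i y \<in> U}"
  using chart_inv_chart_map[OF assms] chart_map_chart_inv[OF assms] chart_inv_in_dom[OF assms]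
    chart_map_in_img[OF assms]
  by (auto intro!: image_eqI)

lemma chart_map_image_compact:
  assumes M: "smooth_manifold M" and i: "i \<in> chart_idx M" and L: "compact L" "L \<subseteq> chart_dom M i"
  shows "compact (chart_map M i ` L)" "chart_map M i ` L \<subseteq> chart_img M i"
    and "\<And>y. y \<in> chart_img M i \<Longrightarrow> y \<notin> chart_map M i ` L \<Longrightarrow> chart_inv M i y \<in> points M - L"
proof -
  show "compact (chart_map M i ` L)" "chart_map M i ` L \<subseteq> chart_img M i"
    using L continuous_on_chart_map[OF M i] chart_map_in_img[OF M i]
    by (auto intro!: compact_continuous_image intro: continuous_on_subset)
  fix y assume y: "y \<in> chart_img M i" "y \<notin> chart_map M i ` L"
  then show "chart_inv M i y \<in> points M - L"
    using chart_inv_in_dom[OF M i y(1)] chart_dom_subset_points[OF i] chart_map_chart_inv[OF M i y(1)]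
    by (metis DiffI image_eqI subsetD)
qed

lemma smooth_on_transition:
  assumes "smooth_manifold M" "i \<in> chart_idx M" "j \<in> chart_idx M"
  shows "smooth_on {y \<in> chart_img M i. chart_inv M i y \<in> chart_dom M j} (transition M i j)"
  using assms chart_map_image_eq[OF assms(1,2), of "chart_dom M j"]
  unfolding smooth_manifold_def by metis

lemma continuous_on_points:
  assumes M: "smooth_manifold M"
    and f: "\<And>i. i \<in> chart_idx M \<Longrightarrow> continuous_on (chart_img M i) (\<lambda>y. f (chart_inv M i y))"
  shows "continuous_on (points M) f"
  unfolding points_def
proof (rule continuous_on_open_UN)
  fix i assume i: "i \<in> chart_idx M"
  show "open (chart_dom M i)" by (rule open_chart_dom[OF M i])
  have "continuous_on (chart_dom M i) (\<lambda>p. f (chart_inv M i (chart_map M i p)))"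
    by (rule continuous_on_compose2[OF f[OF i] continuous_on_chart_map[OF M i]])
       (use chart_map_in_img[OF M i] in auto)
  then show "continuous_on (chart_dom M i) f"
    by (rule continuous_on_eq) (simp add: chart_inv_chart_map[OF M i])
qed

definition C1_function :: "('i, 'a, 'e::euclidean_space) riem_atlas \<Rightarrow> ('a \<Rightarrow> real) \<Rightarrow> bool" where
  "C1_function M f \<longleftrightarrow>
     (\<forall>i\<in>chart_idx M. C1_on (chart_img M i) (\<lambda>y. f (chart_inv M i y)))"

lemma C1_functionD:
  "C1_function M f \<Longrightarrow> i \<in> chart_idx M \<Longrightarrow> C1_on (chart_img M i) (\<lambda>y. f (chart_inv M i y))"
  by (simp add: C1_function_def)

lemma C1_function_continuous:
  "smooth_manifold M \<Longrightarrow> C1_function M f \<Longrightarrow> continuous_on (points M) f"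
  by (intro continuous_on_points) (auto intro: Ck_on_imp_continuous_on dest: C1_functionD)

lemma test_function_C1: "test_function M f \<Longrightarrow> C1_function M f"
  unfolding test_function_def C1_function_def by (auto simp: smooth_on_def o_def simp del: Ck_on.simps)

lemma C1_function_mult:
  "smooth_manifold M \<Longrightarrow> C1_function M f \<Longrightarrow> C1_function M g \<Longrightarrow> C1_function M (\<lambda>p. f p * g p)"
  unfolding C1_function_def by (intro ballI Ck_on_mult open_chart_img) auto

lemma C1_function_add:
  "smooth_manifold M \<Longrightarrow> C1_function M f \<Longrightarrow> C1_function M g \<Longrightarrow> C1_function M (\<lambda>p. f p + g p)"
  unfolding C1_function_def by (intro ballI Ck_on_add open_chart_img) auto

lemma C1_function_sum:
  "smooth_manifold M \<Longrightarrow> (\<And>q. q \<in> J \<Longrightarrow> C1_function M (f q)) \<Longrightarrow> C1_function M (\<lambda>p. \<Sum>q\<in>J. f q p)"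
  unfolding C1_function_def by (intro ballI Ck_on_sum open_chart_img) auto

subsection \<open>Partitions of unity\<close>

text \<open>Squaring the positive part makes it continuously differentiable at 0. C^1 cutoffs are
  enough, since the divergence theorem below is proved for C^1 functions.\<close>

definition sq_pos :: "real \<Rightarrow> real" where
  "sq_pos t = (max 0 t)\<^sup>2"

lemma sq_pos_nonneg: "sq_pos t \<ge> 0" and sq_pos_eq_0: "t \<le> 0 \<Longrightarrow> sq_pos t = 0"
  and sq_pos_pos: "t > 0 \<Longrightarrow> sq_pos t > 0"
  by (auto simp: sq_pos_def)

lemma C1_on_sq_pos: "C1_on UNIV sq_pos"
proof (rule C1_on_realI[where f' = "\<lambda>t. 2 * max 0 t"])
  show "(sq_pos has_real_derivative 2 * max 0 x) (at x)" for x
  proof (cases x "0::real" rule: linorder_cases)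
    case less
    have "((\<lambda>t. 0) has_real_derivative 2 * max 0 x) (at x)" using less by simp
    then show ?thesis
      by (rule has_field_derivative_transform_within_open[of _ _ _ "{..<0}"])
         (use less in \<open>auto simp: sq_pos_eq_0\<close>)
  next
    case equal
    have "((\<lambda>h::real. max 0 h) \<longlongrightarrow> max 0 0) (at 0)" by (intro tendsto_intros)
    moreover have "\<forall>\<^sub>F h in at 0. max 0 h = (sq_pos (0 + h) - sq_pos 0) / h"
      unfolding eventually_at_topological
      by (intro exI[of _ UNIV]) (auto simp: sq_pos_def max_def power2_eq_square)
    ultimately have "((\<lambda>h. (sq_pos (0 + h) - sq_pos 0) / h) \<longlongrightarrow> max 0 0) (at 0)"
      by (rule Lim_transform_eventually)
    then show ?thesis using equal by (simp add: DERIV_def)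
  next
    case greater
    have "((\<lambda>t. t\<^sup>2) has_real_derivative 2 * max 0 x) (at x)"
      using greater by (auto intro!: derivative_eq_intros)
    then show ?thesis
      by (rule has_field_derivative_transform_within_open[of _ _ _ "{0<..}"])
         (use greater in \<open>auto simp: sq_pos_def\<close>)
  qed
  show "continuous_on UNIV (\<lambda>t::real. 2 * max 0 t)" by (intro continuous_intros)
qed auto

text \<open>Squared distances keep the argument of \<open>sq_pos\<close> polynomial in the
  coordinates, so the centre causes no loss of differentiability.\<close>

definition chart_bump :: "('i, 'a, 'e::euclidean_space) riem_atlas \<Rightarrow> 'i \<Rightarrow> 'e \<Rightarrow> real \<Rightarrow> 'a \<Rightarrow> real" where
  "chart_bump M i z \<rho> p = (if p \<in> chart_dom M i then sq_pos (\<rho>\<^sup>2 - (dist (chart_map M i p) z)\<^sup>2) else 0)"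

lemma chart_bump_nonneg: "chart_bump M i z \<rho> p \<ge> 0"
  by (simp add: chart_bump_def sq_pos_nonneg)

lemma chart_bump_pos:
  "p \<in> chart_dom M i \<Longrightarrow> \<rho> > 0 \<Longrightarrow> chart_bump M i (chart_map M i p) \<rho> p > 0"
  by (simp add: chart_bump_def sq_pos_pos)

lemma compact_chart_cball:
  assumes "smooth_manifold M" "i \<in> chart_idx M" "cball z \<rho> \<subseteq> chart_img M i"
  shows "compact (chart_inv M i ` cball z \<rho>)" "chart_inv M i ` cball z \<rho> \<subseteq> chart_dom M i"
  using assms chart_inv_in_dom[OF assms(1,2)] continuous_on_chart_inv[OF assms(1,2)]
  by (auto intro!: compact_continuous_image intro: continuous_on_subset)

lemma chart_bump_support:
  assumes "smooth_manifold M" "i \<in> chart_idx M" "\<rho> > 0" "p \<notin> chart_inv M i ` cball z \<rho>"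
  shows "chart_bump M i z \<rho> p = 0"
proof (cases "p \<in> chart_dom M i")
  case True
  then have "chart_map M i p \<notin> cball z \<rho>"
    using assms(4) chart_inv_chart_map[OF assms(1,2) True] by (metis image_eqI)
  then have "\<rho> < dist (chart_map M i p) z" by (simp add: dist_commute)
  then have "\<rho>\<^sup>2 \<le> (dist (chart_map M i p) z)\<^sup>2" using assms(3) by (intro power_mono) auto
  then show ?thesis by (simp add: chart_bump_def sq_pos_eq_0)
qed (simp add: chart_bump_def)

text \<open>In another chart \<open>j\<close> the bump is C^1 where the domains overlap, through the
  transition map, and is 0 off the compact set \<open>?L\<close>. Both regions are open, the second
  because compact sets are closed in a Hausdorff space, and together they cover the image of chart
  \<open>j\<close>.\<close>

lemma C1_function_chart_bump:
  assumes M: "smooth_manifold M" and i: "i \<in> chart_idx M" and \<rho>: "\<rho> > 0"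
    and sub: "cball z \<rho> \<subseteq> chart_img M i"
  shows "C1_function M (chart_bump M i z \<rho>)"
  unfolding C1_function_def
proof
  fix j assume j: "j \<in> chart_idx M"
  let ?L = "chart_inv M i ` cball z \<rho>"
  let ?f = "\<lambda>y. chart_bump M i z \<rho> (chart_inv M j y)"
  let ?T1 = "{y \<in> chart_img M j. chart_inv M j y \<in> chart_dom M i}"
  let ?T2 = "{y \<in> chart_img M j. chart_inv M j y \<in> - ?L}"
  have o1: "open ?T1" by (rule open_chart_preimage[OF M j open_chart_dom[OF M i]])
  have o2: "open ?T2"
    using compact_chart_cball[OF M i sub]
    by (intro open_chart_preimage[OF M j]) (auto intro: compact_imp_closed)
  have "C1_on ?T1 (\<lambda>y. sq_pos (\<rho>\<^sup>2 - (transition M j i y - z) \<bullet> (transition M j i y - z)))"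
  proof (rule C1_on_compose[OF o1 _ C1_on_sq_pos])
    have t: "C1_on ?T1 (\<lambda>y. transition M j i y - z)"
      by (intro Ck_on_diff Ck_on_const o1 smooth_on_Ck smooth_on_transition M i j)
    show "C1_on ?T1 (\<lambda>y. \<rho>\<^sup>2 - (transition M j i y - z) \<bullet> (transition M j i y - z))"
      by (intro Ck_on_diff Ck_on_const o1 Ck_on_bilinear[OF o1 bounded_bilinear_inner] t)
  qed auto
  then have c1: "C1_on ?T1 ?f"
    by (rule Ck_on_cong[OF o1, rotated])
       (simp add: chart_bump_def transition_def dist_norm power2_norm_eq_inner)
  have c2: "C1_on ?T2 ?f"
    by (rule Ck_on_cong[OF o2 _ Ck_on_const[OF o2, of _ 0]])
       (simp add: chart_bump_support[OF M i \<rho>])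
  show "C1_on (chart_img M j) ?f"
  proof (rule Ck_on_local)
    fix y assume y: "y \<in> chart_img M j"
    show "\<exists>T. open T \<and> y \<in> T \<and> C1_on T ?f"
    proof (cases "chart_inv M j y \<in> ?L")
      case True
      then have "y \<in> ?T1" using y compact_chart_cball(2)[OF M i sub] by auto
      then show ?thesis using o1 c1 by blast
    next
      case False
      then have "y \<in> ?T2" using y by simp
      then show ?thesis using o2 c2 by blast
    qed
  qed
qed

lemma chart_ball_exists:
  assumes "smooth_manifold M" "p \<in> points M"
  obtains i \<rho> where "i \<in> chart_idx M" "p \<in> chart_dom M i" "\<rho> > 0" "cball (chart_map M i p) \<rho> \<subseteq> chart_img M i"
proof -
  obtain i where i: "i \<in> chart_idx M" "p \<in> chart_dom M i" using assms(2) by (auto simp: points_def)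
  obtain \<rho> where "\<rho> > 0" "cball (chart_map M i p) \<rho> \<subseteq> chart_img M i"
    using open_chart_img[OF assms(1) i(1)] chart_map_in_img[OF assms(1) i]
    unfolding open_contains_cball by blast
  then show thesis using that i by blast
qed

text \<open>The sum of the bumps is at least \<open>\<delta>\<close> on \<open>K\<close>, and \<open>s + sq_pos (\<delta> - s)\<close> equals \<open>s\<close> for
  \<open>s \<ge> \<delta>\<close> and is positive for \<open>s \<ge> 0\<close>, so that it may replace the sum in the denominator.\<close>

lemma partition_of_unity:
  fixes M :: "('i, 'a::{t2_space, second_countable_topology}, 'e::euclidean_space) riem_atlas"
  assumes M: "smooth_manifold M" and K: "compact K" "K \<subseteq> points M"
  obtains J :: "'a set" and c \<eta> L where "finite J"
    "\<And>q. q \<in> J \<Longrightarrow> c q \<in> chart_idx M" "\<And>q. q \<in> J \<Longrightarrow> compact (L q)"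
    "\<And>q. q \<in> J \<Longrightarrow> L q \<subseteq> chart_dom M (c q)" "\<And>q. q \<in> J \<Longrightarrow> C1_function M (\<eta> q)"
    "\<And>q p. q \<in> J \<Longrightarrow> 0 \<le> \<eta> q p \<and> \<eta> q p \<le> 1" "\<And>q p. q \<in> J \<Longrightarrow> p \<notin> L q \<Longrightarrow> \<eta> q p = 0"
    "\<And>p. p \<in> K \<Longrightarrow> (\<Sum>q\<in>J. \<eta> q p) = 1"
proof -
  have "\<exists>i \<rho>. i \<in> chart_idx M \<and> p \<in> chart_dom M i \<and> \<rho> > 0 \<and> cball (chart_map M i p) \<rho> \<subseteq> chart_img M i"
    if "p \<in> K" for p
    using chart_ball_exists[OF M] K(2) that by (metis subsetD)
  then obtain c \<rho> where c: "\<And>p. p \<in> K \<Longrightarrow> c p \<in> chart_idx M" "\<And>p. p \<in> K \<Longrightarrow> p \<in> chart_dom M (c p)"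
    "\<And>p. p \<in> K \<Longrightarrow> \<rho> p > 0" "\<And>p. p \<in> K \<Longrightarrow> cball (chart_map M (c p) p) (\<rho> p) \<subseteq> chart_img M (c p)"
    by metis
  define \<beta> where "\<beta> q = chart_bump M (c q) (chart_map M (c q) q) (\<rho> q)" for q
  define L where "L q = chart_inv M (c q) ` cball (chart_map M (c q) q) (\<rho> q)" for q
  have \<beta>C1: "C1_function M (\<beta> q)" if "q \<in> K" for q
    unfolding \<beta>_def using c that by (intro C1_function_chart_bump M)
  have \<beta>0: "\<beta> q p \<ge> 0" for q p by (simp add: \<beta>_def chart_bump_nonneg)
  have op: "open {p \<in> points M. \<beta> q p \<in> {0<..}}" if "q \<in> K" for q
    using continuous_open_preimage[OF C1_function_continuous[OF M \<beta>C1[OF that]] open_points[OF M] open_greaterThan]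
    by (simp add: vimage_def Int_def)
  have cover: "K \<subseteq> (\<Union>q\<in>K. {p \<in> points M. \<beta> q p \<in> {0<..}})"
    using c K(2) chart_bump_pos unfolding \<beta>_def by fastforce
  obtain J where J: "J \<subseteq> K" "finite J" "K \<subseteq> (\<Union>q\<in>J. {p \<in> points M. \<beta> q p \<in> {0<..}})"
    by (rule compactE_image[OF K(1) op cover])
  define S where "S p = (\<Sum>q\<in>J. \<beta> q p)" for p
  have SC1: "C1_function M S"
    unfolding S_def using \<beta>C1 J(1) by (intro C1_function_sum M) auto
  have S0: "S p \<ge> 0" for p unfolding S_def by (intro sum_nonneg \<beta>0)
  have Spos: "S p > 0" if "p \<in> K" for p
  proof -
    have "p \<in> (\<Union>q\<in>J. {p \<in> points M. \<beta> q p \<in> {0<..}})" using J(3) that by (rule subsetD)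
    then obtain q where "q \<in> J" "\<beta> q p > 0" by auto
    then show ?thesis unfolding S_def using J(2) \<beta>0 by (intro sum_pos2[of J q]) auto
  qed
  obtain \<delta> where \<delta>: "\<delta> > 0" "\<And>p. p \<in> K \<Longrightarrow> \<delta> \<le> S p"
  proof (cases "K = {}")
    case True
    then show thesis using that[of 1] by simp
  next
    case False
    have "continuous_on K S"
      using C1_function_continuous[OF M SC1] K(2) continuous_on_subset by blast
    from continuous_attains_inf[OF K(1) False this]
    obtain p where "p \<in> K" "\<forall>x\<in>K. S p \<le> S x" by blast
    then show thesis using that[of "S p"] Spos by blast
  qed
  define H where "H p = S p + sq_pos (\<delta> - S p)" for p
  have Hpos: "H p > 0" for p
    using S0[of p] sq_pos_pos[of \<delta>] sq_pos_nonneg[of "\<delta> - S p"] \<delta>(1) unfolding H_def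
    by (cases "S p = 0") (auto intro: add_pos_nonneg)
  have HC1: "C1_on (chart_img M i) (\<lambda>y. H (chart_inv M i y))" if "i \<in> chart_idx M" for i
  proof -
    note o = open_chart_img[OF M that] and SC = C1_functionD[OF SC1 that]
    show ?thesis
      unfolding H_def
      by (intro Ck_on_add[OF o] SC C1_on_compose[OF o _ C1_on_sq_pos] Ck_on_diff Ck_on_const o) simp
  qed
  show thesis
  proof (rule that[of J c L "\<lambda>q p. \<beta> q p / H p"])
    show "finite J" by fact
    fix q assume "q \<in> J"
    then have q: "q \<in> K" using J by auto
    show "c q \<in> chart_idx M" using c q by simp
    show "compact (L q)" "L q \<subseteq> chart_dom M (c q)"
      unfolding L_def using compact_chart_cball[OF M] c q by auto
    show "C1_function M (\<lambda>p. \<beta> q p / H p)"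
      unfolding C1_function_def
      by (intro ballI C1_on_divide open_chart_img M C1_functionD[OF \<beta>C1[OF q]] HC1)
         (use Hpos in \<open>auto simp: less_imp_neq[symmetric]\<close>)
    show "0 \<le> \<beta> q p / H p \<and> \<beta> q p / H p \<le> 1" for p
    proof -
      have "\<beta> q p \<le> S p"
        unfolding S_def using J(2) \<open>q \<in> J\<close> \<beta>0 by (intro member_le_sum) auto
      also have "S p \<le> H p" by (simp add: H_def sq_pos_nonneg)
      finally show ?thesis using \<beta>0 Hpos[of p] by simp
    qed
    show "\<beta> q p / H p = 0" if "p \<notin> L q" for p
      using that chart_bump_support[OF M] c q unfolding L_def \<beta>_def by simp
  next
    fix p assume "p \<in> K"
    then have "H p = S p" using \<delta>(2) by (simp add: H_def sq_pos_eq_0)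
    then show "(\<Sum>q\<in>J. \<beta> q p / H p) = 1"
      using Spos[OF \<open>p \<in> K\<close>] by (simp add: sum_divide_distrib[symmetric] S_def)
  qed
qed

subsection \<open>Integration in charts\<close>

lemma riemannian_manifold_smooth: "riemannian_manifold M \<Longrightarrow> smooth_manifold M"
  by (simp add: riemannian_manifold_def)

lemma rmetric_pos_def_form:
  "riemannian_manifold M \<Longrightarrow> i \<in> chart_idx M \<Longrightarrow> p \<in> chart_dom M i \<Longrightarrow> pos_def_form (rmetric M i p)"
  by (auto simp: riemannian_manifold_def pos_def_form_def)

lemma metric_det_eq_gram_det: "metric_det M i p = gram_det Basis (rmetric M i p)"
  by (simp add: metric_det_def gram_det_def)

lemma C1_on_rmetric:
  "riemannian_manifold M \<Longrightarrow> i \<in> chart_idx M \<Longrightarrow>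
    C1_on (chart_img M i) (\<lambda>y. rmetric M i (chart_inv M i y) u w)"
  by (auto simp: riemannian_manifold_def intro: smooth_on_Ck simp del: Ck_on.simps)

lemma metric_det_pos:
  "riemannian_manifold M \<Longrightarrow> i \<in> chart_idx M \<Longrightarrow> p \<in> chart_dom M i \<Longrightarrow> metric_det M i p > 0"
  by (simp add: metric_det_eq_gram_det pos_def_form_det_pos rmetric_pos_def_form)

lemma vol_density_pos:
  assumes "riemannian_manifold M" "i \<in> chart_idx M" "y \<in> chart_img M i"
  shows "vol_density M i y > 0"
  using metric_det_pos[OF assms(1,2) chart_inv_in_dom[OF riemannian_manifold_smooth[OF assms(1)] assms(2,3)]]
  by (simp add: vol_density_def)

lemma C1_on_vol_density:
  assumes "riemannian_manifold M" "i \<in> chart_idx M"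
  shows "C1_on (chart_img M i) (vol_density M i)"
proof -
  note M = riemannian_manifold_smooth[OF assms(1)]
  have "C1_on (chart_img M i) (\<lambda>y. sqrt (gram_det Basis (rmetric M i (chart_inv M i y))))"
  proof (intro C1_on_sqrt C1_on_gram_det open_chart_img[OF M assms(2)] C1_on_rmetric[OF assms])
    show "gram_det Basis (rmetric M i (chart_inv M i y)) > 0" if "y \<in> chart_img M i" for y
      using metric_det_pos[OF assms chart_inv_in_dom[OF M assms(2) that]]
      by (simp add: metric_det_eq_gram_det)
  qed
  then show ?thesis
    by (simp add: vol_density_def[abs_def] metric_det_eq_gram_det del: Ck_on.simps)
qed

lemma borel_measurable_vol_density:
  assumes "riemannian_manifold M" "i \<in> chart_idx M"
  shows "vol_density M i \<in> borel_measurable (restrict_space lborel (chart_img M i))"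
proof -
  have "sets (restrict_space lborel (chart_img M i)) = sets (restrict_space borel (chart_img M i))"
    by (rule sets_restrict_space_cong) simp
  then show ?thesis
    using borel_measurable_continuous_on_restrict[OF Ck_on_imp_continuous_on[OF C1_on_vol_density[OF assms]]]
    by (simp cong: measurable_cong_sets)
qed

text \<open>Turns the defining formula for Borel subsets of a chart domain into an identity of
  measures, so that the rules for restrictions, image measures and densities apply to
  integrals.\<close>

lemma riemannian_measure_chart:
  assumes M: "riemannian_manifold M" and \<mu>: "is_riemannian_measure M \<mu>" and i: "i \<in> chart_idx M"
  defines "\<nu> \<equiv> density (restrict_space lborel (chart_img M i)) (\<lambda>y. ennreal (vol_density M i y))"
  shows "restrict_space \<mu> (chart_dom M i) = distr \<nu> (restrict_space borel (chart_dom M i)) (chart_inv M i)"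
    and "chart_inv M i \<in> measurable \<nu> (restrict_space borel (chart_dom M i))"
    and "chart_dom M i \<in> sets \<mu>"
proof -
  note sm = riemannian_manifold_smooth[OF M]
  let ?D = "chart_dom M i" and ?I = "chart_img M i"
  have D: "open ?D" "?D \<subseteq> points M" "?D \<in> sets borel"
    using open_chart_dom[OF sm i] chart_dom_subset_points[OF i] by auto
  have I: "?I \<in> sets borel" using open_chart_img[OF sm i] by simp
  have sp: "space \<mu> = points M" and st: "sets \<mu> = sets (restrict_space borel (points M))"
    using \<mu> by (auto simp: is_riemannian_measure_def)
  have pM: "points M \<in> sets borel" using open_points[OF sm] by simp
  show Ds: "?D \<in> sets \<mu>" unfolding st using D pM by (simp add: sets_restrict_space_iff)
  have meas: "chart_inv M i \<in> measurable (restrict_space borel ?I) (restrict_space borel ?D)"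
    using continuous_on_chart_inv[OF sm i] chart_inv_in_dom[OF sm i]
    by (auto intro!: measurable_restrict_space2 borel_measurable_continuous_on_restrict simp: space_restrict_space)
  have sets_rl: "sets (restrict_space lborel ?I) = sets (restrict_space borel ?I)"
    by (rule sets_restrict_space_cong) simp
  show m\<nu>: "chart_inv M i \<in> measurable \<nu> (restrict_space borel ?D)"
    unfolding \<nu>_def using meas sets_rl
    by (simp cong: measurable_cong_sets)
  have vm: "(\<lambda>y. ennreal (vol_density M i y)) \<in> borel_measurable (restrict_space lborel ?I)"
    by (rule measurable_compose[OF borel_measurable_vol_density[OF M i] measurable_ennreal])
  show "restrict_space \<mu> ?D = distr \<nu> (restrict_space borel ?D) (chart_inv M i)"
  proof (rule measure_eqI)
    have "sets (restrict_space \<mu> ?D) = sets (restrict_space (restrict_space borel (points M)) ?D)"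
      by (rule sets_restrict_space_cong[OF st])
    then show s: "sets (restrict_space \<mu> ?D) = sets (distr \<nu> (restrict_space borel ?D) (chart_inv M i))"
      using D by (simp add: sets_restrict_restrict_space Int_absorb1)
    fix A assume "A \<in> sets (restrict_space \<mu> ?D)"
    then have A: "A \<in> sets (restrict_space borel ?D)" using s by simp
    then have A': "A \<in> sets borel" "A \<subseteq> ?D" using D by (auto simp: sets_restrict_space_iff)
    have im: "chart_map M i ` A = chart_inv M i -` A \<inter> ?I"
      using chart_map_image_eq[OF sm i, of A] A'(2) by (auto simp: Int_absorb1)
    have ms: "chart_inv M i -` A \<inter> ?I \<in> sets (restrict_space borel ?I)"
      using measurable_sets[OF meas A] by (simp add: space_restrict_space)
    have "emeasure (restrict_space \<mu> ?D) A = emeasure \<mu> A"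
      using A' Ds sets.sets_into_space[OF Ds] by (intro emeasure_restrict_space) (auto simp: Int_absorb2)
    also have "\<dots> = (\<integral>\<^sup>+ y \<in> chart_map M i ` A. ennreal (vol_density M i y) \<partial>lborel)"
      using \<mu> i A' by (simp add: is_riemannian_measure_def)
    also have "\<dots> = (\<integral>\<^sup>+ y \<in> ?I. ennreal (vol_density M i y) * indicator (chart_inv M i -` A \<inter> ?I) y \<partial>lborel)"
      unfolding im by (intro nn_integral_cong) (auto simp: indicator_def)
    also have "\<dots> = (\<integral>\<^sup>+ y. ennreal (vol_density M i y) * indicator (chart_inv M i -` A \<inter> ?I) y \<partial>restrict_space lborel ?I)"
      using I by (subst nn_integral_restrict_space) auto
    also have "\<dots> = emeasure \<nu> (chart_inv M i -` A \<inter> ?I)"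
      unfolding \<nu>_def using vm ms sets_rl by (subst emeasure_density) auto
    also have "\<dots> = emeasure (distr \<nu> (restrict_space borel ?D) (chart_inv M i)) A"
      using m\<nu> A by (subst emeasure_distr) (auto simp: \<nu>_def space_restrict_space)
    finally show "emeasure (restrict_space \<mu> ?D) A = emeasure (distr \<nu> (restrict_space borel ?D) (chart_inv M i)) A" .
  qed
qed

text \<open>Restriction to the chart domain, push-forward and density are resolved one after the
  other, once for values and once for integrability. The first claim includes non-integrable
  \<open>f\<close>, where both integrals are 0 by convention.\<close>

lemma
  fixes M :: "('i, 'a::{t2_space, second_countable_topology}, 'e::euclidean_space) riem_atlas"
    and f :: "'a \<Rightarrow> real"
  assumes M: "riemannian_manifold M" and \<mu>: "is_riemannian_measure M \<mu>" and i: "i \<in> chart_idx M"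
    and f: "f \<in> borel_measurable (restrict_space borel (chart_dom M i))"
    and f0: "\<And>p. p \<in> points M \<Longrightarrow> p \<notin> chart_dom M i \<Longrightarrow> f p = 0"
  shows integral_chart: "(\<integral>p. f p \<partial>\<mu>) =
      (\<integral>y. indicator (chart_img M i) y * (vol_density M i y * f (chart_inv M i y)) \<partial>lborel)"
    and integrable_chart: "integrable \<mu> f \<longleftrightarrow>
      integrable lborel (\<lambda>y. indicator (chart_img M i) y * (vol_density M i y * f (chart_inv M i y)))"
proof -
  note sm = riemannian_manifold_smooth[OF M]
  let ?D = "chart_dom M i" and ?I = "chart_img M i"
  define \<nu> where "\<nu> = density (restrict_space lborel ?I) (\<lambda>y. ennreal (vol_density M i y))"
  note rc = riemannian_measure_chart[OF M \<mu> i, folded \<nu>_def]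
  have sp: "space \<mu> = points M" using \<mu> by (auto simp: is_riemannian_measure_def)
  have eq: "f p = indicator ?D p *\<^sub>R f p" if "p \<in> space \<mu>" for p
    using f0 that sp by (auto simp: indicator_def)
  have Ds: "?D \<inter> space \<mu> \<in> sets \<mu>" using rc(3) by simp
  have I: "?I \<in> sets borel" using open_chart_img[OF sm i] by simp
  note vm = borel_measurable_vol_density[OF M i]
  have fm: "(\<lambda>y. f (chart_inv M i y)) \<in> borel_measurable (restrict_space lborel ?I)"
    using measurable_compose[OF rc(2) f] by (simp add: \<nu>_def)
  have pos: "AE y in restrict_space lborel ?I. 0 \<le> vol_density M i y"
    using vol_density_pos[OF M i] by (intro AE_I2) (auto simp: space_restrict_space less_imp_le)
  have "(\<integral>p. f p \<partial>\<mu>) = (\<integral>p. indicator ?D p *\<^sub>R f p \<partial>\<mu>)" by (rule Bochner_Integration.integral_cong[OF refl eq])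
  also have "\<dots> = (\<integral>p. f p \<partial>restrict_space \<mu> ?D)" by (rule integral_restrict_space[OF Ds, symmetric])
  also have "\<dots> = (\<integral>y. f (chart_inv M i y) \<partial>\<nu>)"
    unfolding rc(1) by (rule integral_distr[OF rc(2) f])
  also have "\<dots> = (\<integral>y. vol_density M i y *\<^sub>R f (chart_inv M i y) \<partial>restrict_space lborel ?I)"
    unfolding \<nu>_def by (rule integral_density[OF fm vm pos])
  also have "\<dots> = (\<integral>y. indicator ?I y *\<^sub>R (vol_density M i y *\<^sub>R f (chart_inv M i y)) \<partial>lborel)"
    using I by (intro integral_restrict_space) simp
  finally show "(\<integral>p. f p \<partial>\<mu>) = (\<integral>y. indicator ?I y * (vol_density M i y * f (chart_inv M i y)) \<partial>lborel)"
    by simp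
  have "integrable \<mu> f \<longleftrightarrow> integrable \<mu> (\<lambda>p. indicator ?D p *\<^sub>R f p)"
    by (rule Bochner_Integration.integrable_cong[OF refl eq])
  also have "\<dots> \<longleftrightarrow> integrable (restrict_space \<mu> ?D) f" by (rule integrable_restrict_space[OF Ds, symmetric])
  also have "\<dots> \<longleftrightarrow> integrable \<nu> (\<lambda>y. f (chart_inv M i y))"
    unfolding rc(1) by (rule integrable_distr_eq[OF rc(2) f])
  also have "\<dots> \<longleftrightarrow> integrable (restrict_space lborel ?I) (\<lambda>y. vol_density M i y *\<^sub>R f (chart_inv M i y))"
    unfolding \<nu>_def by (rule integrable_density[OF fm vm pos])
  also have "\<dots> \<longleftrightarrow> integrable lborel (\<lambda>y. indicator ?I y *\<^sub>R (vol_density M i y *\<^sub>R f (chart_inv M i y)))"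
    using I by (intro integrable_restrict_space) simp
  finally show "integrable \<mu> f \<longleftrightarrow>
      integrable lborel (\<lambda>y. indicator ?I y * (vol_density M i y * f (chart_inv M i y)))" by simp
qed

lemma borel_measurable_riemannian_continuous:
  assumes \<mu>: "is_riemannian_measure M \<mu>" and f: "continuous_on (points M) f"
  shows "f \<in> borel_measurable \<mu>"
  using borel_measurable_continuous_on_restrict[OF f] \<mu>
  by (simp add: is_riemannian_measure_def cong: measurable_cong_sets)

text \<open>The supports \<open>L q\<close> of a partition of unity cover \<open>K\<close>. Each
  lies in one chart, where its measure is the integral of a continuous density over a compact
  set.\<close>

lemma emeasure_compact_riemannian:
  fixes M :: "('i, 'a::{t2_space, second_countable_topology}, 'e::euclidean_space) riem_atlas"
  assumes M: "riemannian_manifold M" and \<mu>: "is_riemannian_measure M \<mu>"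
    and K: "compact K" "K \<subseteq> points M"
  shows "K \<in> sets \<mu>" "emeasure \<mu> K < \<infinity>"
proof -
  note sm = riemannian_manifold_smooth[OF M]
  have st: "sets \<mu> = sets (restrict_space borel (points M))"
    using \<mu> by (auto simp: is_riemannian_measure_def)
  have pM: "points M \<in> sets borel" using open_points[OF sm] by simp
  have sets: "B \<in> sets \<mu>" if "B \<in> sets borel" "B \<subseteq> points M" for B
    unfolding st using pM that by (simp add: sets_restrict_space_iff)
  show "K \<in> sets \<mu>" using K by (intro sets borel_closed compact_imp_closed)
  obtain J :: "'a set" and c \<eta> L where J: "finite J"
    and cL: "\<And>q. q \<in> J \<Longrightarrow> c q \<in> chart_idx M" "\<And>q. q \<in> J \<Longrightarrow> compact (L q)"
    "\<And>q. q \<in> J \<Longrightarrow> L q \<subseteq> chart_dom M (c q)" and "\<And>q. q \<in> J \<Longrightarrow> C1_function M (\<eta> q)"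
    and "\<And>q p. q \<in> J \<Longrightarrow> 0 \<le> \<eta> q p \<and> \<eta> q p \<le> 1"
    and \<eta>: "\<And>q p. q \<in> J \<Longrightarrow> p \<notin> L q \<Longrightarrow> \<eta> q p = 0" "\<And>p. p \<in> K \<Longrightarrow> (\<Sum>q\<in>J. \<eta> q p) = 1"
    by (rule partition_of_unity[OF sm K]) (rule that, assumption+)
  have Lf: "L q \<in> sets \<mu> \<and> emeasure \<mu> (L q) < \<infinity>" if q: "q \<in> J" for q
  proof -
    have Lb: "L q \<in> sets borel" using cL q by (intro borel_closed compact_imp_closed) auto
    have Lm: "L q \<in> sets \<mu>" using sets[OF Lb] cL(3)[OF q] chart_dom_subset_points[OF cL(1)[OF q]] by (meson subset_trans)
    define V where "V = chart_map M (c q) ` L q"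
    note V = chart_map_image_compact[OF sm cL[OF q], folded V_def]
    have "integrable lborel (\<lambda>y. indicator V y *\<^sub>R vol_density M (c q) y)"
      using V Ck_on_imp_continuous_on[OF C1_on_vol_density[OF M cL(1)[OF q]]]
      by (intro borel_integrable_compact) (auto intro: continuous_on_subset)
    then have "(\<integral>\<^sup>+ y. ennreal (norm (indicator V y *\<^sub>R vol_density M (c q) y)) \<partial>lborel) < \<infinity>"
      by (simp add: integrable_iff_bounded)
    moreover have "(\<integral>\<^sup>+ y \<in> V. ennreal (vol_density M (c q) y) \<partial>lborel)
        = (\<integral>\<^sup>+ y. ennreal (norm (indicator V y *\<^sub>R vol_density M (c q) y)) \<partial>lborel)"
      using vol_density_pos[OF M cL(1)[OF q]]
      by (intro nn_integral_cong) (auto simp: indicator_def abs_of_pos dest!: subsetD[OF V(2)])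
    moreover have "emeasure \<mu> (L q) = (\<integral>\<^sup>+ y \<in> V. ennreal (vol_density M (c q) y) \<partial>lborel)"
      using \<mu> cL[OF q] Lb by (simp add: is_riemannian_measure_def V_def)
    ultimately show ?thesis using Lm by simp
  qed
  have "K \<subseteq> (\<Union>q\<in>J. L q)"
  proof
    fix p assume p: "p \<in> K"
    show "p \<in> (\<Union>q\<in>J. L q)"
    proof (rule ccontr)
      assume "p \<notin> (\<Union>q\<in>J. L q)"
      then have "(\<Sum>q\<in>J. \<eta> q p) = 0" using \<eta>(1) by (intro sum.neutral) auto
      then show False using \<eta>(2)[OF p] by simp
    qed
  qed
  then have "emeasure \<mu> K \<le> emeasure \<mu> (\<Union>q\<in>J. L q)"
    using Lf J by (intro emeasure_mono) auto
  also have "\<dots> \<le> (\<Sum>q\<in>J. emeasure \<mu> (L q))"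
    using Lf J by (intro emeasure_subadditive_finite) auto
  also have "\<dots> < \<infinity>" using Lf J by (simp add: ennreal_sum_less_top)
  finally show "emeasure \<mu> K < \<infinity>" .
qed

lemma integrable_riemannian_continuous:
  fixes M :: "('i, 'a::{t2_space, second_countable_topology}, 'e::euclidean_space) riem_atlas"
    and f :: "'a \<Rightarrow> real"
  assumes M: "riemannian_manifold M" and \<mu>: "is_riemannian_measure M \<mu>"
    and f: "continuous_on (points M) f" and K: "compact K" "K \<subseteq> points M"
    and f0: "\<And>p. p \<in> points M \<Longrightarrow> p \<notin> K \<Longrightarrow> f p = 0"
  shows "integrable \<mu> f"
proof -
  have "bounded (f ` K)"
    using K f by (intro compact_imp_bounded compact_continuous_image) (auto intro: continuous_on_subset)
  then obtain C where C: "\<And>p. p \<in> K \<Longrightarrow> norm (f p) \<le> C" unfolding bounded_pos by auto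
  have sp: "space \<mu> = points M" using \<mu> by (auto simp: is_riemannian_measure_def)
  show ?thesis
  proof (rule integrableI_bounded_set[where A = K and B = C])
    show "f \<in> borel_measurable \<mu>" by (rule borel_measurable_riemannian_continuous[OF \<mu> f])
    show "AE p in \<mu>. p \<in> K \<longrightarrow> norm (f p) \<le> C" using C by auto
    show "AE p in \<mu>. p \<notin> K \<longrightarrow> f p = 0" using f0 sp by auto
  qed (use emeasure_compact_riemannian[OF M \<mu> K] in auto)
qed

subsection \<open>Differentials and transition maps\<close>

lemma frechet_derivative_cong_open:
  assumes "open T" "x \<in> T" "\<And>y. y \<in> T \<Longrightarrow> f y = g y"
  shows "frechet_derivative f (at x) = frechet_derivative g (at x)"
proof -
  have "(f has_derivative D) (at x) \<longleftrightarrow> (g has_derivative D) (at x)" for D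
    using has_derivative_transform_within_open[of f D x UNIV T g]
      has_derivative_transform_within_open[of g D x UNIV T f] assms by auto
  then show ?thesis unfolding frechet_derivative_def by simp
qed

definition differential ::
  "('i, 'a, 'e::euclidean_space) riem_atlas \<Rightarrow> ('a \<Rightarrow> real) \<Rightarrow> 'i \<Rightarrow> 'a \<Rightarrow> 'e \<Rightarrow> real" where
  "differential M f i p = frechet_derivative (\<lambda>y. f (chart_inv M i y)) (at (chart_map M i p))"

definition transition_deriv ::
  "('i, 'a, 'e::euclidean_space) riem_atlas \<Rightarrow> 'i \<Rightarrow> 'i \<Rightarrow> 'a \<Rightarrow> 'e \<Rightarrow> 'e" where
  "transition_deriv M i j p = frechet_derivative (transition M i j) (at (chart_map M i p))"

lemma differential_cong:
  assumes M: "smooth_manifold M" and i: "i \<in> chart_idx M" and U: "open U" "p \<in> U" "p \<in> chart_dom M i"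
    and eq: "\<And>q. q \<in> U \<Longrightarrow> q \<in> chart_dom M i \<Longrightarrow> f q = g q"
  shows "differential M f i p = differential M g i p"
  unfolding differential_def
proof (rule frechet_derivative_cong_open)
  show "open {y \<in> chart_img M i. chart_inv M i y \<in> U}" by (rule open_chart_preimage[OF M i U(1)])
qed (use U eq chart_map_in_img[OF M i] chart_inv_in_dom[OF M i] chart_inv_chart_map[OF M i] in auto)

lemma differential_zero:
  assumes "smooth_manifold M" "i \<in> chart_idx M" "open U" "p \<in> U" "p \<in> chart_dom M i"
    "\<And>q. q \<in> U \<Longrightarrow> q \<in> chart_dom M i \<Longrightarrow> f q = 0"
  shows "differential M f i p w = 0"
  using differential_cong[of M i U p f "\<lambda>_. 0"] assms by (simp add: differential_def)

lemma differential_has_derivative: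
  assumes "smooth_manifold M" "C1_function M f" "i \<in> chart_idx M" "p \<in> chart_dom M i"
  shows "((\<lambda>y. f (chart_inv M i y)) has_derivative differential M f i p) (at (chart_map M i p))"
  unfolding differential_def
  using Ck_on_has_derivative[OF C1_functionD[OF assms(2,3)]] chart_map_in_img[OF assms(1,3,4)] by simp

lemma linear_differential:
  assumes "smooth_manifold M" "C1_function M f" "i \<in> chart_idx M" "p \<in> chart_dom M i"
  shows "linear (differential M f i p)"
  using differential_has_derivative[OF assms] by (rule has_derivative_linear)

lemma differential_sum:
  assumes "smooth_manifold M" "\<And>q. q \<in> J \<Longrightarrow> C1_function M (f q)" "i \<in> chart_idx M" "p \<in> chart_dom M i"
  shows "differential M (\<lambda>p. \<Sum>q\<in>J. f q p) i p w = (\<Sum>q\<in>J. differential M (f q) i p w)"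
proof -
  have "((\<lambda>y. \<Sum>q\<in>J. f q (chart_inv M i y)) has_derivative (\<lambda>w. \<Sum>q\<in>J. differential M (f q) i p w))
      (at (chart_map M i p))"
    by (intro has_derivative_sum differential_has_derivative assms)
  then show ?thesis
    unfolding differential_def[of M "\<lambda>p. \<Sum>q\<in>J. f q p"] by (simp add: frechet_derivative_eqI)
qed

lemma transition_has_derivative:
  assumes "smooth_manifold M" "i \<in> chart_idx M" "j \<in> chart_idx M" "p \<in> chart_dom M i" "p \<in> chart_dom M j"
  shows "(transition M i j has_derivative transition_deriv M i j p) (at (chart_map M i p))"
  unfolding transition_deriv_def
  using Ck_on_has_derivative[OF smooth_on_Ck[OF smooth_on_transition[OF assms(1-3)], of 1]]
    chart_map_in_img[OF assms(1,2,4)] chart_inv_chart_map[OF assms(1,2,4)] assms(5) by simp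

lemma transition_chart_map:
  assumes "smooth_manifold M" "i \<in> chart_idx M" "p \<in> chart_dom M i"
  shows "transition M i j (chart_map M i p) = chart_map M j p"
  using chart_inv_chart_map[OF assms] by (simp add: transition_def)

lemma differential_transition:
  assumes M: "smooth_manifold M" and f: "C1_function M f"
    and i: "i \<in> chart_idx M" "p \<in> chart_dom M i" and j: "j \<in> chart_idx M" "p \<in> chart_dom M j"
  shows "differential M f i p w = differential M f j p (transition_deriv M i j p w)"
proof -
  let ?T = "{y \<in> chart_img M i. chart_inv M i y \<in> chart_dom M j}"
  have T: "open ?T" "chart_map M i p \<in> ?T"
    using open_chart_preimage[OF M i(1) open_chart_dom[OF M j(1)]] chart_map_in_img[OF M i]
      chart_inv_chart_map[OF M i] j(2) by auto
  have "((\<lambda>y. f (chart_inv M j (transition M i j y))) has_derivative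
      (\<lambda>w. differential M f j p (transition_deriv M i j p w))) (at (chart_map M i p))"
    by (rule has_derivative_compose[OF transition_has_derivative[OF M i(1) j(1) i(2) j(2)]])
       (use differential_has_derivative[OF M f j] transition_chart_map[OF M i, of j] in simp)
  then have "((\<lambda>y. f (chart_inv M i y)) has_derivative
      (\<lambda>w. differential M f j p (transition_deriv M i j p w))) (at (chart_map M i p))"
    by (rule has_derivative_transform_within_open[OF _ T])
       (simp add: transition_def chart_inv_chart_map[OF M j(1)])
  then show ?thesis
    unfolding differential_def[of M f i p] by (simp add: frechet_derivative_eqI)
qed

lemma transition_deriv_inverse:
  assumes M: "smooth_manifold M"
    and i: "i \<in> chart_idx M" "p \<in> chart_dom M i" and j: "j \<in> chart_idx M" "p \<in> chart_dom M j"
  shows "transition_deriv M i j p (transition_deriv M j i p w) = w"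
proof -
  let ?T = "{y \<in> chart_img M j. chart_inv M j y \<in> chart_dom M i}"
  have T: "open ?T" "chart_map M j p \<in> ?T"
    using open_chart_preimage[OF M j(1) open_chart_dom[OF M i(1)]] chart_map_in_img[OF M j]
      chart_inv_chart_map[OF M j] i(2) by auto
  have "((\<lambda>y. transition M i j (transition M j i y)) has_derivative
      (\<lambda>w. transition_deriv M i j p (transition_deriv M j i p w))) (at (chart_map M j p))"
    by (rule has_derivative_compose[OF transition_has_derivative[OF M j(1) i(1) j(2) i(2)]])
       (use transition_has_derivative[OF M i(1) j(1) i(2) j(2)] transition_chart_map[OF M j, of i] in simp)
  then have "((\<lambda>y. y) has_derivative
      (\<lambda>w. transition_deriv M i j p (transition_deriv M j i p w))) (at (chart_map M j p))"
    by (rule has_derivative_transform_within_open[OF _ T])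
       (simp add: transition_def chart_inv_chart_map[OF M i(1)] chart_map_chart_inv[OF M j(1)])
  from has_derivative_unique[OF this has_derivative_ident] show ?thesis by meson
qed

lemma rmetric_transition:
  assumes "riemannian_manifold M" "i \<in> chart_idx M" "p \<in> chart_dom M i" "j \<in> chart_idx M" "p \<in> chart_dom M j"
  shows "rmetric M i p u w = rmetric M j p (transition_deriv M i j p u) (transition_deriv M i j p w)"
  using assms unfolding riemannian_manifold_def transition_deriv_def Let_def by blast

subsection \<open>Gradients and vector fields\<close>

lemma rmetric_rgrad:
  assumes M: "riemannian_manifold M" and f: "C1_function M f" and i: "i \<in> chart_idx M" "p \<in> chart_dom M i"
  shows "rmetric M i p (rgrad M f i p) w = differential M f i p w"
proof -
  note sm = riemannian_manifold_smooth[OF M]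
  have "\<exists>!u. \<forall>w. rmetric M i p u w = differential M f i p w"
    by (rule pos_def_form_riesz[OF rmetric_pos_def_form[OF M i] linear_differential[OF sm f i]])
  from theI'[OF this] show ?thesis
    by (simp add: rgrad_def differential_def o_def)
qed

lemma rgrad_unique:
  assumes M: "riemannian_manifold M" and f: "C1_function M f" and i: "i \<in> chart_idx M" "p \<in> chart_dom M i"
    and u: "\<And>w. rmetric M i p u w = differential M f i p w"
  shows "rgrad M f i p = u"
  using pos_def_form_riesz[OF rmetric_pos_def_form[OF M i]
      linear_differential[OF riemannian_manifold_smooth[OF M] f i]]
    rmetric_rgrad[OF M f i] u by blast

definition C1_vector_field ::
  "('i, 'a, 'e::euclidean_space) riem_atlas \<Rightarrow> ('i \<Rightarrow> 'a \<Rightarrow> 'e) \<Rightarrow> bool" where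
  "C1_vector_field M X \<longleftrightarrow>
     (\<forall>i\<in>chart_idx M. C1_on (chart_img M i) (\<lambda>y. X i (chart_inv M i y))) \<and>
     (\<forall>i\<in>chart_idx M. \<forall>j\<in>chart_idx M. \<forall>p\<in>chart_dom M i \<inter> chart_dom M j.
        X j p = transition_deriv M i j p (X i p))"

text \<open>For \<open>X = rgrad M g\<close> this is the pairing of the gradients of
  \<open>g\<close> and \<open>f\<close> in Green's formula, and the squared length of the gradient
  when \<open>f = g\<close>.\<close>

definition dir_deriv ::
  "('i, 'a, 'e::euclidean_space) riem_atlas \<Rightarrow> ('i \<Rightarrow> 'a \<Rightarrow> 'e) \<Rightarrow> ('a \<Rightarrow> real) \<Rightarrow> 'a \<Rightarrow> real" where
  "dir_deriv M X f p = (let i = chart_at M p in differential M f i p (X i p))"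

lemma dir_deriv_chart:
  assumes "smooth_manifold M" "C1_vector_field M X" "C1_function M f" "i \<in> chart_idx M" "p \<in> chart_dom M i"
  shows "dir_deriv M X f p = differential M f i p (X i p)"
proof -
  have p: "p \<in> points M" using assms(4,5) by (auto simp: points_def)
  have "X (chart_at M p) p = transition_deriv M i (chart_at M p) p (X i p)"
    using assms chart_at[OF p] unfolding C1_vector_field_def by blast
  then show ?thesis
    using differential_transition[OF assms(1,3-5) chart_at[OF p]] by (simp add: dir_deriv_def Let_def)
qed

text \<open>Regularity comes from Cramer's rule. For the change of charts, uniqueness of the
  gradient reduces the claim to testing the transformed vector against \<open>w\<close>. Writing
  \<open>w\<close> as an image under the transition derivative brings it into the form to which
  invariance of the metric applies.\<close>

lemma C1_vector_field_rgrad: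
  assumes M: "riemannian_manifold M"
    and f: "\<And>i. i \<in> chart_idx M \<Longrightarrow> Ck_on 2 (chart_img M i) (\<lambda>y. f (chart_inv M i y))"
  shows "C1_vector_field M (rgrad M f)"
  unfolding C1_vector_field_def
proof (intro conjI ballI)
  note sm = riemannian_manifold_smooth[OF M]
  have f1: "C1_function M f"
    unfolding C1_function_def by (intro ballI Ck_on_le[OF f]) auto
  fix i assume i: "i \<in> chart_idx M"
  show "C1_on (chart_img M i) (\<lambda>y. rgrad M f i (chart_inv M i y))"
  proof (rule C1_on_riesz[OF open_chart_img[OF sm i]])
    show "pos_def_form (rmetric M i (chart_inv M i y))" if "y \<in> chart_img M i" for y
      by (rule rmetric_pos_def_form[OF M i chart_inv_in_dom[OF sm i that]])
    show "C1_on (chart_img M i) (\<lambda>y. rmetric M i (chart_inv M i y) u w)" for u w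
      by (rule C1_on_rmetric[OF M i])
    show "C1_on (chart_img M i) (\<lambda>y. frechet_derivative (\<lambda>y. f (chart_inv M i y)) (at y) w)" for w
      by (rule Ck_on_frechet) (use f[OF i] in \<open>simp add: numeral_2_eq_2\<close>)
    show "rmetric M i (chart_inv M i y) (rgrad M f i (chart_inv M i y)) w
        = frechet_derivative (\<lambda>y. f (chart_inv M i y)) (at y) w" if "y \<in> chart_img M i" for y w
      using rmetric_rgrad[OF M f1 i chart_inv_in_dom[OF sm i that]]
      by (simp add: differential_def chart_map_chart_inv[OF sm i that])
  qed
  fix j p assume j: "j \<in> chart_idx M" and p: "p \<in> chart_dom M i \<inter> chart_dom M j"
  then have p: "p \<in> chart_dom M i" "p \<in> chart_dom M j" by auto
  show "rgrad M f j p = transition_deriv M i j p (rgrad M f i p)"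
  proof (rule rgrad_unique[OF M f1 j p(2)])
    fix w
    have "rmetric M j p (transition_deriv M i j p (rgrad M f i p)) w
      = rmetric M j p (transition_deriv M i j p (rgrad M f i p))
          (transition_deriv M i j p (transition_deriv M j i p w))"
      by (simp add: transition_deriv_inverse[OF sm i p(1) j p(2)])
    also have "\<dots> = rmetric M i p (rgrad M f i p) (transition_deriv M j i p w)"
      using rmetric_transition[OF M i p(1) j p(2)] by simp
    also have "\<dots> = differential M f i p (transition_deriv M j i p w)"
      by (rule rmetric_rgrad[OF M f1 i p(1)])
    also have "\<dots> = differential M f j p w"
      by (rule differential_transition[OF sm f1 j p(2) i p(1), symmetric])
    finally show "rmetric M j p (transition_deriv M i j p (rgrad M f i p)) w = differential M f j p w" .
  qed
qed

lemma rnorm2_rgrad: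
  assumes M: "riemannian_manifold M" and f: "C1_function M f" and p: "p \<in> points M"
  shows "rnorm2 M (rgrad M f) p = dir_deriv M (rgrad M f) f p"
  using rmetric_rgrad[OF M f chart_at[OF p]] by (simp add: rnorm2_def dir_deriv_def Let_def)

subsection \<open>The divergence theorem\<close>

text \<open>\<open>rdiv\<close> uses the chart selected by \<open>chart_at\<close>. With the chart
  as an argument, independence of it can be stated and integration by parts can be done in one fixed
  chart.\<close>

definition chart_div ::
  "('i, 'a, 'e::euclidean_space) riem_atlas \<Rightarrow> ('i \<Rightarrow> 'a \<Rightarrow> 'e) \<Rightarrow> 'i \<Rightarrow> 'a \<Rightarrow> real" where
  "chart_div M X i p = (\<Sum>b\<in>Basis. frechet_derivative
      (\<lambda>y. vol_density M i y * (X i (chart_inv M i y) \<bullet> b)) (at (chart_map M i p)) b)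
      / vol_density M i (chart_map M i p)"

lemma rdiv_eq_chart_div: "rdiv M X p = chart_div M X (chart_at M p) p"
  by (simp add: rdiv_def chart_div_def Let_def)

lemma C1_on_density_component:
  assumes "riemannian_manifold M" "C1_vector_field M X" "i \<in> chart_idx M"
  shows "C1_on (chart_img M i) (\<lambda>y. vol_density M i y * (X i (chart_inv M i y) \<bullet> b))"
proof -
  note o = open_chart_img[OF riemannian_manifold_smooth[OF assms(1)] assms(3)]
  have "C1_on (chart_img M i) (\<lambda>y. X i (chart_inv M i y))"
    using assms by (simp add: C1_vector_field_def)
  then show ?thesis
    by (intro Ck_on_mult[OF o] C1_on_vol_density[OF assms(1,3)]
        Ck_on_bilinear[OF o bounded_bilinear_inner] Ck_on_const[OF o])
qed

lemma continuous_on_chart_div: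
  assumes "riemannian_manifold M" "C1_vector_field M X" "i \<in> chart_idx M"
  shows "continuous_on (chart_img M i) (\<lambda>y. chart_div M X i (chart_inv M i y))"
proof -
  note sm = riemannian_manifold_smooth[OF assms(1)]
  have "continuous_on (chart_img M i) (\<lambda>y. (\<Sum>b\<in>Basis. frechet_derivative
      (\<lambda>y. vol_density M i y * (X i (chart_inv M i y) \<bullet> b)) (at y) b) / vol_density M i y)"
  proof (intro continuous_on_divide continuous_on_sum)
    show "continuous_on (chart_img M i)
      (\<lambda>y. frechet_derivative (\<lambda>y. vol_density M i y * (X i (chart_inv M i y) \<bullet> b)) (at y) b)" for b
      using C1_on_density_component[OF assms, of b] by simp
    show "continuous_on (chart_img M i) (vol_density M i)"
      by (rule Ck_on_imp_continuous_on[OF C1_on_vol_density[OF assms(1,3)]])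
    show "\<forall>y\<in>chart_img M i. vol_density M i y \<noteq> 0"
      using vol_density_pos[OF assms(1,3)] by force
  qed
  then show ?thesis
    by (rule continuous_on_eq) (simp add: chart_div_def chart_map_chart_inv[OF sm assms(3)])
qed

lemma continuous_on_dir_deriv_chart:
  assumes "riemannian_manifold M" "C1_vector_field M X" "C1_function M f" "i \<in> chart_idx M"
  shows "continuous_on (chart_img M i) (\<lambda>y. differential M f i (chart_inv M i y) (X i (chart_inv M i y)))"
proof -
  note sm = riemannian_manifold_smooth[OF assms(1)]
  have X: "continuous_on (chart_img M i) (\<lambda>y. X i (chart_inv M i y))"
    using assms by (intro Ck_on_imp_continuous_on) (auto simp: C1_vector_field_def simp del: Ck_on.simps)
  have "continuous_on (chart_img M i)
      (\<lambda>y. frechet_derivative (\<lambda>y. f (chart_inv M i y)) (at y) (X i (chart_inv M i y)))"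
    by (rule C1_on_frechet_continuous[OF C1_functionD[OF assms(3,4)] continuous_on_id X]) auto
  then show ?thesis
    by (rule continuous_on_eq) (simp add: differential_def chart_map_chart_inv[OF sm assms(4)])
qed

lemma continuous_on_dir_deriv:
  assumes "riemannian_manifold M" "C1_vector_field M X" "C1_function M f"
  shows "continuous_on (points M) (dir_deriv M X f)"
proof (rule continuous_on_points[OF riemannian_manifold_smooth[OF assms(1)]])
  note sm = riemannian_manifold_smooth[OF assms(1)]
  fix i assume i: "i \<in> chart_idx M"
  show "continuous_on (chart_img M i) (\<lambda>y. dir_deriv M X f (chart_inv M i y))"
    by (rule continuous_on_eq[OF continuous_on_dir_deriv_chart[OF assms i]])
       (simp add: dir_deriv_chart[OF sm assms(2,3) i chart_inv_in_dom[OF sm i]])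
qed

lemma continuous_on_chart_dom:
  assumes "smooth_manifold M" "i \<in> chart_idx M" "continuous_on (chart_img M i) (\<lambda>y. f (chart_inv M i y))"
  shows "continuous_on (chart_dom M i) f"
proof -
  have "continuous_on (chart_dom M i) (\<lambda>p. f (chart_inv M i (chart_map M i p)))"
    by (rule continuous_on_compose2[OF assms(3) continuous_on_chart_map[OF assms(1,2)]])
       (use chart_map_in_img[OF assms(1,2)] in auto)
  then show ?thesis by (rule continuous_on_eq) (simp add: chart_inv_chart_map[OF assms(1,2)])
qed

text \<open>Formulated with Lebesgue measure in coordinates, so that it also applies to the factor
  \<open>N\<close>, on which no Riemannian measure is given.\<close>

lemma integrable_lborel_chart:
  fixes M :: "('i, 'a::{t2_space, second_countable_topology}, 'e::euclidean_space) riem_atlas"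
    and f :: "'a \<Rightarrow> real"
  assumes M: "riemannian_manifold M" and i: "i \<in> chart_idx M"
    and f: "continuous_on (chart_img M i) (\<lambda>y. f (chart_inv M i y))"
    and L: "compact L" "L \<subseteq> chart_dom M i" and f0: "\<forall>p\<in>points M - L. f p = 0"
  shows "integrable lborel (\<lambda>y. indicator (chart_img M i) y * (vol_density M i y * f (chart_inv M i y)))"
proof -
  note sm = riemannian_manifold_smooth[OF M]
  define V where "V = chart_map M i ` L"
  note V = chart_map_image_compact[OF sm i L, folded V_def]
  have "continuous_on V (\<lambda>y. vol_density M i y * f (chart_inv M i y))"
    using V f Ck_on_imp_continuous_on[OF C1_on_vol_density[OF M i]]
    by (auto intro!: continuous_on_mult intro: continuous_on_subset)
  from borel_integrable_compact[OF V(1) this]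
  have "integrable lborel (\<lambda>y. indicator V y *\<^sub>R (vol_density M i y * f (chart_inv M i y)))" .
  also have "(\<lambda>y. indicator V y *\<^sub>R (vol_density M i y * f (chart_inv M i y)))
      = (\<lambda>y. indicator (chart_img M i) y * (vol_density M i y * f (chart_inv M i y)))"
  proof
    fix y
    have "f (chart_inv M i y) = 0" if "y \<in> chart_img M i" "y \<notin> V"
      using f0 V(3)[OF that] by blast
    then show "indicator V y *\<^sub>R (vol_density M i y * f (chart_inv M i y))
        = indicator (chart_img M i) y * (vol_density M i y * f (chart_inv M i y))"
      using V(2) by (auto simp: indicator_def)
  qed
  finally show ?thesis .
qed

lemma integrable_chart_support:
  fixes M :: "('i, 'a::{t2_space, second_countable_topology}, 'e::euclidean_space) riem_atlas"
    and f :: "'a \<Rightarrow> real"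
  assumes M: "riemannian_manifold M" and \<mu>: "is_riemannian_measure M \<mu>" and i: "i \<in> chart_idx M"
    and f: "continuous_on (chart_img M i) (\<lambda>y. f (chart_inv M i y))"
    and L: "compact L" "L \<subseteq> chart_dom M i" and f0: "\<forall>p\<in>points M - L. f p = 0"
  shows "(\<integral>p. f p \<partial>\<mu>) =
      (\<integral>y. indicator (chart_img M i) y * (vol_density M i y * f (chart_inv M i y)) \<partial>lborel)"
    and "integrable \<mu> f"
    and "integrable lborel (\<lambda>y. indicator (chart_img M i) y * (vol_density M i y * f (chart_inv M i y)))"
proof -
  have fm: "f \<in> borel_measurable (restrict_space borel (chart_dom M i))"
    by (rule borel_measurable_continuous_on_restrict
        [OF continuous_on_chart_dom[OF riemannian_manifold_smooth[OF M] i f]])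
  have f0': "\<And>p. p \<in> points M \<Longrightarrow> p \<notin> chart_dom M i \<Longrightarrow> f p = 0" using f0 L by blast
  show "(\<integral>p. f p \<partial>\<mu>) =
      (\<integral>y. indicator (chart_img M i) y * (vol_density M i y * f (chart_inv M i y)) \<partial>lborel)"
    by (rule integral_chart[OF M \<mu> i fm f0'])
  show int: "integrable lborel (\<lambda>y. indicator (chart_img M i) y * (vol_density M i y * f (chart_inv M i y)))"
    by (rule integrable_lborel_chart[OF M i f L f0])
  then show "integrable \<mu> f" using integrable_chart[OF M \<mu> i fm f0'] by blast
qed

lemma dir_deriv_zero:
  assumes "smooth_manifold M" "compact L" "p \<in> points M" "p \<notin> L"
    "\<And>p. p \<in> points M \<Longrightarrow> p \<notin> L \<Longrightarrow> f p = 0"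
  shows "dir_deriv M X f p = 0"
  unfolding dir_deriv_def Let_def
  by (rule differential_zero[of _ _ "- L"])
     (use assms chart_at[OF assms(3)] chart_dom_subset_points[OF chart_at(1)[OF assms(3)]]
       compact_imp_closed in \<open>auto simp: open_Compl\<close>)

lemma rgrad_zero:
  assumes M: "riemannian_manifold M" and f: "C1_function M f" and i: "i \<in> chart_idx M" "p \<in> chart_dom M i"
    and U: "open U" "p \<in> U" "\<And>q. q \<in> U \<Longrightarrow> q \<in> chart_dom M i \<Longrightarrow> f q = 0"
  shows "rgrad M f i p = 0"
proof (rule rgrad_unique[OF M f i])
  fix w
  have "linear (\<lambda>u. rmetric M i p u w)"
    using rmetric_pos_def_form[OF M i] by (simp add: pos_def_form_def bilinear_def)
  from linear_0[OF this] show "rmetric M i p 0 w = differential M f i p w"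
    using differential_zero[OF riemannian_manifold_smooth[OF M] i(1) U(1,2) i(2) U(3)] by simp
qed

lemma laplacian_zero:
  assumes M: "riemannian_manifold M" and f: "C1_function M f" and K: "compact K"
    and p: "p \<in> points M" "p \<notin> K" and f0: "\<And>p. p \<in> points M \<Longrightarrow> p \<notin> K \<Longrightarrow> f p = 0"
  shows "laplacian M f p = 0"
proof -
  note sm = riemannian_manifold_smooth[OF M] and i = chart_at[OF p(1)]
  let ?i = "chart_at M p"
  have oK: "open (- K)" using compact_imp_closed[OF K] by (simp add: open_Compl)
  let ?T = "{y \<in> chart_img M ?i. chart_inv M ?i y \<in> - K}"
  have "rgrad M f ?i (chart_inv M ?i y) = 0" if "y \<in> ?T" for y
    by (rule rgrad_zero[OF M f i(1) _ oK])
       (use that chart_inv_in_dom[OF sm i(1)] f0 chart_dom_subset_points[OF i(1)] in auto)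
  moreover have "open ?T" by (rule open_chart_preimage[OF sm i(1) oK])
  moreover have "chart_map M ?i p \<in> ?T"
    using p(2) chart_map_in_img[OF sm i] chart_inv_chart_map[OF sm i] by simp
  ultimately have "frechet_derivative (\<lambda>y. vol_density M ?i y * (rgrad M f ?i (chart_inv M ?i y) \<bullet> b))
      (at (chart_map M ?i p)) = (\<lambda>w. 0)" for b
    by (intro frechet_derivative_zero_on[of ?T]) auto
  then show ?thesis by (simp add: laplacian_def rdiv_eq_chart_div chart_div_def)
qed

text \<open>In coordinates, the density times \<open>f div X + X f\<close> is the Euclidean
  divergence of the field \<open>f X\<close> multiplied by the density. Extended by 0 from the chart
  image, that field is C^1 with compact support, and the integrals of its partial derivatives
  vanish.\<close>

lemma chart_divergence_theorem:
  fixes M :: "('i, 'a::{t2_space, second_countable_topology}, 'e::euclidean_space) riem_atlas"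
  assumes M: "riemannian_manifold M" and \<mu>: "is_riemannian_measure M \<mu>" and i: "i \<in> chart_idx M"
    and X: "C1_vector_field M X" and f: "C1_function M f"
    and L: "compact L" "L \<subseteq> chart_dom M i" and f0: "\<And>p. p \<in> points M \<Longrightarrow> p \<notin> L \<Longrightarrow> f p = 0"
  shows "integrable \<mu> (\<lambda>p. f p * chart_div M X i p)" "integrable \<mu> (dir_deriv M X f)"
    and "(\<integral>p. f p * chart_div M X i p \<partial>\<mu>) = - (\<integral>p. dir_deriv M X f p \<partial>\<mu>)"
proof -
  note sm = riemannian_manifold_smooth[OF M]
  let ?I = "chart_img M i"
  define \<phi> where "\<phi> y = f (chart_inv M i y)" for y
  define Z where "Z b y = vol_density M i y * (X i (chart_inv M i y) \<bullet> b)" for b y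
  have \<phi>: "C1_on ?I \<phi>" unfolding \<phi>_def by (rule C1_functionD[OF f i])
  have Z: "C1_on ?I (Z b)" for b unfolding Z_def by (rule C1_on_density_component[OF M X i])
  have oI: "open ?I" by (rule open_chart_img[OF sm i])
  have cont1: "continuous_on ?I (\<lambda>y. f (chart_inv M i y) * chart_div M X i (chart_inv M i y))"
    by (intro continuous_on_mult continuous_on_chart_div[OF M X i] Ck_on_imp_continuous_on[OF C1_functionD[OF f i]])
  have cont2: "continuous_on ?I (\<lambda>y. dir_deriv M X f (chart_inv M i y))"
    by (rule continuous_on_eq[OF continuous_on_dir_deriv_chart[OF M X f i]])
       (simp add: dir_deriv_chart[OF sm X f i chart_inv_in_dom[OF sm i]])
  have zero1: "\<forall>p\<in>points M - L. f p * chart_div M X i p = 0" using f0 by simp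
  have zero2: "\<forall>p\<in>points M - L. dir_deriv M X f p = 0"
    by (auto intro!: dir_deriv_zero[OF sm L(1)] f0)
  note c1 = integrable_chart_support[OF M \<mu> i cont1 L zero1]
  note c2 = integrable_chart_support[OF M \<mu> i cont2 L zero2]
  show "integrable \<mu> (\<lambda>p. f p * chart_div M X i p)" by (rule c1(2))
  show "integrable \<mu> (dir_deriv M X f)" by (rule c2(2))
  define V where "V = chart_map M i ` L"
  note V = chart_map_image_compact[OF sm i L, folded V_def]
  have \<phi>0: "\<phi> y = 0" if "y \<in> ?I" "y \<notin> V" for y
    unfolding \<phi>_def using f0 V(3)[OF that] by blast
  define g where "g b y = (if y \<in> ?I then \<phi> y * Z b y else 0)" for b y
  \<comment> \<open>Off the chart image both sides are 0: there \<open>y\<close> lies in the open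
    set \<open>- V\<close>, on which \<open>g b\<close> vanishes identically.\<close>
  have gd: "frechet_derivative (g b) (at y) w
      = indicator ?I y * (\<phi> y * frechet_derivative (Z b) (at y) w + frechet_derivative \<phi> (at y) w * Z b y)" for b y w
  proof (cases "y \<in> ?I")
    case True
    have "((\<lambda>y. \<phi> y * Z b y) has_derivative
       (\<lambda>w. \<phi> y * frechet_derivative (Z b) (at y) w + frechet_derivative \<phi> (at y) w * Z b y)) (at y)"
      using Ck_on_has_derivative[OF \<phi> _ True] Ck_on_has_derivative[OF Z _ True]
      by (intro has_derivative_mult) auto
    then have "(g b has_derivative
       (\<lambda>w. \<phi> y * frechet_derivative (Z b) (at y) w + frechet_derivative \<phi> (at y) w * Z b y)) (at y)"
      by (rule has_derivative_transform_within_open[OF _ oI True]) (simp add: g_def)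
    then show ?thesis using True by (simp add: frechet_derivative_eqI)
  next
    case False
    have "frechet_derivative (g b) (at y) = (\<lambda>w. 0)"
      by (rule frechet_derivative_zero_on[of "- V"])
         (use False V compact_imp_closed[OF V(1)] \<phi>0 in \<open>auto simp: g_def open_Compl\<close>)
    then show ?thesis using False by simp
  qed
  have gC: "C1_on UNIV (g b)" for b
  proof (rule Ck_on_local)
    fix y :: 'e
    show "\<exists>T. open T \<and> y \<in> T \<and> C1_on T (g b)"
    proof (cases "y \<in> ?I")
      case True
      have "C1_on ?I (g b)"
        by (rule Ck_on_cong[OF oI _ Ck_on_mult[OF oI \<phi> Z[of b]]]) (simp add: g_def)
      then show ?thesis using True oI by blast
    next
      case False
      have o: "open (- V)" using compact_imp_closed[OF V(1)] by (simp add: open_Compl)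
      have "C1_on (- V) (g b)"
        by (rule Ck_on_cong[OF o _ Ck_on_const[OF o, of _ 0]]) (use \<phi>0 in \<open>auto simp: g_def\<close>)
      then show ?thesis using False o V(2) by blast
    qed
  qed
  have g0: "g b y = 0" if "y \<notin> V" for b y using \<phi>0 that by (simp add: g_def)
  have gint: "integrable lborel (\<lambda>y. frechet_derivative (g b) (at y) b)" for b
  proof -
    have "integrable lborel (\<lambda>y. indicator V y *\<^sub>R frechet_derivative (g b) (at y) b)"
    proof (rule borel_integrable_compact[OF V(1)])
      have "continuous_on UNIV (\<lambda>y. frechet_derivative (g b) (at y) b)" using gC[of b] by simp
      then show "continuous_on V (\<lambda>y. frechet_derivative (g b) (at y) b)"
        by (rule continuous_on_subset) simp
    qed
    moreover have "frechet_derivative (g b) (at y) b = 0" if "y \<notin> V" for y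
      using frechet_derivative_zero_on[of "- V" y "g b"] that g0 compact_imp_closed[OF V(1)]
      by (simp add: open_Compl)
    then have "(\<lambda>y. indicator V y *\<^sub>R frechet_derivative (g b) (at y) b) = (\<lambda>y. frechet_derivative (g b) (at y) b)"
      by (auto simp: indicator_def fun_eq_iff)
    ultimately show ?thesis by simp
  qed
  \<comment> \<open>The product rule; the density cancels the denominator of
    \<open>chart_div\<close>, and the terms with derivatives of \<phi> add up to the derivative of
    \<open>f\<close> along \<open>X\<close>.\<close>
  have sumeq: "(\<Sum>b\<in>Basis. frechet_derivative (g b) (at y) b)
      = indicator ?I y * (vol_density M i y * (f (chart_inv M i y) * chart_div M X i (chart_inv M i y)))
      + indicator ?I y * (vol_density M i y * dir_deriv M X f (chart_inv M i y))" for y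
  proof (cases "y \<in> ?I")
    case True
    have v: "vol_density M i y \<noteq> 0" using vol_density_pos[OF M i True] by simp
    have lin: "linear (frechet_derivative \<phi> (at y))"
      using Ck_on_has_derivative[OF \<phi> _ True] has_derivative_linear by blast
    have d: "dir_deriv M X f (chart_inv M i y)
        = (\<Sum>b\<in>Basis. (X i (chart_inv M i y) \<bullet> b) * frechet_derivative \<phi> (at y) b)"
      using dir_deriv_chart[OF sm X f i chart_inv_in_dom[OF sm i True]]
        linear_sum_Basis[OF lin, of "X i (chart_inv M i y)"]
      by (simp add: differential_def chart_map_chart_inv[OF sm i True] \<phi>_def[abs_def])
    have "chart_div M X i (chart_inv M i y) = (\<Sum>b\<in>Basis. frechet_derivative (Z b) (at y) b) / vol_density M i y"
      by (simp add: chart_div_def chart_map_chart_inv[OF sm i True] Z_def[abs_def])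
    then have c: "vol_density M i y * (f (chart_inv M i y) * chart_div M X i (chart_inv M i y))
        = (\<Sum>b\<in>Basis. \<phi> y * frechet_derivative (Z b) (at y) b)"
      using v by (simp add: \<phi>_def flip: sum_distrib_left)
    have "vol_density M i y * dir_deriv M X f (chart_inv M i y)
        = (\<Sum>b\<in>Basis. frechet_derivative \<phi> (at y) b * Z b y)"
      unfolding d by (simp add: sum_distrib_left Z_def mult_ac)
    with c show ?thesis using True by (simp add: gd sum.distrib)
  next
    case False
    then show ?thesis by (simp add: gd)
  qed
  have "0 = (\<Sum>b\<in>Basis. \<integral>y. frechet_derivative (g b) (at y) b \<partial>lborel)"
    using integral_partial_derivative_eq_0[OF gC V(1) g0] by simp
  also have "\<dots> = (\<integral>y. (\<Sum>b\<in>Basis. frechet_derivative (g b) (at y) b) \<partial>lborel)"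
    using gint by (simp add: Bochner_Integration.integral_sum)
  also have "\<dots> = (\<integral>p. f p * chart_div M X i p \<partial>\<mu>) + (\<integral>p. dir_deriv M X f p \<partial>\<mu>)"
    unfolding sumeq
    by (subst Bochner_Integration.integral_add[OF c1(3) c2(3)]) (simp only: c1(1) c2(1))
  finally show "(\<integral>p. f p * chart_div M X i p \<partial>\<mu>) = - (\<integral>p. dir_deriv M X f p \<partial>\<mu>)" by simp
qed

text \<open>Both sides have the same integral against every bump function, which saves the change of
  variables formula for the divergence.\<close>

lemma chart_div_le:
  assumes M: "riemannian_manifold M" and \<mu>: "is_riemannian_measure M \<mu>" and X: "C1_vector_field M X"
    and i: "i \<in> chart_idx M" "p \<in> chart_dom M i" and j: "j \<in> chart_idx M" "p \<in> chart_dom M j"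
  shows "chart_div M X i p \<le> chart_div M X j p"
proof (rule ccontr)
  assume neg: "\<not> chart_div M X i p \<le> chart_div M X j p"
  note sm = riemannian_manifold_smooth[OF M]
  define \<delta> where "\<delta> p = chart_div M X i p - chart_div M X j p" for p
  let ?W = "chart_dom M i \<inter> chart_dom M j"
  have cW: "continuous_on ?W \<delta>"
    unfolding \<delta>_def
    using continuous_on_chart_dom[OF sm i(1) continuous_on_chart_div[OF M X i(1)]]
      continuous_on_chart_dom[OF sm j(1) continuous_on_chart_div[OF M X j(1)]]
    by (auto intro!: continuous_on_diff intro: continuous_on_subset)
  have "open ?W" using open_chart_dom[OF sm] i j by auto
  then have oU: "open (?W \<inter> \<delta> -` {0<..})"
    using continuous_open_preimage[OF cW _ open_greaterThan] by simp
  let ?T = "{y \<in> chart_img M i. chart_inv M i y \<in> ?W \<inter> \<delta> -` {0<..}}"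
  have "chart_map M i p \<in> ?T"
    using chart_map_in_img[OF sm i] chart_inv_chart_map[OF sm i] i j neg by (simp add: \<delta>_def)
  moreover have "open ?T" by (rule open_chart_preimage[OF sm i(1) oU])
  ultimately obtain \<rho> where \<rho>: "\<rho> > 0" "cball (chart_map M i p) \<rho> \<subseteq> ?T"
    unfolding open_contains_cball by blast
  let ?z = "chart_map M i p"
  define f where "f = chart_bump M i ?z \<rho>"
  define L where "L = chart_inv M i ` cball ?z \<rho>"
  have sub: "cball ?z \<rho> \<subseteq> chart_img M i" using \<rho>(2) by blast
  have LW: "L \<subseteq> ?W" "\<And>q. q \<in> L \<Longrightarrow> \<delta> q > 0" unfolding L_def using \<rho>(2) by auto
  then have L: "compact L" "L \<subseteq> chart_dom M i" "L \<subseteq> chart_dom M j"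
    using compact_chart_cball[OF sm i(1) sub] by (auto simp: L_def)
  have f: "C1_function M f" unfolding f_def by (rule C1_function_chart_bump[OF sm i(1) \<rho>(1) sub])
  have f0: "f q = 0" if "q \<notin> L" for q
    using chart_bump_support[OF sm i(1) \<rho>(1)] that by (simp add: f_def L_def)
  have fn: "f q \<ge> 0" for q by (simp add: f_def chart_bump_nonneg)
  note di = chart_divergence_theorem[OF M \<mu> i(1) X f L(1,2) f0]
  note dj = chart_divergence_theorem[OF M \<mu> j(1) X f L(1,3) f0]
  have "integrable \<mu> (\<lambda>q. f q * chart_div M X i q - f q * chart_div M X j q)"
    by (rule Bochner_Integration.integrable_diff[OF di(1) dj(1)])
  \<comment> \<open>Each integral equals minus the integral of \<open>dir_deriv M X f\<close>, in
    which neither \<open>i\<close> nor \<open>j\<close> occurs.\<close>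
  moreover have "(\<integral>q. f q * chart_div M X i q - f q * chart_div M X j q \<partial>\<mu>) = 0"
    using Bochner_Integration.integral_diff[OF di(1) dj(1)] di(3) dj(3) by simp
  ultimately have int: "integrable \<mu> (\<lambda>q. f q * \<delta> q)" "(\<integral>q. f q * \<delta> q \<partial>\<mu>) = 0"
    by (simp_all add: \<delta>_def right_diff_distrib)
  have nn: "f q * \<delta> q \<ge> 0" for q using fn[of q] f0[of q] LW(2)[of q] by (cases "q \<in> L") auto
  have ae: "AE q in \<mu>. f q * \<delta> q = 0"
    using integral_nonneg_eq_0_iff_AE[OF int(1)] nn int(2) by simp
  \<comment> \<open>Source of the contradiction: the integrand is positive on the open set
    \<open>B\<close> and zero almost everywhere, so \<open>B\<close> is null. As the density is
    positive, a ball in coordinates would then be null for Lebesgue measure.\<close>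
  define B where "B = chart_inv M i ` ball ?z \<rho>"
  have BU: "ball ?z \<rho> \<subseteq> chart_img M i" using sub ball_subset_cball by blast
  have Beq: "B = chart_dom M i \<inter> chart_map M i -` ball ?z \<rho>"
    unfolding B_def using BU chart_inv_in_dom[OF sm i(1)] chart_map_chart_inv[OF sm i(1)] chart_inv_chart_map[OF sm i(1)]
    by (force simp: image_iff)
  have Bo: "open B" unfolding Beq
    by (rule continuous_open_preimage[OF continuous_on_chart_map[OF sm i(1)] open_chart_dom[OF sm i(1)] open_ball])
  have imB: "chart_map M i ` B = ball ?z \<rho>"
    unfolding B_def using BU chart_map_chart_inv[OF sm i(1)] by (force simp: image_iff)
  have "f q * \<delta> q > 0" if "q \<in> B" for q
  proof -
    have q: "q \<in> chart_dom M i" "dist ?z (chart_map M i q) < \<rho>" using that unfolding Beq by auto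
    then have "(dist (chart_map M i q) ?z)\<^sup>2 < \<rho>\<^sup>2" by (intro power_strict_mono) (auto simp: dist_commute)
    then have "f q > 0" using q by (simp add: f_def chart_bump_def sq_pos_pos)
    moreover have "q \<in> L" using that ball_subset_cball unfolding B_def L_def by blast
    ultimately show ?thesis using LW(2) by simp
  qed
  then have ae2: "AE q in \<mu>. q \<notin> B" using ae by (fastforce elim!: eventually_mono)
  have sp: "space \<mu> = points M" "sets \<mu> = sets (restrict_space borel (points M))"
    using \<mu> by (auto simp: is_riemannian_measure_def)
  have Bs: "B \<in> sets \<mu>"
    using Bo Beq chart_dom_subset_points[OF i(1)] open_points[OF sm] unfolding sp
    by (auto simp: sets_restrict_space_iff)
  have Bsub: "B \<subseteq> points M" using Beq chart_dom_subset_points[OF i(1)] by blast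
  have "{q \<in> space \<mu>. \<not> q \<notin> B} = B" using Bsub sp by auto
  then have "emeasure \<mu> B = 0" using ae2 Bs by (subst (asm) AE_iff_measurable[of B]) auto
  moreover have "emeasure \<mu> B = (\<integral>\<^sup>+ y \<in> ball ?z \<rho>. ennreal (vol_density M i y) \<partial>lborel)"
    using \<mu> i(1) Bo Beq imB by (simp add: is_riemannian_measure_def)
  ultimately have "(\<integral>\<^sup>+ y. ennreal (indicator (ball ?z \<rho>) y *\<^sub>R vol_density M i y) \<partial>lborel) = 0"
    by (simp add: nn_integral_set_ennreal mult.commute)
  moreover have vm: "(\<lambda>y. indicator (ball ?z \<rho>) y *\<^sub>R vol_density M i y) \<in> borel_measurable borel"
    using Ck_on_imp_continuous_on[OF C1_on_vol_density[OF M i(1)]] BU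
    by (intro borel_measurable_continuous_on_indicator) (auto intro: continuous_on_subset)
  ultimately have "AE y in lborel. ennreal (indicator (ball ?z \<rho>) y *\<^sub>R vol_density M i y) = 0"
    by (subst (asm) nn_integral_0_iff_AE) auto
  then have "AE y in lborel. y \<notin> ball ?z \<rho>"
  proof (rule eventually_mono)
    fix y assume "ennreal (indicator (ball ?z \<rho>) y *\<^sub>R vol_density M i y) = 0"
    then show "y \<notin> ball ?z \<rho>"
      using vol_density_pos[OF M i(1)] BU by (fastforce simp: indicator_def)
  qed
  then have "emeasure lborel (ball ?z \<rho>) = 0"
    by (subst (asm) AE_iff_measurable[of "ball ?z \<rho>"]) auto
  then show False using content_ball_pos[OF \<rho>(1), of ?z] by (simp add: measure_def)
qed

text \<open>A statement about charts alone; the measure \<mu> appears because the divergences are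
  compared by integration. Exchanging the two charts turns the inequality into an equality.\<close>

lemma rdiv_chart:
  assumes "riemannian_manifold M" "is_riemannian_measure M \<mu>" "C1_vector_field M X"
    "i \<in> chart_idx M" "p \<in> chart_dom M i"
  shows "rdiv M X p = chart_div M X i p"
proof -
  have p: "p \<in> points M" using assms(4,5) by (auto simp: points_def)
  show ?thesis
    unfolding rdiv_eq_chart_div
    using chart_div_le[OF assms chart_at[OF p]] chart_div_le[OF assms(1-3) chart_at[OF p] assms(4,5)]
    by simp
qed

lemma continuous_on_rdiv:
  assumes "riemannian_manifold M" "is_riemannian_measure M \<mu>" "C1_vector_field M X"
  shows "continuous_on (points M) (rdiv M X)"
proof (rule continuous_on_points[OF riemannian_manifold_smooth[OF assms(1)]])
  fix i assume i: "i \<in> chart_idx M"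
  show "continuous_on (chart_img M i) (\<lambda>y. rdiv M X (chart_inv M i y))"
    by (rule continuous_on_eq[OF continuous_on_chart_div[OF assms(1,3) i]])
       (simp add: rdiv_chart[OF assms i chart_inv_in_dom[OF riemannian_manifold_smooth[OF assms(1)] i]])
qed

text \<open>On the support of each piece \<open>g q\<close> of \<open>f\<close>, \<open>rdiv\<close>
  agrees with the divergence in the chart \<open>c q\<close>, so the chart version applies piece by
  piece. The derivatives of the pieces add up because the pieces sum to \<open>f\<close> on the open
  set \<open>points M\<close>.\<close>

theorem divergence_theorem:
  fixes M :: "('i, 'a::{t2_space, second_countable_topology}, 'e::euclidean_space) riem_atlas"
  assumes M: "riemannian_manifold M" and \<mu>: "is_riemannian_measure M \<mu>"
    and X: "C1_vector_field M X" and f: "C1_function M f"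
    and K: "compact K" "K \<subseteq> points M" and f0: "\<And>p. p \<in> points M \<Longrightarrow> p \<notin> K \<Longrightarrow> f p = 0"
  shows "(\<integral>p. f p * rdiv M X p \<partial>\<mu>) = - (\<integral>p. dir_deriv M X f p \<partial>\<mu>)"
proof -
  note sm = riemannian_manifold_smooth[OF M]
  have sp: "space \<mu> = points M" using \<mu> by (auto simp: is_riemannian_measure_def)
  obtain J :: "'a set" and c \<eta> L where J: "finite J"
    and c: "\<And>q. q \<in> J \<Longrightarrow> c q \<in> chart_idx M" and L: "\<And>q. q \<in> J \<Longrightarrow> compact (L q)"
    "\<And>q. q \<in> J \<Longrightarrow> L q \<subseteq> chart_dom M (c q)" and \<eta>: "\<And>q. q \<in> J \<Longrightarrow> C1_function M (\<eta> q)"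
    and "\<And>q p. q \<in> J \<Longrightarrow> 0 \<le> \<eta> q p \<and> \<eta> q p \<le> 1"
    and \<eta>0: "\<And>q p. q \<in> J \<Longrightarrow> p \<notin> L q \<Longrightarrow> \<eta> q p = 0" and \<eta>1: "\<And>p. p \<in> K \<Longrightarrow> (\<Sum>q\<in>J. \<eta> q p) = 1"
    by (rule partition_of_unity[OF sm K]) (rule that, assumption+)
  define g where "g q p = \<eta> q p * f p" for q p
  have g: "C1_function M (g q)" if "q \<in> J" for q
    unfolding g_def by (rule C1_function_mult[OF sm \<eta>[OF that] f])
  have g0: "g q p = 0" if "q \<in> J" "p \<notin> L q" for q p using \<eta>0 that by (simp add: g_def)
  note cd = chart_divergence_theorem[OF M \<mu> c X g L g0]
  have fg: "f p = (\<Sum>q\<in>J. g q p)" if "p \<in> points M" for p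
    using \<eta>1[of p] f0[OF that] by (cases "p \<in> K") (auto simp: g_def sum_distrib_right[symmetric])
  have "(\<integral>p. f p * rdiv M X p \<partial>\<mu>) = (\<integral>p. (\<Sum>q\<in>J. g q p * chart_div M X (c q) p) \<partial>\<mu>)"
  proof (rule Bochner_Integration.integral_cong[OF refl])
    fix p assume "p \<in> space \<mu>"
    then have p: "p \<in> points M" using sp by simp
    have *: "g q p * rdiv M X p = g q p * chart_div M X (c q) p" if "q \<in> J" for q
      using g0[OF that] L(2)[OF that] rdiv_chart[OF M \<mu> X c[OF that]] by (cases "p \<in> L q") auto
    show "f p * rdiv M X p = (\<Sum>q\<in>J. g q p * chart_div M X (c q) p)"
      unfolding fg[OF p] sum_distrib_right by (rule sum.cong[OF refl *])
  qed
  also have "\<dots> = (\<Sum>q\<in>J. \<integral>p. g q p * chart_div M X (c q) p \<partial>\<mu>)"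
    by (rule Bochner_Integration.integral_sum) (rule cd(1))
  also have "\<dots> = - (\<Sum>q\<in>J. \<integral>p. dir_deriv M X (g q) p \<partial>\<mu>)"
    using cd(3) by (simp add: sum_negf)
  also have "(\<Sum>q\<in>J. \<integral>p. dir_deriv M X (g q) p \<partial>\<mu>) = (\<integral>p. (\<Sum>q\<in>J. dir_deriv M X (g q) p) \<partial>\<mu>)"
    by (rule Bochner_Integration.integral_sum[symmetric]) (rule cd(2))
  also have "\<dots> = (\<integral>p. dir_deriv M X f p \<partial>\<mu>)"
  proof (rule Bochner_Integration.integral_cong[OF refl])
    fix p assume "p \<in> space \<mu>"
    then have p: "p \<in> points M" using sp by simp
    note i = chart_at[OF p]
    have "differential M f (chart_at M p) p = differential M (\<lambda>p. \<Sum>q\<in>J. g q p) (chart_at M p) p"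
      by (rule differential_cong[OF sm i(1) open_points[OF sm] p i(2) fg])
    then show "(\<Sum>q\<in>J. dir_deriv M X (g q) p) = dir_deriv M X f p"
      using differential_sum[where J = J and f = g, OF sm g i] by (simp add: dir_deriv_def Let_def)
  qed
  finally show ?thesis .
qed

subsection \<open>The geometry of warped ends\<close>

lemma
  shows chart_idx_warped_end: "chart_idx (warped_end r\<^sub>0 \<sigma> N) = chart_idx N"
    and chart_dom_warped_end: "chart_dom (warped_end r\<^sub>0 \<sigma> N) i = {r\<^sub>0<..} \<times> chart_dom N i"
    and chart_map_warped_end: "chart_map (warped_end r\<^sub>0 \<sigma> N) i = map_prod id (chart_map N i)"
    and chart_img_warped_end: "chart_img (warped_end r\<^sub>0 \<sigma> N) i = {r\<^sub>0<..} \<times> chart_img N i"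
    and rmetric_warped_end: "rmetric (warped_end r\<^sub>0 \<sigma> N) i (r, x) (s, u) (t, w) =
      s * t + (\<sigma> r)\<^sup>2 * rmetric N i x u w"
  by (simp_all add: warped_end_def chart_img_def map_prod_surj_on)

lemma chart_inv_warped_end:
  assumes N: "smooth_manifold N" and i: "i \<in> chart_idx N" and r: "r > r\<^sub>0" and y: "y \<in> chart_img N i"
  shows "chart_inv (warped_end r\<^sub>0 \<sigma> N) i (r, y) = (r, chart_inv N i y)"
proof -
  have "inj_on (map_prod id (chart_map N i)) ({r\<^sub>0<..} \<times> chart_dom N i)"
    using chart_inv_chart_map[OF N i] by (auto simp: inj_on_def) metis
  moreover have "(r, y) = map_prod id (chart_map N i) (r, chart_inv N i y)"
    using chart_map_chart_inv[OF N i y] by simp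
  ultimately show ?thesis
    unfolding chart_inv_def[of "warped_end r\<^sub>0 \<sigma> N"] chart_dom_warped_end chart_map_warped_end
    using r chart_inv_in_dom[OF N i y] by (simp add: inv_into_f_f del: map_prod_simp)
qed

lemma smooth_manifold_warped_end:
  assumes N: "smooth_manifold N"
  shows "smooth_manifold (warped_end r\<^sub>0 \<sigma> N)"
  unfolding smooth_manifold_def chart_idx_warped_end
proof (intro conjI ballI)
  let ?W = "warped_end r\<^sub>0 \<sigma> N"
  fix i assume i: "i \<in> chart_idx N"
  show "open (chart_dom ?W i)" "open (chart_img ?W i)"
    unfolding chart_dom_warped_end chart_img_warped_end
    using open_chart_dom[OF N i] open_chart_img[OF N i] by (auto intro: open_Times)
  have inv: "chart_inv ?W i z = map_prod id (chart_inv N i) z" if "z \<in> {r\<^sub>0<..} \<times> chart_img N i" for z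
    using that chart_inv_warped_end[OF N i] by auto
  show "homeomorphism (chart_dom ?W i) (chart_img ?W i) (chart_map ?W i) (chart_inv ?W i)"
    unfolding homeomorphism_def chart_dom_warped_end chart_img_warped_end chart_map_warped_end
  proof (intro conjI)
    show "continuous_on ({r\<^sub>0<..} \<times> chart_dom N i) (map_prod id (chart_map N i))"
      unfolding map_prod_def case_prod_unfold id_apply
      by (intro continuous_on_Pair continuous_on_fst continuous_on_snd continuous_on_id
          continuous_on_compose2[OF continuous_on_chart_map[OF N i]]) auto
    have "continuous_on ({r\<^sub>0<..} \<times> chart_img N i) (map_prod id (chart_inv N i))"
      unfolding map_prod_def case_prod_unfold id_apply
      by (intro continuous_on_Pair continuous_on_fst continuous_on_snd continuous_on_id
          continuous_on_compose2[OF continuous_on_chart_inv[OF N i]]) auto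
    then show "continuous_on ({r\<^sub>0<..} \<times> chart_img N i) (chart_inv ?W i)"
      by (rule continuous_on_eq) (simp add: inv)
    show "\<forall>p\<in>{r\<^sub>0<..} \<times> chart_dom N i. chart_inv ?W i (map_prod id (chart_map N i) p) = p"
      using inv chart_map_in_img[OF N i] chart_inv_chart_map[OF N i] by auto
    show "\<forall>z\<in>{r\<^sub>0<..} \<times> chart_img N i. map_prod id (chart_map N i) (chart_inv ?W i z) = z"
      using inv chart_map_chart_inv[OF N i] by auto
    show "map_prod id (chart_map N i) ` ({r\<^sub>0<..} \<times> chart_dom N i) = {r\<^sub>0<..} \<times> chart_img N i"
      by (simp add: chart_img_def map_prod_surj_on)
    have "chart_inv ?W i ` ({r\<^sub>0<..} \<times> chart_img N i) = map_prod id (chart_inv N i) ` ({r\<^sub>0<..} \<times> chart_img N i)"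
      using inv by (intro image_cong) auto
    also have "\<dots> = {r\<^sub>0<..} \<times> (chart_inv N i ` chart_img N i)"
      by (simp add: map_prod_surj_on)
    also have "chart_inv N i ` chart_img N i = chart_dom N i"
      using N i by (simp add: smooth_manifold_def homeomorphism_def)
    finally show "chart_inv ?W i ` ({r\<^sub>0<..} \<times> chart_img N i) = {r\<^sub>0<..} \<times> chart_dom N i" .
  qed
  fix j assume j: "j \<in> chart_idx N"
  let ?T = "{y \<in> chart_img N i. chart_inv N i y \<in> chart_dom N j}"
  have eq: "chart_map ?W i ` (chart_dom ?W i \<inter> chart_dom ?W j) = {r\<^sub>0<..} \<times> ?T"
    unfolding chart_map_image_eq[OF N i, symmetric] chart_map_warped_end chart_dom_warped_end
    by (simp add: Times_Int_Times map_prod_surj_on)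
  have T: "open ?T" by (rule open_chart_preimage[OF N i open_chart_dom[OF N j]])
  then have oT: "open ({r\<^sub>0<..} \<times> ?T)" by (intro open_Times) auto
  show "smooth_on (chart_map ?W i ` (chart_dom ?W i \<inter> chart_dom ?W j)) (transition ?W i j)"
    unfolding eq smooth_on_def
  proof
    fix k
    have "Ck_on k ({r\<^sub>0<..} \<times> ?T) (\<lambda>z. (fst z, transition N i j (snd z)))"
      by (intro Ck_on_Pair[OF oT] Ck_on_linear[OF oT] bounded_linear_fst
          Ck_on_compose_linear[OF T bounded_linear_snd smooth_on_Ck[OF smooth_on_transition[OF N i j]] _ oT]) auto
    then show "Ck_on k ({r\<^sub>0<..} \<times> ?T) (transition ?W i j)"
      by (rule Ck_on_cong[OF oT, rotated])
         (auto simp: transition_def chart_map_warped_end chart_inv_warped_end[OF N i])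
  qed
qed

lemma riemannian_manifold_warped_end:
  fixes N :: "('i, 'a::{t2_space, second_countable_topology}, 'e::euclidean_space) riem_atlas"
  assumes N: "riemannian_manifold N" and \<sigma>: "smooth_on {r\<^sub>0<..} \<sigma>" "\<And>r. r > r\<^sub>0 \<Longrightarrow> \<sigma> r > 0"
  shows "riemannian_manifold (warped_end r\<^sub>0 \<sigma> N)"
proof -
  let ?W = "warped_end r\<^sub>0 \<sigma> N"
  note sm = riemannian_manifold_smooth[OF N]
  note smW = smooth_manifold_warped_end[OF sm, of r\<^sub>0 \<sigma>]
  have pd: "bilinear (rmetric ?W i p) \<and> (\<forall>u w. rmetric ?W i p u w = rmetric ?W i p w u) \<and>
      (\<forall>u. u \<noteq> 0 \<longrightarrow> rmetric ?W i p u u > 0)" if i: "i \<in> chart_idx N" and p: "p \<in> chart_dom ?W i" for i p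
  proof -
    obtain r x where p_eq: "p = (r, x)" and r: "r > r\<^sub>0" and x: "x \<in> chart_dom N i"
      using p by (auto simp: chart_dom_warped_end)
    have B: "pos_def_form (rmetric N i x)" by (rule rmetric_pos_def_form[OF N i x])
    then have lin: "\<And>u. linear (rmetric N i x u)" "\<And>w. linear (\<lambda>u. rmetric N i x u w)"
      by (auto simp: pos_def_form_def bilinear_def)
    have "bilinear (rmetric ?W i p)"
      unfolding bilinear_def p_eq
    proof (intro conjI allI linearI)
      fix a b c :: "real \<times> 'e" and k :: real
      show "rmetric ?W i (r, x) a (b + c) = rmetric ?W i (r, x) a b + rmetric ?W i (r, x) a c"
        by (cases a; cases b; cases c) (simp add: rmetric_warped_end linear_add[OF lin(1)] algebra_simps)
      show "rmetric ?W i (r, x) (b + c) a = rmetric ?W i (r, x) b a + rmetric ?W i (r, x) c a"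
        by (cases a; cases b; cases c) (simp add: rmetric_warped_end linear_add[OF lin(2)] algebra_simps)
      show "rmetric ?W i (r, x) a (k *\<^sub>R b) = k *\<^sub>R rmetric ?W i (r, x) a b"
        by (cases a; cases b) (simp add: rmetric_warped_end linear_cmul[OF lin(1)] algebra_simps)
      show "rmetric ?W i (r, x) (k *\<^sub>R b) a = k *\<^sub>R rmetric ?W i (r, x) b a"
        by (cases a; cases b) (simp add: rmetric_warped_end linear_cmul[OF lin(2)] algebra_simps)
    qed
    moreover have "rmetric ?W i p u w = rmetric ?W i p w u" for u w
      using B unfolding p_eq
      by (cases u; cases w) (simp add: rmetric_warped_end pos_def_form_def mult.commute)
    moreover have "rmetric ?W i p u u > 0" if "u \<noteq> 0" for u
    proof -
      obtain s w where u: "u = (s, w)" by (cases u)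
      have "rmetric N i x w w \<ge> 0"
        using B linear_0[OF lin(1)] by (cases "w = 0") (auto simp: pos_def_form_def less_imp_le)
      moreover have "s \<noteq> 0 \<or> rmetric N i x w w > 0"
        using B that u by (auto simp: pos_def_form_def zero_prod_def)
      moreover have "s * s > 0" if "s \<noteq> 0" using that by (auto simp: zero_less_mult_iff linorder_neq_iff)
      ultimately show ?thesis
        using \<sigma>(2)[OF r] unfolding u p_eq rmetric_warped_end
        by (auto intro: add_pos_nonneg add_nonneg_pos)
    qed
    ultimately show ?thesis by blast
  qed
  have sm_metric: "smooth_on (chart_img ?W i) (\<lambda>z. rmetric ?W i (chart_inv ?W i z) u w)"
    if i: "i \<in> chart_idx N" for i u w
    unfolding smooth_on_def
  proof
    fix k
    obtain s u' t w' where uw: "u = (s, u')" "w = (t, w')" by (cases u; cases w)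
    have o: "open (chart_img ?W i)" using smW i by (simp add: open_chart_img chart_idx_warped_end)
    have g: "Ck_on k (chart_img N i) (\<lambda>y. rmetric N i (chart_inv N i y) u' w')"
      using N i by (auto simp: riemannian_manifold_def intro: smooth_on_Ck)
    have "Ck_on k (chart_img ?W i)
        (\<lambda>z. s * t + (\<sigma> (fst z))\<^sup>2 * rmetric N i (chart_inv N i (snd z)) u' w')"
      by (intro Ck_on_add Ck_on_const Ck_on_mult Ck_on_power o
          Ck_on_compose_linear[OF open_chart_img[OF sm i] bounded_linear_snd g _ o]
          Ck_on_compose_linear[OF open_greaterThan bounded_linear_fst smooth_on_Ck[OF \<sigma>(1)] _ o])
         (auto simp: chart_img_warped_end)
    then show "Ck_on k (chart_img ?W i) (\<lambda>z. rmetric ?W i (chart_inv ?W i z) u w)"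
      by (rule Ck_on_cong[OF o, rotated])
         (auto simp: chart_img_warped_end chart_inv_warped_end[OF sm i] uw rmetric_warped_end)
  qed
  have trans: "rmetric ?W i p u w = rmetric ?W j p (D u) (D w)"
    if i: "i \<in> chart_idx N" and j: "j \<in> chart_idx N" and p: "p \<in> chart_dom ?W i \<inter> chart_dom ?W j"
      and D: "D = frechet_derivative (transition ?W i j) (at (chart_map ?W i p))" for i j p u w D
  proof -
    obtain r x where p_eq: "p = (r, x)" and r: "r > r\<^sub>0" and x: "x \<in> chart_dom N i" "x \<in> chart_dom N j"
      using p by (auto simp: chart_dom_warped_end)
    let ?T = "{y \<in> chart_img N i. chart_inv N i y \<in> chart_dom N j}"
    have oT: "open ({r\<^sub>0<..} \<times> ?T)"
      by (intro open_Times open_chart_preimage[OF sm i open_chart_dom[OF sm j]]) auto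
    have d: "(transition N i j has_derivative transition_deriv N i j x) (at (snd (r, chart_map N i x)))"
      using transition_has_derivative[OF sm i j x] by simp
    have "((\<lambda>z. transition N i j (snd z)) has_derivative (\<lambda>z. transition_deriv N i j x (snd z))) (at (r, chart_map N i x))"
      by (rule has_derivative_compose[where f = snd and g = "transition N i j", OF _ d])
         (rule has_derivative_snd[OF has_derivative_ident])
    then have "((\<lambda>z. (fst z, transition N i j (snd z))) has_derivative
        (\<lambda>z. (fst z, transition_deriv N i j x (snd z)))) (at (r, chart_map N i x))"
      by (intro has_derivative_Pair has_derivative_fst has_derivative_ident)
    then have "(transition ?W i j has_derivative
        (\<lambda>z. (fst z, transition_deriv N i j x (snd z)))) (at (r, chart_map N i x))"
      by (rule has_derivative_transform_within_open[OF _ oT])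
         (use r x chart_map_in_img[OF sm i] chart_inv_chart_map[OF sm i] in
           \<open>auto simp: transition_def chart_map_warped_end chart_inv_warped_end[OF sm i]\<close>)
    then have "D = (\<lambda>z. (fst z, transition_deriv N i j x (snd z)))"
      unfolding D p_eq chart_map_warped_end by (simp add: frechet_derivative_eqI)
    then show ?thesis
      unfolding p_eq using rmetric_transition[OF N i x(1) j x(2)]
      by (cases u; cases w) (simp add: rmetric_warped_end)
  qed
  show ?thesis
    unfolding riemannian_manifold_def chart_idx_warped_end Let_def
    using smW pd sm_metric trans by blast
qed

text \<open>The Gram matrix is block diagonal, with entry 1 for the radial direction and
  \<open>(\<sigma> r)\<^sup>2\<close> times the Gram matrix of \<open>N\<close> for the
  rest.\<close>

lemma metric_det_warped_end:
  fixes N :: "('i, 'a, 'e::euclidean_space) riem_atlas"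
  assumes "pos_def_form (rmetric N i x)"
  shows "metric_det (warped_end r\<^sub>0 \<sigma> N) i (r, x) = (\<sigma> r)\<^sup>2 ^ DIM('e) * metric_det N i x"
proof -
  let ?W = "warped_end r\<^sub>0 \<sigma> N"
  have lin: "linear (rmetric N i x u)" "linear (\<lambda>u. rmetric N i x u w)" for u w
    using assms by (auto simp: pos_def_form_def bilinear_def)
  have B: "(Basis :: (real \<times> 'e) set) = insert (1, 0) (Pair 0 ` Basis)"
    by (auto simp: Basis_prod_def)
  have "metric_det ?W i (r, x) = rmetric ?W i (r, x) (1, 0) (1, 0) * gram_det (Pair 0 ` Basis) (rmetric ?W i (r, x))"
    unfolding metric_det_eq_gram_det B
    by (rule gram_det_insert) (auto simp: rmetric_warped_end linear_0[OF lin(2)])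
  also have "rmetric ?W i (r, x) (1, 0) (1, 0) = 1"
    by (simp add: rmetric_warped_end linear_0[OF lin(2)])
  also have "gram_det (Pair 0 ` Basis) (rmetric ?W i (r, x)) = gram_det Basis (\<lambda>a b. (\<sigma> r)\<^sup>2 * rmetric N i x a b)"
    by (subst gram_det_reindex[of "Pair 0" Basis])
       (auto simp: bij_betw_def inj_on_def rmetric_warped_end)
  finally show ?thesis by (simp add: gram_det_scale metric_det_eq_gram_det)
qed

lemma vol_density_warped_end:
  fixes N :: "('i, 'a::{t2_space, second_countable_topology}, 'e::euclidean_space) riem_atlas"
  assumes N: "riemannian_manifold N" and "\<sigma> r > 0" and i: "i \<in> chart_idx N" and r: "r > r\<^sub>0"
    and y: "y \<in> chart_img N i"
  shows "vol_density (warped_end r\<^sub>0 \<sigma> N) i (r, y) = \<sigma> r ^ DIM('e) * vol_density N i y"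
proof -
  note sm = riemannian_manifold_smooth[OF N]
  have "sqrt ((\<sigma> r)\<^sup>2 ^ DIM('e)) = \<sigma> r ^ DIM('e)"
    using assms(2) by (metis power_mult mult.commute real_sqrt_abs abs_of_pos zero_less_power)
  then show ?thesis
    using metric_det_warped_end[OF rmetric_pos_def_form[OF N i chart_inv_in_dom[OF sm i y]]]
    by (simp add: vol_density_def chart_inv_warped_end[OF sm i r y] real_sqrt_mult)
qed

section \<open>The one-dimensional inequality on a ray\<close>

text \<open>With \<open>u = e\<^sup>\<phi> v\<close>, \<open>\<phi>' = F\<close> and \<open>W = \<sigma>\<^sup>m e\<^sup>h\<close>, the integrand minus the derivative of
  \<open>\<Phi>\<close> is a sum of squares with nonnegative coefficients. Since \<open>A\<close> and \<open>k\<^sub>2\<close> are merely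
  differentiable, \<open>\<Phi>'\<close> need not be Lebesgue integrable, but it is Henstock-Kurzweil integrable.\<close>

lemma carleman_radial:
  fixes \<sigma> \<sigma>1 h h1 G1 F F1 A A1 k\<^sub>1 k\<^sub>2 k21 a a1 a2 q q1 E :: "real \<Rightarrow> real"
  assumes "\<alpha> \<le> \<beta>"
    and \<sigma>: "\<And>r. r \<in> {\<alpha>..\<beta>} \<Longrightarrow> \<sigma> r > 0" "\<And>r. r \<in> {\<alpha>..\<beta>} \<Longrightarrow> (\<sigma> has_real_derivative \<sigma>1 r) (at r)"
    and h: "\<And>r. r \<in> {\<alpha>..\<beta>} \<Longrightarrow> (h has_real_derivative h1 r) (at r)"
    and F1: "\<And>r. r \<in> {\<alpha>..\<beta>} \<Longrightarrow> (F has_real_derivative F1 r) (at r)"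
    and A1: "\<And>r. r \<in> {\<alpha>..\<beta>} \<Longrightarrow> (A has_real_derivative A1 r) (at r)"
    and k21: "\<And>r. r \<in> {\<alpha>..\<beta>} \<Longrightarrow> (k\<^sub>2 has_real_derivative k21 r) (at r)"
    and F: "\<And>r. r \<in> {\<alpha>..\<beta>} \<Longrightarrow> F r = 1/2 * (h1 r + real m * \<sigma>1 r / \<sigma> r - G1 r)"
    and A: "\<And>r. r \<in> {\<alpha>..\<beta>} \<Longrightarrow> A r = F r ^ 3 - F r * (F1 r + real m * F r * \<sigma>1 r / \<sigma> r)"
    and k2: "\<And>r. r \<in> {\<alpha>..\<beta>} \<Longrightarrow> k\<^sub>2 r \<le> 2 * (2 * (F r)\<^sup>2 - 2 * real m * (F r * \<sigma>1 r / \<sigma> r) + F1 r + F r * G1 r)"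
      "\<And>r. r \<in> {\<alpha>..\<beta>} \<Longrightarrow> k\<^sub>2 r \<le> 2 * (- F1 r - F r * G1 r + 2 * (F r * \<sigma>1 r / \<sigma> r))"
    and k1: "\<And>r. r \<in> {\<alpha>..\<beta>} \<Longrightarrow> k\<^sub>1 r \<le> 2 * (A1 r + A r * G1 r) - k\<^sub>2 r * (F r)\<^sup>2
        - G1 r * k\<^sub>2 r * F r - k21 r * F r - k\<^sub>2 r * F1 r"
    and a: "\<And>r. r \<in> {\<alpha>..\<beta>} \<Longrightarrow> (a has_real_derivative a1 r) (at r)"
      "\<And>r. r \<in> {\<alpha>..\<beta>} \<Longrightarrow> (a1 has_real_derivative a2 r) (at r)"
    and q: "\<And>r. r \<in> {\<alpha>..\<beta>} \<Longrightarrow> (q has_real_derivative q1 r) (at r)" "\<And>r. r \<in> {\<alpha>..\<beta>} \<Longrightarrow> q r \<ge> 0"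
    and bd: "\<And>r. r \<in> {\<alpha>, \<beta>} \<Longrightarrow> a r = 0 \<and> a1 r = 0 \<and> q r = 0"
    and E: "\<And>r. r \<in> {\<alpha>..\<beta>} \<Longrightarrow> E r = \<sigma> r ^ m * exp (h r) *
      (4 * a1 r * (F1 r * (a1 r + F r * a r) + F r * (a2 r + F1 r * a r + F r * a1 r) + F r * (a1 r + F r * a r) * h1 r)
       + 4 * F r * (q1 r / 2 + F r * q r) / (\<sigma> r)\<^sup>2 - 4 * (F r)\<^sup>2 * (a1 r + F r * a r)\<^sup>2
       - (a r)\<^sup>2 * k\<^sub>1 r - ((a1 r)\<^sup>2 + q r / (\<sigma> r)\<^sup>2) * k\<^sub>2 r)"
  shows "0 \<le> (LINT r : {\<alpha>..\<beta>} | lborel. E r)"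
proof (cases "set_integrable lborel {\<alpha>..\<beta>} E")
  \<comment> \<open>A non-integrable function has integral 0 by convention. This spares a proof of
    integrability on each single ray, which Fubini would give for almost every ray only.\<close>
  case False
  then show ?thesis
    by (simp add: set_integrable_def set_lebesgue_integral_def not_integrable_integral_eq)
next
  case True
  define W where "W r = \<sigma> r ^ m * exp (h r)" for r
  \<comment> \<open>What integration by parts leaves as exact. The first two terms amount to
    \<open>2 F (a1\<^sup>2 - F\<^sup>2 a\<^sup>2)\<close>. The term with \<open>A\<close> leaves
    \<open>2 (A' + A G') a\<^sup>2\<close> in the remainder, the one with \<open>q\<close> leaves
    the second bound on \<open>k\<^sub>2\<close>. With \<open>b = a1 + F a\<close>, the last one
    comes from \<open>a1\<^sup>2 = b\<^sup>2 - F (a\<^sup>2)' - F\<^sup>2 a\<^sup>2\<close> and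
    leaves the terms with \<open>k\<^sub>2\<close> in the bound on \<open>k\<^sub>1\<close>.\<close>
  define P where "P r = 4 * F r * a1 r * (a1 r + F r * a r) - 2 * F r * (a1 r + F r * a r)\<^sup>2
      - 2 * A r * (a r)\<^sup>2 + 2 * F r * q r / (\<sigma> r)\<^sup>2 + k\<^sub>2 r * F r * (a r)\<^sup>2" for r
  define P1 where "P1 r = 4 * F1 r * a1 r * (a1 r + F r * a r) + 4 * F r * a2 r * (a1 r + F r * a r)
      + 4 * F r * a1 r * (a2 r + F1 r * a r + F r * a1 r)
      - 2 * F1 r * (a1 r + F r * a r)\<^sup>2 - 4 * F r * (a1 r + F r * a r) * (a2 r + F1 r * a r + F r * a1 r)
      - 2 * A1 r * (a r)\<^sup>2 - 4 * A r * a r * a1 r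
      + 2 * F1 r * q r / (\<sigma> r)\<^sup>2 + 2 * F r * q1 r / (\<sigma> r)\<^sup>2 - 4 * F r * q r * \<sigma>1 r / (\<sigma> r) ^ 3
      + k21 r * F r * (a r)\<^sup>2 + k\<^sub>2 r * F1 r * (a r)\<^sup>2 + 2 * k\<^sub>2 r * F r * a r * a1 r" for r
  \<comment> \<open>The definition of \<open>F\<close>, read as a formula for the logarithmic
    derivative of the weight.\<close>
  have dW: "(W has_real_derivative (2 * F r + G1 r) * W r) (at r)" if r: "r \<in> {\<alpha>..\<beta>}" for r
  proof -
    have "(W has_real_derivative (real m * \<sigma> r ^ (m - 1) * \<sigma>1 r) * exp (h r) + \<sigma> r ^ m * (exp (h r) * h1 r)) (at r)"
      unfolding W_def using \<sigma>(2)[OF r] h[OF r]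
      by (auto intro!: derivative_eq_intros simp: algebra_simps)
    moreover have e: "real m * \<sigma> r ^ (m - 1) = real m * \<sigma> r ^ m / \<sigma> r"
      using \<sigma>(1)[OF r] by (cases m) auto
    moreover have h1: "h1 r = 2 * F r + G1 r - real m * \<sigma>1 r / \<sigma> r" using F[OF r] by simp
    have "(real m * \<sigma> r ^ (m - 1) * \<sigma>1 r) * exp (h r) + \<sigma> r ^ m * (exp (h r) * h1 r) = (2 * F r + G1 r) * W r"
      unfolding e h1 by (simp add: W_def field_simps)
    ultimately show ?thesis by simp
  qed
  have dP: "(P has_real_derivative P1 r) (at r)" if r: "r \<in> {\<alpha>..\<beta>}" for r
    unfolding P_def P1_def using \<sigma>[OF r] F1[OF r] A1[OF r] k21[OF r] a(1)[OF r] a(2)[OF r] q(1)[OF r]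
    by (auto intro!: derivative_eq_intros simp: field_simps power2_eq_square power3_eq_cube)
  define \<Phi> where "\<Phi> r = P r * W r" for r
  have d\<Phi>: "(\<Phi> has_real_derivative (P1 r + (2 * F r + G1 r) * P r) * W r) (at r)" if r: "r \<in> {\<alpha>..\<beta>}" for r
    unfolding \<Phi>_def using DERIV_mult[OF dP[OF r] dW[OF r]] by (simp add: algebra_simps)
  have "((\<lambda>r. (P1 r + (2 * F r + G1 r) * P r) * W r) has_integral (\<Phi> \<beta> - \<Phi> \<alpha>)) {\<alpha>..\<beta>}"
    using assms(1) d\<Phi>
    by (intro fundamental_theorem_of_calculus)
       (auto simp: has_real_derivative_iff_has_vector_derivative[symmetric] intro: has_field_derivative_at_within)
  moreover have "\<Phi> \<beta> = 0" "\<Phi> \<alpha> = 0" using bd by (auto simp: \<Phi>_def P_def)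
  ultimately have I0: "((\<lambda>r. (P1 r + (2 * F r + G1 r) * P r) * W r) has_integral 0) {\<alpha>..\<beta>}" by simp
  have IE: "(E has_integral (LINT r : {\<alpha>..\<beta>} | lborel. E r)) {\<alpha>..\<beta>}"
    using set_borel_integral_eq_integral[OF True] by (simp add: has_integral_iff)
  show ?thesis
  proof (rule has_integral_le[OF I0 IE])
    fix r assume r: "r \<in> {\<alpha>..\<beta>}"
    define s where "s = \<sigma>1 r / \<sigma> r"
    define p where "p = 1 / (\<sigma> r)\<^sup>2"
    define b where "b = a1 r + F r * a r"
    define R where "R = 2 * (A1 r + A r * G1 r) - k\<^sub>2 r * (F r)\<^sup>2
        - G1 r * k\<^sub>2 r * F r - k21 r * F r - k\<^sub>2 r * F1 r"
    have h1: "h1 r = 2 * F r + G1 r - real m * s" using F[OF r] by (simp add: s_def)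
    have Ar: "A r = F r ^ 3 - F r * (F1 r + real m * F r * s)" using A[OF r] by (simp add: s_def)
    have s3: "4 * F r * q r * \<sigma>1 r / \<sigma> r ^ 3 = 4 * F r * q r * s * p" using \<sigma>(1)[OF r] by (simp add: s_def p_def power2_eq_square power3_eq_cube)
    have PP: "P1 r = 4 * F1 r * a1 r * b + 4 * F r * a2 r * b + 4 * F r * a1 r * (a2 r + F1 r * a r + F r * a1 r)
      - 2 * F1 r * b\<^sup>2 - 4 * F r * b * (a2 r + F1 r * a r + F r * a1 r)
      - 2 * A1 r * (a r)\<^sup>2 - 4 * A r * a r * a1 r
      + 2 * F1 r * q r * p + 2 * F r * q1 r * p - 4 * F r * q r * s * p
      + k21 r * F r * (a r)\<^sup>2 + k\<^sub>2 r * F1 r * (a r)\<^sup>2 + 2 * k\<^sub>2 r * F r * a r * a1 r"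
      unfolding P1_def s3 by (simp add: b_def p_def)
    have PPP: "P r = 4 * F r * a1 r * b - 2 * F r * b\<^sup>2 - 2 * A r * (a r)\<^sup>2 + 2 * F r * q r * p + k\<^sub>2 r * F r * (a r)\<^sup>2"
      by (simp add: P_def b_def p_def)
    have EE: "E r = W r * (4 * a1 r * (F1 r * b + F r * (a2 r + F1 r * a r + F r * a1 r) + F r * b * h1 r)
       + 4 * F r * (q1 r / 2 + F r * q r) * p - 4 * (F r)\<^sup>2 * b\<^sup>2
       - (a r)\<^sup>2 * k\<^sub>1 r - ((a1 r)\<^sup>2 + q r * p) * k\<^sub>2 r)"
      unfolding E[OF r] by (simp add: W_def b_def p_def)
    \<comment> \<open>The three coefficients are the slacks in the two bounds on
      \<open>k\<^sub>2\<close> and in the bound on \<open>k\<^sub>1\<close>. The mixed term in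
      \<open>a r * b\<close> cancels precisely because of the formula for \<open>A\<close>.\<close>
    have "E r - (P1 r + (2 * F r + G1 r) * P r) * W r = W r *
        (b\<^sup>2 * (2 * (2 * (F r)\<^sup>2 - 2 * real m * (F r * s) + F1 r + F r * G1 r) - k\<^sub>2 r)
         + p * q r * (2 * (- F1 r - F r * G1 r + 2 * (F r * s)) - k\<^sub>2 r) + (a r)\<^sup>2 * (R - k\<^sub>1 r))"
      unfolding EE PP PPP R_def Ar h1 b_def by algebra
    also have "\<dots> \<ge> 0"
    proof (intro mult_nonneg_nonneg add_nonneg_nonneg)
      show "0 \<le> W r" using \<sigma>(1)[OF r] by (simp add: W_def)
      show "0 \<le> 2 * (2 * (F r)\<^sup>2 - 2 * real m * (F r * s) + F1 r + F r * G1 r) - k\<^sub>2 r"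
        using k2(1)[OF r] by (simp add: s_def)
      show "0 \<le> 2 * (- F1 r - F r * G1 r + 2 * (F r * s)) - k\<^sub>2 r" using k2(2)[OF r] by (simp add: s_def)
      show "0 \<le> R - k\<^sub>1 r" using k1[OF r] by (simp add: R_def)
    qed (use q(2)[OF r] in \<open>auto simp: p_def\<close>)
    finally show "(P1 r + (2 * F r + G1 r) * P r) * W r \<le> E r" by simp
  qed
qed

subsection \<open>Radial derivatives and gradients on a warped end\<close>

text \<open>Differentiating along the ray through a point needs no chart of \<open>N\<close>, so the
  result is a function on the end without any choice, and the operation can be iterated.\<close>

definition radial_deriv :: "(real \<times> 'a \<Rightarrow> real) \<Rightarrow> real \<times> 'a \<Rightarrow> real" where
  "radial_deriv f p = deriv (\<lambda>r. f (r, snd p)) (fst p)"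

lemma open_chart_img_warped_end:
  fixes r\<^sub>0 :: real
  shows "smooth_manifold N \<Longrightarrow> i \<in> chart_idx N \<Longrightarrow> open ({r\<^sub>0<..} \<times> chart_img N i)"
  by (intro open_Times open_chart_img open_greaterThan)

text \<open>The charts of the end are the identity in \<open>r\<close>, so the coordinate direction
  \<open>(1, 0)\<close> is the radial one in all of them.\<close>

lemma radial_deriv_chart:
  assumes N: "smooth_manifold N" and i: "i \<in> chart_idx N"
    and f: "C1_on ({r\<^sub>0<..} \<times> chart_img N i) (\<lambda>z. f (chart_inv (warped_end r\<^sub>0 \<sigma> N) i z))"
    and r: "r > r\<^sub>0" and y: "y \<in> chart_img N i"
  defines "D \<equiv> frechet_derivative (\<lambda>z. f (chart_inv (warped_end r\<^sub>0 \<sigma> N) i z)) (at (r, y)) (1, 0)"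
  shows "((\<lambda>s. f (s, chart_inv N i y)) has_real_derivative D) (at r)"
    and "radial_deriv f (r, chart_inv N i y) = D"
proof -
  let ?\<phi> = "\<lambda>z. f (chart_inv (warped_end r\<^sub>0 \<sigma> N) i z)"
  have "((\<lambda>t. ?\<phi> ((0, y) + t *\<^sub>R (1, 0))) has_real_derivative
      frechet_derivative ?\<phi> (at ((0, y) + r *\<^sub>R (1, 0))) (1, 0)) (at r)"
    by (rule C1_on_translate_field_derivative[OF f]) (use r y in simp)
  then have "((\<lambda>t. ?\<phi> (t, y)) has_real_derivative D) (at r)" by (simp add: D_def)
  then show d: "((\<lambda>s. f (s, chart_inv N i y)) has_real_derivative D) (at r)"
    by (rule has_field_derivative_transform_within_open[of _ _ _ "{r\<^sub>0<..}"])
       (use r chart_inv_warped_end[OF N i _ y] in auto)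
  then show "radial_deriv f (r, chart_inv N i y) = D"
    by (simp add: radial_deriv_def DERIV_imp_deriv)
qed

lemma Ck_on_radial_deriv:
  assumes N: "smooth_manifold N" and i: "i \<in> chart_idx N"
    and f: "Ck_on (Suc k) ({r\<^sub>0<..} \<times> chart_img N i) (\<lambda>z. f (chart_inv (warped_end r\<^sub>0 \<sigma> N) i z))"
  shows "Ck_on k ({r\<^sub>0<..} \<times> chart_img N i) (\<lambda>z. radial_deriv f (chart_inv (warped_end r\<^sub>0 \<sigma> N) i z))"
proof (rule Ck_on_cong[OF open_chart_img_warped_end[OF N i] _ Ck_on_frechet[OF f, of "(1, 0)"]])
  have f1: "C1_on ({r\<^sub>0<..} \<times> chart_img N i) (\<lambda>z. f (chart_inv (warped_end r\<^sub>0 \<sigma> N) i z))"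
    by (rule Ck_on_le[OF f]) simp
  fix z assume "z \<in> {r\<^sub>0<..} \<times> chart_img N i"
  then show "frechet_derivative (\<lambda>z. f (chart_inv (warped_end r\<^sub>0 \<sigma> N) i z)) (at z) (1, 0)
      = radial_deriv f (chart_inv (warped_end r\<^sub>0 \<sigma> N) i z)"
    using radial_deriv_chart(2)[OF N i f1] chart_inv_warped_end[OF N i] by auto
qed

lemma C1_function_radial:
  assumes N: "smooth_manifold N" and g: "C1_on {r\<^sub>0<..} g"
  shows "C1_function (warped_end r\<^sub>0 \<sigma> N) (\<lambda>p. g (fst p))"
  unfolding C1_function_def chart_idx_warped_end chart_img_warped_end
proof
  fix i assume i: "i \<in> chart_idx N"
  note o = open_chart_img_warped_end[OF N i, of r\<^sub>0]
  have "C1_on ({r\<^sub>0<..} \<times> chart_img N i) (\<lambda>z. g (fst z))"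
    by (rule Ck_on_compose_linear[OF open_greaterThan bounded_linear_fst g _ o]) auto
  then show "C1_on ({r\<^sub>0<..} \<times> chart_img N i) (\<lambda>z. g (fst (chart_inv (warped_end r\<^sub>0 \<sigma> N) i z)))"
    by (rule Ck_on_cong[OF o, rotated]) (auto simp: chart_inv_warped_end[OF N i])
qed

lemma C1_function_radial_deriv:
  assumes N: "smooth_manifold N"
    and v: "\<And>i. i \<in> chart_idx (warped_end r\<^sub>0 \<sigma> N) \<Longrightarrow>
      Ck_on 2 (chart_img (warped_end r\<^sub>0 \<sigma> N) i) (\<lambda>z. v (chart_inv (warped_end r\<^sub>0 \<sigma> N) i z))"
  shows "C1_function (warped_end r\<^sub>0 \<sigma> N) (radial_deriv v)"
  unfolding C1_function_def
proof
  fix j assume j: "j \<in> chart_idx (warped_end r\<^sub>0 \<sigma> N)"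
  then have jN: "j \<in> chart_idx N" by (simp add: chart_idx_warped_end)
  show "C1_on (chart_img (warped_end r\<^sub>0 \<sigma> N) j) (\<lambda>z. radial_deriv v (chart_inv (warped_end r\<^sub>0 \<sigma> N) j z))"
    using Ck_on_radial_deriv[OF N jN, of "Suc 0" r\<^sub>0 v \<sigma>] v[OF j]
    by (simp add: chart_img_warped_end numeral_2_eq_2 del: Ck_on.simps)
qed

lemma linear_Pair_split:
  assumes "linear f"
  shows "f (t, c *\<^sub>R w) = t *\<^sub>R f (1, 0) + c *\<^sub>R f (0, w)"
proof -
  have "(t, c *\<^sub>R w) = t *\<^sub>R (1, 0) + c *\<^sub>R (0, w)" by simp
  then show ?thesis using linear_add[OF assms] linear_cmul[OF assms] by metis
qed

text \<open>\<open>q\<close> is the squared length, with respect to the metric of \<open>N\<close>, of the gradient along \<open>N\<close>.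
  The symmetry of the mixed derivatives makes \<open>q1\<close> appear in the last identity.\<close>

lemma warped_gradient_radial:
  fixes N :: "('i, 'a::{t2_space, second_countable_topology}, 'e::euclidean_space) riem_atlas"
    and \<sigma> :: "real \<Rightarrow> real" and r\<^sub>0 :: real
  defines "W \<equiv> warped_end r\<^sub>0 \<sigma> N"
  assumes N: "riemannian_manifold N" and \<sigma>: "smooth_on {r\<^sub>0<..} \<sigma>" "\<And>r. r > r\<^sub>0 \<Longrightarrow> \<sigma> r > 0"
    and v: "\<And>i. i \<in> chart_idx W \<Longrightarrow> Ck_on 2 (chart_img W i) (\<lambda>z. v (chart_inv W i z))"
    and x: "x \<in> points N"
  obtains q q1 where
    "\<And>r. r > r\<^sub>0 \<Longrightarrow> q r \<ge> 0"
    "\<And>r. r > r\<^sub>0 \<Longrightarrow> (q has_real_derivative q1 r) (at r)"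
    "\<And>r. r > r\<^sub>0 \<Longrightarrow> dir_deriv W (rgrad W v) v (r, x) = (radial_deriv v (r, x))\<^sup>2 + q r / (\<sigma> r)\<^sup>2"
    "\<And>r \<alpha> \<beta> \<alpha>' \<beta>'. r > r\<^sub>0 \<Longrightarrow> C1_on {r\<^sub>0<..} \<alpha> \<Longrightarrow> C1_on {r\<^sub>0<..} \<beta> \<Longrightarrow>
      (\<alpha> has_real_derivative \<alpha>') (at r) \<Longrightarrow> (\<beta> has_real_derivative \<beta>') (at r) \<Longrightarrow>
      dir_deriv W (rgrad W v) (\<lambda>p. \<alpha> (fst p) * radial_deriv v p + \<beta> (fst p) * v p) (r, x)
      = radial_deriv v (r, x) * (\<alpha>' * radial_deriv v (r, x) + \<alpha> r * radial_deriv (radial_deriv v) (r, x)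
          + \<beta>' * v (r, x) + \<beta> r * radial_deriv v (r, x))
        + (\<alpha> r * q1 r / 2 + \<beta> r * q r) / (\<sigma> r)\<^sup>2"
proof -
  note sm = riemannian_manifold_smooth[OF N]
  have W: "riemannian_manifold W" unfolding W_def by (rule riemannian_manifold_warped_end[OF N \<sigma>])
  note smW = riemannian_manifold_smooth[OF W]
  obtain i where i: "i \<in> chart_idx N" and xi: "x \<in> chart_dom N i" using x by (auto simp: points_def)
  have iW: "i \<in> chart_idx W" using i by (simp add: W_def chart_idx_warped_end)
  define y where "y = chart_map N i x"
  have y: "y \<in> chart_img N i" "chart_inv N i y = x"
    using chart_map_in_img[OF sm i xi] chart_inv_chart_map[OF sm i xi] by (auto simp: y_def)
  define U where "U = {r\<^sub>0<..} \<times> chart_img N i"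
  have U: "chart_img W i = U" "open U" "\<And>r. r > r\<^sub>0 \<Longrightarrow> (r, y) \<in> U"
    using open_chart_img_warped_end[OF sm i] y by (auto simp: U_def W_def chart_img_warped_end)
  have inv: "chart_inv W i (r, y) = (r, x)" if "r > r\<^sub>0" for r
    using chart_inv_warped_end[OF sm i that y(1)] y(2) by (simp add: W_def)
  define \<phi> where "\<phi> z = v (chart_inv W i z)" for z
  have \<phi>2: "Ck_on (Suc (Suc 0)) U \<phi>"
    using v[OF iW] unfolding U(1) by (simp add: \<phi>_def[abs_def] numeral_2_eq_2 del: Ck_on.simps)
  then have \<phi>1: "C1_on U \<phi>" by (rule Ck_on_SucD)
  define D where "D z = frechet_derivative \<phi> (at z)" for z
  have D1: "C1_on U (\<lambda>z. D z w)" for w unfolding D_def by (rule Ck_on_frechet[OF \<phi>2])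
  have linD: "linear (D z)" if "z \<in> U" for z
    using Ck_on_has_derivative[OF \<phi>1 _ that] has_derivative_linear unfolding D_def by blast
  define D2 where "D2 z = frechet_derivative (\<lambda>z. D z (1, 0)) (at z)" for z
  have linD2: "linear (D2 z)" if "z \<in> U" for z
    using Ck_on_has_derivative[OF D1 _ that] has_derivative_linear unfolding D2_def by blast
  have sym: "frechet_derivative (\<lambda>z. D z w) (at z) (1, 0) = D2 z w" if "z \<in> U" for z w
    unfolding D2_def D_def
    by (rule frechet_derivative_symmetric[OF U(2) _ that]) (use \<phi>2 in \<open>simp add: numeral_2_eq_2 del: Ck_on.simps\<close>)
  have vr: "radial_deriv v (r, x) = D (r, y) (1, 0)" if "r > r\<^sub>0" for r
    using radial_deriv_chart(2)[OF sm i _ that y(1), of v \<sigma>] \<phi>1 y(2)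
    by (simp add: \<phi>_def[abs_def] U_def W_def D_def del: Ck_on.simps)
  have vr1: "C1_on U (\<lambda>z. radial_deriv v (chart_inv W i z))"
    using Ck_on_radial_deriv[OF sm i, of "Suc 0" r\<^sub>0 v \<sigma>] \<phi>2
    by (simp add: \<phi>_def[abs_def] U_def W_def del: Ck_on.simps)
  have vrD: "radial_deriv v (chart_inv W i z) = D z (1, 0)" if "z \<in> U" for z
    using radial_deriv_chart(2)[OF sm i, of r\<^sub>0 v \<sigma> "fst z" "snd z"] \<phi>1 that chart_inv_warped_end[OF sm i, of r\<^sub>0 "fst z" "snd z" \<sigma>]
    by (auto simp: \<phi>_def[abs_def] U_def W_def D_def simp del: Ck_on.simps)
  have vrr: "radial_deriv (radial_deriv v) (r, x) = D2 (r, y) (1, 0)" if "r > r\<^sub>0" for r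
  proof -
    have "radial_deriv (radial_deriv v) (r, x)
        = frechet_derivative (\<lambda>z. radial_deriv v (chart_inv W i z)) (at (r, y)) (1, 0)"
      using radial_deriv_chart(2)[OF sm i _ that y(1), of "radial_deriv v" \<sigma>] vr1 y(2)
      by (simp add: U_def W_def del: Ck_on.simps)
    also have "frechet_derivative (\<lambda>z. radial_deriv v (chart_inv W i z)) (at (r, y)) = D2 (r, y)"
      unfolding D2_def by (rule frechet_derivative_cong_open[OF U(2) U(3)[OF that] vrD])
    finally show ?thesis .
  qed
  define g where "g = rmetric N i x"
  have g: "pos_def_form g" unfolding g_def by (rule rmetric_pos_def_form[OF N i xi])
  have ling: "linear (g u)" "linear (\<lambda>u. g u w)" for u w
    using g by (auto simp: pos_def_form_def bilinear_def)
  have bbg: "bounded_bilinear g" using g bilinear_conv_bounded_bilinear by (auto simp: pos_def_form_def)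
  \<comment> \<open>The gradient along \<open>N\<close> with respect to the metric of
    \<open>N\<close> at the fixed point \<open>x\<close>. This form does not change with
    \<open>r\<close>; only the represented functional does.\<close>
  define Y where "Y r = (THE u. \<forall>w. g u w = D (r, y) (0, w))" for r
  have Y: "g (Y r) w = D (r, y) (0, w)" if "r > r\<^sub>0" for r w
  proof -
    have "linear (\<lambda>w. D (r, y) (0, w))"
      using linear_compose[OF _ linD[OF U(3)[OF that]], of "Pair 0"] by (simp add: o_def linear_iff)
    from theI'[OF pos_def_form_riesz[OF g this]] show ?thesis by (simp add: Y_def)
  qed
  have Pr: "Ck_on k {r\<^sub>0<..} (\<lambda>r. (r, y))" for k
    by (intro Ck_on_Pair Ck_on_linear Ck_on_const bounded_linear_ident) auto
  have lC: "C1_on {r\<^sub>0<..} (\<lambda>r. D (r, y) (0, w))" for w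
    by (rule C1_on_compose[OF open_greaterThan Pr D1]) (use U(3) in auto)
  have YC: "C1_on {r\<^sub>0<..} Y"
    by (rule C1_on_riesz[where B = "\<lambda>r. g" and l = "\<lambda>r w. D (r, y) (0, w)"])
       (use g Y lC in \<open>auto intro: Ck_on_const simp del: Ck_on.simps\<close>)
  define q where "q r = D (r, y) (0, Y r)" for r
  \<comment> \<open>Since \<open>q = g Y Y\<close>, its derivative is \<open>2 g Y' Y\<close>. Here
    \<open>g Y' w\<close> is the radial derivative of the functional \<open>D (r, y) (0, w)\<close>,
    which is \<open>D2 (r, y) (0, w)\<close> by symmetry of the mixed derivatives.\<close>
  define q1 where "q1 r = 2 * D2 (r, y) (0, Y r)" for r
  have q_g: "q r = g (Y r) (Y r)" if "r > r\<^sub>0" for r using Y[OF that] by (simp add: q_def)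
  have dq: "(q has_real_derivative q1 r) (at r)" if r: "r > r\<^sub>0" for r
  proof -
    define Y' where "Y' = frechet_derivative Y (at r)"
    have dY: "(Y has_derivative Y') (at r)"
      unfolding Y'_def by (rule Ck_on_has_derivative[OF YC]) (use r in auto)
    have linY': "linear Y'" by (rule has_derivative_linear[OF dY])
    have Y't: "Y' t = t *\<^sub>R Y' 1" for t using linear_cmul[OF linY', of t 1] by simp
    have gY': "g (Y' 1) w = D2 (r, y) (0, w)" for w
    proof -
      have "((\<lambda>s. g (Y s) w) has_derivative (\<lambda>t. g (Y' t) w)) (at r)"
        using bounded_linear.has_derivative[OF bounded_bilinear.bounded_linear_left[OF bbg] dY] .
      moreover have "g (Y' t) w = g (Y' 1) w * t" for t
        using Y't[of t] linear_cmul[OF ling(2)[of w], of t "Y' 1"] by simp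
      then have "(\<lambda>t. g (Y' t) w) = (*) (g (Y' 1) w)" by (rule ext)
      ultimately have "((\<lambda>s. g (Y s) w) has_real_derivative g (Y' 1) w) (at r)"
        unfolding has_field_derivative_def by (simp only:)
      then have d1: "((\<lambda>s. D (s, y) (0, w)) has_real_derivative g (Y' 1) w) (at r)"
        by (rule has_field_derivative_transform_within_open[of _ _ _ "{r\<^sub>0<..}"]) (use r Y in auto)
      have "((\<lambda>t. D ((0, y) + t *\<^sub>R (1, 0)) (0, w)) has_real_derivative
          frechet_derivative (\<lambda>z. D z (0, w)) (at ((0, y) + r *\<^sub>R (1, 0))) (1, 0)) (at r)"
        by (rule C1_on_translate_field_derivative[OF D1]) (use U(3)[OF r] in simp)
      then have "((\<lambda>s. D (s, y) (0, w)) has_real_derivative D2 (r, y) (0, w)) (at r)"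
        using sym[OF U(3)[OF r]] by simp
      then show ?thesis using d1 DERIV_unique by blast
    qed
    have "((\<lambda>s. g (Y s) (Y s)) has_derivative (\<lambda>t. g (Y r) (Y' t) + g (Y' t) (Y r))) (at r)"
      by (rule bounded_bilinear.FDERIV[OF bbg dY dY])
    moreover have "g (Y r) (Y' t) + g (Y' t) (Y r) = q1 r * t" for t
    proof -
      have "g (Y r) (Y' t) = g (Y' t) (Y r)" using g by (simp add: pos_def_form_def)
      moreover have "g (Y' t) (Y r) = t * g (Y' 1) (Y r)"
        using Y't[of t] linear_cmul[OF ling(2)[of "Y r"], of t "Y' 1"] by simp
      ultimately show ?thesis using gY' by (simp add: q1_def)
    qed
    ultimately have "((\<lambda>s. g (Y s) (Y s)) has_real_derivative q1 r) (at r)"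
      by (simp add: has_field_derivative_def)
    then show ?thesis
      by (rule has_field_derivative_transform_within_open[of _ _ _ "{r\<^sub>0<..}"]) (use r q_g in auto)
  qed
  have v1: "C1_function W v"
    unfolding C1_function_def by (intro ballI Ck_on_le[OF v]) auto
  have vf: "C1_vector_field W (rgrad W v)" by (rule C1_vector_field_rgrad[OF W v])
  have pW: "(r, x) \<in> chart_dom W i" if "r > r\<^sub>0" for r
    using that xi by (simp add: W_def chart_dom_warped_end)
  have cm: "chart_map W i (r, x) = (r, y)" for r by (simp add: W_def chart_map_warped_end y_def)
  \<comment> \<open>The warped metric multiplies the form of \<open>N\<close> by
    \<open>(\<sigma> r)\<^sup>2\<close>, so the representing vector in the \<open>N\<close>
    direction is \<open>Y r\<close> divided by it.\<close>
  have grad: "rgrad W v i (r, x) = (D (r, y) (1, 0), (1 / (\<sigma> r)\<^sup>2) *\<^sub>R Y r)" if r: "r > r\<^sub>0" for r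
  proof (rule rgrad_unique[OF W v1 iW pW[OF r]])
    fix w :: "real \<times> 'e"
    obtain t u where w: "w = (t, u)" by (cases w)
    have "rmetric W i (r, x) (D (r, y) (1, 0), (1 / (\<sigma> r)\<^sup>2) *\<^sub>R Y r) w = t * D (r, y) (1, 0) + D (r, y) (0, u)"
      using \<sigma>(2)[OF r] Y[OF r, of u] linear_cmul[OF ling(2)[of u], of "1 / (\<sigma> r)\<^sup>2" "Y r"]
      by (simp add: w W_def rmetric_warped_end g_def)
    also have "\<dots> = D (r, y) w"
      using linear_Pair_split[OF linD[OF U(3)[OF r]], of t 1 u] by (simp add: w)
    finally show "rmetric W i (r, x) (D (r, y) (1, 0), (1 / (\<sigma> r)\<^sup>2) *\<^sub>R Y r) w = differential W v i (r, x) w"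
      by (simp add: differential_def cm D_def \<phi>_def[abs_def])
  qed
  show thesis
  proof (rule that[of q q1])
    fix r assume r: "r > r\<^sub>0"
    show "q r \<ge> 0"
      unfolding q_g[OF r] using g linear_0[OF ling(1)]
      by (cases "Y r = 0") (auto simp: pos_def_form_def less_imp_le)
    show "(q has_real_derivative q1 r) (at r)" by (rule dq[OF r])
    have "dir_deriv W (rgrad W v) v (r, x) = D (r, y) (rgrad W v i (r, x))"
      using dir_deriv_chart[OF smW vf v1 iW pW[OF r]]
      by (simp add: differential_def cm D_def \<phi>_def[abs_def])
    also have "\<dots> = (D (r, y) (1, 0))\<^sup>2 + q r / (\<sigma> r)\<^sup>2"
      unfolding grad[OF r] linear_Pair_split[OF linD[OF U(3)[OF r]]]
      by (simp add: q_def power2_eq_square)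
    finally show "dir_deriv W (rgrad W v) v (r, x) = (radial_deriv v (r, x))\<^sup>2 + q r / (\<sigma> r)\<^sup>2"
      unfolding vr[OF r] .
    fix \<alpha> \<beta> :: "real \<Rightarrow> real" and \<alpha>' \<beta>' :: real
    assume \<alpha>: "C1_on {r\<^sub>0<..} \<alpha>" and \<beta>: "C1_on {r\<^sub>0<..} \<beta>"
      and \<alpha>': "(\<alpha> has_real_derivative \<alpha>') (at r)" and \<beta>': "(\<beta> has_real_derivative \<beta>') (at r)"
    let ?\<psi> = "\<lambda>p. \<alpha> (fst p) * radial_deriv v p + \<beta> (fst p) * v p"
    have vrC: "C1_function W (radial_deriv v)"
      unfolding W_def by (rule C1_function_radial_deriv[OF sm v[unfolded W_def]])
    have \<psi>C: "C1_function W ?\<psi>"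
      using C1_function_radial[OF sm \<alpha>, of \<sigma>] C1_function_radial[OF sm \<beta>, of \<sigma>] vrC v1
      by (intro C1_function_add C1_function_mult smW) (simp_all add: W_def)
    have da: "((\<lambda>z. a (fst z)) has_derivative (\<lambda>w. a' * fst w)) (at (r, y))"
      if "(a has_real_derivative a') (at r)" for a a'
    proof (rule has_derivative_compose[where f = fst and g = a, OF has_derivative_fst[OF has_derivative_ident]])
      show "(a has_derivative (*) a') (at (fst (r, y)))" using that by (simp add: has_field_derivative_def)
    qed
    have d\<phi>: "(\<phi> has_derivative D (r, y)) (at (r, y))"
      unfolding D_def by (rule Ck_on_has_derivative[OF \<phi>1 _ U(3)[OF r]]) simp
    have dD: "((\<lambda>z. D z (1, 0)) has_derivative D2 (r, y)) (at (r, y))"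
      unfolding D2_def by (rule Ck_on_has_derivative[OF D1 _ U(3)[OF r]]) simp
    have "((\<lambda>z. \<alpha> (fst z) * D z (1, 0) + \<beta> (fst z) * \<phi> z) has_derivative
        (\<lambda>w. (\<alpha> (fst (r, y)) * D2 (r, y) w + \<alpha>' * fst w * D (r, y) (1, 0))
          + (\<beta> (fst (r, y)) * D (r, y) w + \<beta>' * fst w * \<phi> (r, y)))) (at (r, y))"
      by (intro has_derivative_add has_derivative_mult da \<alpha>' \<beta>' d\<phi> dD)
    then have "((\<lambda>z. ?\<psi> (chart_inv W i z)) has_derivative
        (\<lambda>w. (\<alpha> r * D2 (r, y) w + \<alpha>' * fst w * D (r, y) (1, 0))
          + (\<beta> r * D (r, y) w + \<beta>' * fst w * \<phi> (r, y)))) (at (r, y))"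
      unfolding fst_conv
    proof (rule has_derivative_transform_within_open[OF _ U(2) U(3)[OF r]])
      fix z assume "z \<in> U"
      then show "\<alpha> (fst z) * D z (1, 0) + \<beta> (fst z) * \<phi> z = ?\<psi> (chart_inv W i z)"
        using vrD[of z] chart_inv_warped_end[OF sm i, of r\<^sub>0 "fst z" "snd z" \<sigma>]
        by (auto simp: \<phi>_def U_def W_def)
    qed
    then have "differential W ?\<psi> i (r, x) = (\<lambda>w. (\<alpha> r * D2 (r, y) w + \<alpha>' * fst w * D (r, y) (1, 0))
          + (\<beta> r * D (r, y) w + \<beta>' * fst w * \<phi> (r, y)))"
      unfolding differential_def cm by (rule frechet_derivative_eqI)
    then have "dir_deriv W (rgrad W v) ?\<psi> (r, x) =
        (\<alpha> r * D2 (r, y) (rgrad W v i (r, x)) + \<alpha>' * D (r, y) (1, 0) * D (r, y) (1, 0))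
          + (\<beta> r * D (r, y) (rgrad W v i (r, x)) + \<beta>' * D (r, y) (1, 0) * \<phi> (r, y))"
      using dir_deriv_chart[OF smW vf \<psi>C iW pW[OF r]] grad[OF r] by simp
    also have "D2 (r, y) (rgrad W v i (r, x)) = D (r, y) (1, 0) * D2 (r, y) (1, 0) + q1 r / (2 * (\<sigma> r)\<^sup>2)"
      unfolding grad[OF r] linear_Pair_split[OF linD2[OF U(3)[OF r]]] by (simp add: q1_def)
    also have "D (r, y) (rgrad W v i (r, x)) = D (r, y) (1, 0) * D (r, y) (1, 0) + q r / (\<sigma> r)\<^sup>2"
      unfolding grad[OF r] linear_Pair_split[OF linD[OF U(3)[OF r]]] by (simp add: q_def)
    also have "\<phi> (r, y) = v (r, x)" by (simp add: \<phi>_def inv[OF r])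
    finally show "dir_deriv W (rgrad W v) ?\<psi> (r, x)
      = radial_deriv v (r, x) * (\<alpha>' * radial_deriv v (r, x) + \<alpha> r * radial_deriv (radial_deriv v) (r, x)
          + \<beta>' * v (r, x) + \<beta> r * radial_deriv v (r, x))
        + (\<alpha> r * q1 r / 2 + \<beta> r * q r) / (\<sigma> r)\<^sup>2"
      unfolding vr[OF r] vrr[OF r] by (simp add: algebra_simps add_divide_distrib)
  qed
qed

section \<open>Integrals over a warped end in product charts\<close>

lemma integrable_mult_pair:
  fixes f :: "'a::euclidean_space \<Rightarrow> real" and g :: "'b::euclidean_space \<Rightarrow> real"
  assumes f: "integrable lborel f" and g: "integrable lborel g"
  shows "integrable lborel (\<lambda>z. f (fst z) * g (snd z))"
proof -
  have "integrable (lborel \<Otimes>\<^sub>M lborel) (\<lambda>z. f (fst z) * g (snd z))"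
  proof (rule lborel_pair.Fubini_integrable)
    have "f \<in> borel_measurable lborel" "g \<in> borel_measurable lborel" using f g by auto
    then show "(\<lambda>z. f (fst z) * g (snd z)) \<in> borel_measurable (lborel \<Otimes>\<^sub>M lborel)" by measurable
    have "(\<lambda>x. \<integral>y. norm (f (fst (x, y)) * g (snd (x, y))) \<partial>lborel) = (\<lambda>x. norm (f x) * (\<integral>y. norm (g y) \<partial>lborel))"
      by (simp add: abs_mult)
    then show "integrable lborel (\<lambda>x. \<integral>y. norm (f (fst (x, y)) * g (snd (x, y))) \<partial>lborel)"
      using f by simp
  qed (use g in simp)
  then show ?thesis by (simp add: lborel_prod)
qed

text \<open>Fubini in a product chart, with \<open>r\<close> as the inner variable. The density
  splits into \<open>\<sigma> r ^ DIM('e)\<close> and the density of \<open>N\<close>, which is a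
  positive constant on each ray. If \<open>f\<close> is not integrable, its integral is 0 by
  convention.\<close>

lemma riemannian_measure_warped_nonneg:
  fixes N :: "('i, 'a::{t2_space, second_countable_topology}, 'e::euclidean_space) riem_atlas"
    and \<sigma> :: "real \<Rightarrow> real" and r\<^sub>0 :: real and f :: "real \<times> 'a \<Rightarrow> real"
  defines "W \<equiv> warped_end r\<^sub>0 \<sigma> N"
  assumes N: "riemannian_manifold N" and \<sigma>: "smooth_on {r\<^sub>0<..} \<sigma>" "\<And>r. r > r\<^sub>0 \<Longrightarrow> \<sigma> r > 0"
    and \<mu>: "is_riemannian_measure W \<mu>" and i: "i \<in> chart_idx N"
    and f: "f \<in> borel_measurable (restrict_space borel (points W))"
    and f0: "\<And>p. p \<in> points W \<Longrightarrow> p \<notin> chart_dom W i \<Longrightarrow> f p = 0"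
    and nonneg: "\<And>x. x \<in> chart_dom N i \<Longrightarrow>
      0 \<le> (\<integral>r. indicator {r\<^sub>0<..} r * (\<sigma> r ^ DIM('e) * f (r, x)) \<partial>lborel)"
  shows "0 \<le> (\<integral>p. f p \<partial>\<mu>)"
proof (cases "integrable \<mu> f")
  case False
  then show ?thesis by (simp add: not_integrable_integral_eq)
next
  case True
  note sm = riemannian_manifold_smooth[OF N]
  have W: "riemannian_manifold W" unfolding W_def by (rule riemannian_manifold_warped_end[OF N \<sigma>])
  have iW: "i \<in> chart_idx W" using i by (simp add: W_def chart_idx_warped_end)
  have fm: "f \<in> borel_measurable (restrict_space borel (chart_dom W i))"
    by (rule measurable_restrict_mono[OF f chart_dom_subset_points[OF iW]])
  define F where "F z = indicator (chart_img W i) z * (vol_density W i z * f (chart_inv W i z))" for z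
  have int: "integrable lborel F"
    using True integrable_chart[OF W \<mu> iW fm f0] by (simp add: F_def[abs_def])
  have "(\<integral>p. f p \<partial>\<mu>) = (\<integral>z. F z \<partial>lborel)"
    unfolding F_def by (rule integral_chart[OF W \<mu> iW fm f0])
  also have "\<dots> = (\<integral>z. (case z of (r, y) \<Rightarrow> F (r, y)) \<partial>(lborel \<Otimes>\<^sub>M lborel))"
    by (simp add: lborel_prod case_prod_unfold)
  also have "\<dots> = (\<integral>y. (\<integral>r. F (r, y) \<partial>lborel) \<partial>lborel)"
    by (rule lborel_pair.integral_snd[symmetric]) (use int in \<open>simp add: lborel_prod case_prod_unfold\<close>)
  also have "\<dots> \<ge> 0"
  proof (rule Bochner_Integration.integral_nonneg)
    fix y
    show "0 \<le> (\<integral>r. F (r, y) \<partial>lborel)"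
    proof (cases "y \<in> chart_img N i")
      case False
      then show ?thesis by (simp add: F_def W_def chart_img_warped_end)
    next
      case y: True
      have "F (r, y) = vol_density N i y * (indicator {r\<^sub>0<..} r * (\<sigma> r ^ DIM('e) * f (r, chart_inv N i y)))" for r
        using y vol_density_warped_end[where \<sigma> = \<sigma> and r = r, OF N \<sigma>(2) i _ y] chart_inv_warped_end[OF sm i _ y]
        by (auto simp: F_def W_def chart_img_warped_end indicator_def)
      then show ?thesis
        using nonneg[OF chart_inv_in_dom[OF sm i y]] vol_density_pos[OF N i y] by simp
    qed
  qed
  finally show ?thesis .
qed

text \<open>Meant for \<open>k\<^sub>1\<close>, which is only locally integrable and so escapes the
  criterion for continuous functions. In a product chart the integrand separates into a function of
  \<open>r\<close> and one of \<open>y\<close>, and the power of \<sigma> is bounded on the interval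
  that carries \<kappa>.\<close>

lemma integrable_warped_mult:
  fixes N :: "('i, 'a::{t2_space, second_countable_topology}, 'e::euclidean_space) riem_atlas"
    and \<sigma> \<kappa> :: "real \<Rightarrow> real" and r\<^sub>0 :: real and \<eta> :: "'a \<Rightarrow> real"
  defines "W \<equiv> warped_end r\<^sub>0 \<sigma> N"
  assumes N: "riemannian_manifold N" and \<sigma>: "smooth_on {r\<^sub>0<..} \<sigma>" "\<And>r. r > r\<^sub>0 \<Longrightarrow> \<sigma> r > 0"
    and \<mu>: "is_riemannian_measure W \<mu>" and i: "i \<in> chart_idx N"
    and \<kappa>: "integrable lborel \<kappa>" and \<alpha>\<beta>: "r\<^sub>0 < \<alpha>" "\<And>r. r \<notin> {\<alpha>..\<beta>} \<Longrightarrow> \<kappa> r = 0"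
    and \<eta>: "continuous_on (points N) \<eta>" and L: "compact L" "L \<subseteq> chart_dom N i" "\<And>x. x \<notin> L \<Longrightarrow> \<eta> x = 0"
  shows "integrable \<mu> (\<lambda>p. \<kappa> (fst p) * \<eta> (snd p))"
proof -
  note sm = riemannian_manifold_smooth[OF N]
  have W: "riemannian_manifold W" unfolding W_def by (rule riemannian_manifold_warped_end[OF N \<sigma>])
  have iW: "i \<in> chart_idx W" using i by (simp add: W_def chart_idx_warped_end)
  let ?f = "\<lambda>p. \<kappa> (fst p) * \<eta> (snd p)"
  have \<eta>i: "continuous_on (chart_img N i) (\<lambda>y. \<eta> (chart_inv N i y))"
    by (rule continuous_on_compose2[OF \<eta> continuous_on_chart_inv[OF sm i]])
       (use chart_inv_in_dom[OF sm i] chart_dom_subset_points[OF i] in auto)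
  have "\<kappa> \<in> borel_measurable borel" using \<kappa> by auto
  then have m1: "(\<lambda>p. \<kappa> (fst p)) \<in> borel_measurable (restrict_space borel (chart_dom W i))"
    by (intro measurable_restrict_space1 measurable_compose[OF borel_measurable_continuous_onI[OF continuous_on_fst[OF continuous_on_id]]])
  have m2: "(\<lambda>p. \<eta> (snd p)) \<in> borel_measurable (restrict_space borel (chart_dom W i))"
    by (intro borel_measurable_continuous_on_restrict continuous_on_compose2[OF \<eta> continuous_on_snd[OF continuous_on_id]])
       (use chart_dom_subset_points[OF i] in \<open>auto simp: W_def chart_dom_warped_end\<close>)
  have fm: "?f \<in> borel_measurable (restrict_space borel (chart_dom W i))"
    using m1 m2 by (rule borel_measurable_times)
  have f0: "?f p = 0" if "p \<in> points W" "p \<notin> chart_dom W i" for p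
    using that L(2) L(3)[of "snd p"]
    by (cases "snd p \<in> L") (auto simp: W_def chart_dom_warped_end points_warped_end)
  have \<sigma>c: "continuous_on {\<alpha>..\<beta>} (\<lambda>r. \<sigma> r ^ DIM('e))"
    by (intro continuous_on_power continuous_on_subset[OF Ck_on_imp_continuous_on[OF smooth_on_Ck[OF \<sigma>(1), of 0]]])
       (use \<alpha>\<beta>(1) in auto)
  then have "bounded ((\<lambda>r. \<sigma> r ^ DIM('e)) ` {\<alpha>..\<beta>})"
    by (intro compact_imp_bounded compact_continuous_image) auto
  then obtain C where C: "\<And>r. r \<in> {\<alpha>..\<beta>} \<Longrightarrow> norm (\<sigma> r ^ DIM('e)) \<le> C"
    unfolding bounded_pos by blast
  let ?s = "\<lambda>r. indicator {\<alpha>..\<beta>} r *\<^sub>R \<sigma> r ^ DIM('e)"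
  have "integrable lborel (\<lambda>r. ?s r * \<kappa> r)"
  proof (rule Bochner_Integration.integrable_bound)
    show "integrable lborel (\<lambda>r. C * norm (\<kappa> r))" using \<kappa> by simp
    have "?s \<in> borel_measurable borel"
      by (rule borel_measurable_continuous_on_indicator[OF _ \<sigma>c]) simp
    then show "(\<lambda>r. ?s r * \<kappa> r) \<in> borel_measurable lborel"
      using \<kappa> by simp
    have "norm (?s r * \<kappa> r) \<le> norm (C * norm (\<kappa> r))" for r
    proof (cases "r \<in> {\<alpha>..\<beta>}")
      case True
      then show ?thesis using C[OF True] by (simp add: abs_mult) (intro mult_right_mono, auto)
    next
      case False
      then show ?thesis by auto
    qed
    then show "AE r in lborel. norm (?s r * \<kappa> r) \<le> norm (C * norm (\<kappa> r))" by simp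
  qed
  moreover have "integrable lborel (\<lambda>y. indicator (chart_img N i) y * (vol_density N i y * \<eta> (chart_inv N i y)))"
    by (rule integrable_lborel_chart[OF N i \<eta>i L(1,2)]) (use L(3) in auto)
  ultimately have "integrable lborel (\<lambda>z. (?s (fst z) * \<kappa> (fst z)) *
      (indicator (chart_img N i) (snd z) * (vol_density N i (snd z) * \<eta> (chart_inv N i (snd z)))))"
    by (rule integrable_mult_pair)
  also have "(\<lambda>z. (?s (fst z) * \<kappa> (fst z)) *
      (indicator (chart_img N i) (snd z) * (vol_density N i (snd z) * \<eta> (chart_inv N i (snd z)))))
    = (\<lambda>z. indicator (chart_img W i) z * (vol_density W i z * ?f (chart_inv W i z)))"
  proof
    fix z :: "real \<times> 'e"
    obtain r y where z: "z = (r, y)" by (cases z)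
    show "(?s (fst z) * \<kappa> (fst z)) *
      (indicator (chart_img N i) (snd z) * (vol_density N i (snd z) * \<eta> (chart_inv N i (snd z))))
      = indicator (chart_img W i) z * (vol_density W i z * ?f (chart_inv W i z))"
    proof (cases "y \<in> chart_img N i \<and> r \<in> {\<alpha>..\<beta>}")
      case True
      then show ?thesis
        using \<alpha>\<beta>(1) vol_density_warped_end[where \<sigma> = \<sigma>, OF N \<sigma>(2) i, of r r\<^sub>0 y] chart_inv_warped_end[OF sm i, of r\<^sub>0 r y \<sigma>]
        by (simp add: z W_def chart_img_warped_end)
    next
      case False
      then show ?thesis
        using \<alpha>\<beta>(2)[of r] chart_inv_warped_end[OF sm i, of r\<^sub>0 r y \<sigma>]
        by (auto simp: z W_def chart_img_warped_end indicator_def)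
    qed
  qed
  finally show ?thesis using integrable_chart[OF W \<mu> iW fm f0] by blast
qed

subsection \<open>The Carleman estimate\<close>

lemma radial_deriv_has_derivative:
  assumes N: "smooth_manifold N" and f: "C1_function (warped_end r\<^sub>0 \<sigma> N) f" and x: "x \<in> points N" and r: "r > r\<^sub>0"
  shows "((\<lambda>s. f (s, x)) has_real_derivative radial_deriv f (r, x)) (at r)"
proof -
  obtain i where i: "i \<in> chart_idx N" "x \<in> chart_dom N i" using x by (auto simp: points_def)
  have "C1_on ({r\<^sub>0<..} \<times> chart_img N i) (\<lambda>z. f (chart_inv (warped_end r\<^sub>0 \<sigma> N) i z))"
    using C1_functionD[OF f, of i] i by (simp add: chart_idx_warped_end chart_img_warped_end del: Ck_on.simps)
  from radial_deriv_chart[OF N i(1) this r chart_map_in_img[OF N i]]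
  show ?thesis by (simp add: chart_inv_chart_map[OF N i])
qed

lemma radial_deriv_zero:
  assumes N: "smooth_manifold N" and K: "compact K"
    and f0: "\<And>p. p \<in> points (warped_end r\<^sub>0 \<sigma> N) \<Longrightarrow> p \<notin> K \<Longrightarrow> f p = 0"
    and p: "p \<in> points (warped_end r\<^sub>0 \<sigma> N)" "p \<notin> K"
  shows "radial_deriv f p = 0"
proof -
  let ?S = "points (warped_end r\<^sub>0 \<sigma> N) - K"
  have "open ?S"
    by (intro open_Diff open_points smooth_manifold_warped_end[OF N] compact_imp_closed[OF K])
  then have o: "open ((\<lambda>s. (s, snd p)) -` ?S)"
    by (rule open_vimage) (intro continuous_intros)
  have "((\<lambda>s. f (s, snd p)) has_real_derivative 0) (at (fst p))"
    by (rule has_field_derivative_transform_within_open[OF DERIV_const o]) (use p f0 in auto)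
  then show ?thesis by (simp add: radial_deriv_def DERIV_imp_deriv)
qed

lemma continuous_on_radial:
  assumes "continuous_on {r\<^sub>0<..} g"
  shows "continuous_on (points (warped_end r\<^sub>0 \<sigma> N)) (\<lambda>p. g (fst p))"
  by (rule continuous_on_compose2[OF assms continuous_on_fst[OF continuous_on_id]])
     (auto simp: points_warped_end)

text \<open>The strict inequalities keep the slices at \<alpha> and \<beta> off \<open>K\<close>, so
  that all boundary terms on a ray vanish, while \<alpha> stays strictly above
  \<open>r\<^sub>0\<close>, where \<sigma> is under control.\<close>

lemma compact_warped_bounds:
  fixes N :: "('i, 'a::topological_space, 'e) riem_atlas"
  assumes "compact K" "K \<subseteq> points (warped_end r\<^sub>0 \<sigma> N)"
  obtains \<alpha> \<beta> where "r\<^sub>0 < \<alpha>" "\<alpha> < \<beta>" "\<And>p. p \<in> K \<Longrightarrow> \<alpha> < fst p \<and> fst p < \<beta>"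
proof (cases "K = {}")
  case True
  then show thesis using that[of "r\<^sub>0 + 1" "r\<^sub>0 + 2"] by simp
next
  case False
  have c: "continuous_on K fst" by (intro continuous_on_fst continuous_on_id)
  obtain a where a: "a \<in> K" "\<forall>p\<in>K. fst a \<le> fst p" using continuous_attains_inf[OF assms(1) False c] by blast
  obtain b where b: "b \<in> K" "\<forall>p\<in>K. fst p \<le> fst b" using continuous_attains_sup[OF assms(1) False c] by blast
  have "fst a > r\<^sub>0" using a(1) assms(2) by (auto simp: points_warped_end)
  moreover have "fst a \<le> fst b" using a b by blast
  ultimately show thesis
    by (intro that[of "(r\<^sub>0 + fst a) / 2" "fst b + 1"]) (use a(2) b(2) in \<open>fastforce+\<close>)
qed

text \<open>The hypotheses \<open>diff_A\<close>, \<open>diff_k2\<close> and \<open>int_k1\<close>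
  spell out the regularity that the English statement presupposes: \<open>A'\<close> and
  \<open>k\<^sub>2'\<close> exist, and the integral with \<open>k\<^sub>1\<close> converges. Taking
  \<open>n\<close> as the dimension of \<open>real \<times> 'e\<close> includes
  \<open>n \<ge> 2\<close>, since a Euclidean space has positive dimension.\<close>

theorem lemma6:
  fixes N :: "('i, 'a::{t2_space, second_countable_topology}, 'e::euclidean_space) riem_atlas"
    and r\<^sub>0 :: real
    and \<sigma> h G k\<^sub>1 k\<^sub>2 F A :: "real \<Rightarrow> real"
    and n :: nat
    and v :: "real \<times> 'a \<Rightarrow> real"
    and \<mu> :: "(real \<times> 'a) measure"
  assumes n: "n = DIM(real \<times> 'e)"
    and F: "F = (\<lambda>r. 1/2 * (deriv h r + (real n - 1) * deriv \<sigma> r / \<sigma> r - deriv G r))"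
    and A: "A = (\<lambda>r. F r ^ 3 - F r * deriv (\<lambda>s. \<sigma> s ^ (n - 1) * F s) r / \<sigma> r ^ (n - 1))"
    and N: "riemannian_manifold N" "riem_complete N"
    and r0: "r\<^sub>0 \<ge> 0"
    and sigma: "smooth_on {r\<^sub>0<..} \<sigma>" "\<And>r. r > r\<^sub>0 \<Longrightarrow> \<sigma> r > 0"
    and h: "Ck_on 2 {0<..} h"
    and G: "Ck_on 2 {0<..} G"
    and mu: "is_riemannian_measure (warped_end r\<^sub>0 \<sigma> N) \<mu>"
    and diff_A: "\<And>r. r > r\<^sub>0 \<Longrightarrow> A differentiable (at r)"
    and diff_k2: "\<And>r. r > r\<^sub>0 \<Longrightarrow> k\<^sub>2 differentiable (at r)"
    and int_k1: "\<And>a b. r\<^sub>0 < a \<Longrightarrow> a < b \<Longrightarrow> set_integrable lborel {a..b} k\<^sub>1"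
    and k2: "\<And>r. r > r\<^sub>0 \<Longrightarrow> k\<^sub>2 r \<le> 2 * min
          (2 * (F r)\<^sup>2 - 2 * (real n - 1) * (F r * deriv \<sigma> r / \<sigma> r) + deriv F r + F r * deriv G r)
          (- deriv F r - F r * deriv G r + 2 * (F r * deriv \<sigma> r / \<sigma> r))"
    and k1: "\<And>r. r > r\<^sub>0 \<Longrightarrow> k\<^sub>1 r \<le> 2 * (deriv A r + A r * deriv G r)
          - k\<^sub>2 r * (F r)\<^sup>2 - deriv G r * k\<^sub>2 r * F r - deriv k\<^sub>2 r * F r - k\<^sub>2 r * deriv F r"
    and v: "test_function (warped_end r\<^sub>0 \<sigma> N) v"
  shows "(\<integral>p. (v p)\<^sup>2 * k\<^sub>1 (fst p) * exp (h (fst p)) \<partial>\<mu>)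
       + (\<integral>p. rnorm2 (warped_end r\<^sub>0 \<sigma> N) (rgrad (warped_end r\<^sub>0 \<sigma> N) v) p
                 * k\<^sub>2 (fst p) * exp (h (fst p)) \<partial>\<mu>)
       \<le> (\<integral>p. (laplacian (warped_end r\<^sub>0 \<sigma> N) v p)\<^sup>2 * exp (h (fst p)) \<partial>\<mu>)"
proof -

  \<comment> \<open>The end, the support of \<open>v\<close> and its gradient\<close>
  let ?W = "warped_end r\<^sub>0 \<sigma> N"
  note sm = riemannian_manifold_smooth[OF N(1)]
  note W = riemannian_manifold_warped_end[OF N(1) sigma]
  note smW = riemannian_manifold_smooth[OF W]
  define m where "m = DIM('e)"
  have m: "n - 1 = m" "real n - 1 = real m" by (simp_all add: n m_def)
  have sp: "space \<mu> = points ?W" "sets \<mu> = sets (restrict_space borel (points ?W))"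
    using mu by (auto simp: is_riemannian_measure_def)
  obtain K where K: "compact K" "K \<subseteq> points ?W" and v0: "\<And>p. p \<in> points ?W \<Longrightarrow> p \<notin> K \<Longrightarrow> v p = 0"
    using v by (auto simp: test_function_def)
  obtain \<alpha> \<beta> where \<alpha>\<beta>: "r\<^sub>0 < \<alpha>" "\<alpha> < \<beta>" "\<And>p. p \<in> K \<Longrightarrow> \<alpha> < fst p \<and> fst p < \<beta>"
    using compact_warped_bounds[OF K] by blast
  have v2: "\<And>i. i \<in> chart_idx ?W \<Longrightarrow> Ck_on 2 (chart_img ?W i) (\<lambda>z. v (chart_inv ?W i z))"
    using v by (simp add: test_function_def smooth_on_def o_def)
  have v1: "C1_function ?W v" by (rule test_function_C1[OF v])
  define vr where "vr = radial_deriv v"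
  have vr1: "C1_function ?W vr" unfolding vr_def by (rule C1_function_radial_deriv[OF sm v2])
  have vr0: "\<And>p. p \<in> points ?W \<Longrightarrow> p \<notin> K \<Longrightarrow> vr p = 0"
    unfolding vr_def by (rule radial_deriv_zero[OF sm K(1) v0])
  define X where "X = rgrad ?W v"
  have X: "C1_vector_field ?W X" unfolding X_def by (rule C1_vector_field_rgrad[OF W v2])

  \<comment> \<open>Regularity and derivatives of the coefficients\<close>
  have pos: "{r\<^sub>0<..} \<subseteq> {0<..}" using r0 by auto
  have hC: "Ck_on (Suc (Suc 0)) {r\<^sub>0<..} h" and GC: "Ck_on (Suc (Suc 0)) {r\<^sub>0<..} G"
    using Ck_on_mono[OF pos] h G by (auto simp: numeral_2_eq_2 simp del: Ck_on.simps)
  note \<sigma>C = smooth_on_Ck[OF sigma(1)]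
  have d\<sigma>: "(\<sigma> has_real_derivative deriv \<sigma> r) (at r)" if "r > r\<^sub>0" for r
    using Ck_on_deriv(2)[OF \<sigma>C[of "Suc 0"] open_greaterThan] that by simp
  have dh: "(h has_real_derivative deriv h r) (at r)" if "r > r\<^sub>0" for r
    using Ck_on_deriv(2)[OF hC open_greaterThan] that by simp
  \<comment> \<open>One derivative of \<open>h\<close> and \<open>G\<close> is spent in
    \<open>F\<close>; what is left is just enough for \<psi> to be admissible in Green's
    formula.\<close>
  have F1: "C1_on {r\<^sub>0<..} F"
    unfolding F using sigma(2)
    by (intro Ck_on_cmult Ck_on_diff Ck_on_add C1_on_divide Ck_on_deriv(1)[OF hC] Ck_on_deriv(1)[OF GC]
        Ck_on_deriv(1)[OF \<sigma>C[of "Suc (Suc 0)"]] \<sigma>C open_greaterThan) (auto simp: less_imp_neq[symmetric])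
  have dF: "(F has_real_derivative deriv F r) (at r)" if "r > r\<^sub>0" for r
    using Ck_on_deriv(2)[OF F1 open_greaterThan] that by simp
  have h1: "C1_on {r\<^sub>0<..} h" by (rule Ck_on_SucD[OF hC])
  have F_eq: "F r = 1/2 * (deriv h r + real m * deriv \<sigma> r / \<sigma> r - deriv G r)" for r
    by (simp add: F m)
  \<comment> \<open>Brings \<open>A\<close> into the form with \<open>F'\<close> and the logarithmic
    derivative of \<sigma> that enters the inequality on rays.\<close>
  have A_eq: "A r = F r ^ 3 - F r * (deriv F r + real m * F r * deriv \<sigma> r / \<sigma> r)" if r: "r > r\<^sub>0" for r
  proof -
    have "((\<lambda>s. \<sigma> s ^ m * F s) has_real_derivative
        (real m * \<sigma> r ^ (m - 1) * deriv \<sigma> r) * F r + \<sigma> r ^ m * deriv F r) (at r)"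
      using d\<sigma>[OF r] dF[OF r] by (auto intro!: derivative_eq_intros)
    then have "deriv (\<lambda>s. \<sigma> s ^ m * F s) r = (real m * \<sigma> r ^ (m - 1) * deriv \<sigma> r) * F r + \<sigma> r ^ m * deriv F r"
      by (rule DERIV_imp_deriv)
    moreover have e: "real m * \<sigma> r ^ (m - 1) = real m * \<sigma> r ^ m / \<sigma> r"
      using sigma(2)[OF r] by (cases m) auto
    ultimately have "deriv (\<lambda>s. \<sigma> s ^ m * F s) r / \<sigma> r ^ m = deriv F r + real m * F r * deriv \<sigma> r / \<sigma> r"
      using sigma(2)[OF r] unfolding e by (simp add: field_simps)
    moreover have "A r = F r ^ 3 - F r * (deriv (\<lambda>s. \<sigma> s ^ m * F s) r / \<sigma> r ^ m)"
      unfolding A m(1) by simp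
    ultimately show ?thesis by simp
  qed
  have dA: "(A has_real_derivative deriv A r) (at r)" and dk2: "(k\<^sub>2 has_real_derivative deriv k\<^sub>2 r) (at r)"
    if "r > r\<^sub>0" for r
    using diff_A[OF that] diff_k2[OF that]
    by (auto simp: DERIV_deriv_iff_real_differentiable)

  \<comment> \<open>The multiplier \<psi>\<close>
  define a where "a r = - 2 * (F r * exp (h r))" for r
  \<comment> \<open>The coefficient of \<open>v\<close> in \<psi>; it is not the \<open>b\<close> of
    the overview, which is \<psi> without its exponential factor.\<close>
  define b where "b r = - 2 * ((F r)\<^sup>2 * exp (h r))" for r
  have a1: "C1_on {r\<^sub>0<..} a" and b1: "C1_on {r\<^sub>0<..} b"
    unfolding a_def b_def by (intro Ck_on_cmult Ck_on_mult Ck_on_power C1_on_exp F1 h1 open_greaterThan)+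
  have da: "(a has_real_derivative - 2 * (deriv F r + F r * deriv h r) * exp (h r)) (at r)"
    and db: "(b has_real_derivative - 2 * (2 * F r * deriv F r + (F r)\<^sup>2 * deriv h r) * exp (h r)) (at r)"
    if "r > r\<^sub>0" for r
    unfolding a_def b_def using dF[OF that] dh[OF that]
    by (auto intro!: derivative_eq_intros simp: algebra_simps)
  define \<psi> where "\<psi> p = a (fst p) * vr p + b (fst p) * v p" for p
  have \<psi>1: "C1_function ?W \<psi>"
    unfolding \<psi>_def by (intro C1_function_add C1_function_mult C1_function_radial smW sm a1 b1 vr1 v1)
  have \<psi>0: "\<And>p. p \<in> points ?W \<Longrightarrow> p \<notin> K \<Longrightarrow> \<psi> p = 0" by (simp add: \<psi>_def v0 vr0)

  \<comment> \<open>Integrability of all terms\<close>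
  define T where "T p = 4 * (F (fst p))\<^sup>2 * (vr p + F (fst p) * v p)\<^sup>2 * exp (h (fst p))" for p
  note cr = continuous_on_radial[of r\<^sub>0 _ \<sigma> N]
  have cF: "continuous_on (points ?W) (\<lambda>p. F (fst p))" by (rule cr[OF Ck_on_imp_continuous_on[OF F1]])
  have ch: "continuous_on (points ?W) (\<lambda>p. exp (h (fst p)))"
    by (rule cr[OF Ck_on_imp_continuous_on[OF C1_on_exp[OF open_greaterThan h1]]])
  have "continuous_on {r\<^sub>0<..} k\<^sub>2"
    using diff_k2 by (intro differentiable_imp_continuous_on) (auto simp: differentiable_on_def intro: differentiable_at_withinI)
  then have ck2: "continuous_on (points ?W) (\<lambda>p. k\<^sub>2 (fst p))" by (rule cr)
  have cv: "continuous_on (points ?W) v" "continuous_on (points ?W) vr" "continuous_on (points ?W) \<psi>"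
    using C1_function_continuous[OF smW] v1 vr1 \<psi>1 by auto
  have cl: "continuous_on (points ?W) (laplacian ?W v)"
    unfolding laplacian_def X_def[symmetric] by (rule continuous_on_rdiv[OF W mu X])
  have l0: "\<And>p. p \<in> points ?W \<Longrightarrow> p \<notin> K \<Longrightarrow> laplacian ?W v p = 0"
    by (rule laplacian_zero[OF W v1 K(1) _ _ v0])
  note cdd = continuous_on_dir_deriv[OF W X]
  note ic = integrable_riemannian_continuous[OF W mu _ K]
  have I_lap: "integrable \<mu> (\<lambda>p. (laplacian ?W v p)\<^sup>2 * exp (h (fst p)))"
    by (rule ic) (auto intro!: continuous_on_mult continuous_on_power cl ch simp: l0)
  have I_psi: "integrable \<mu> (\<lambda>p. \<psi> p * laplacian ?W v p)"
    by (rule ic) (auto intro!: continuous_on_mult cl cv simp: l0)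
  have I_T: "integrable \<mu> T"
    unfolding T_def
    by (rule ic) (auto intro!: continuous_on_mult continuous_on_power continuous_on_add continuous_on_const cF cv ch simp: v0 vr0)
  have dd0: "\<And>p. p \<in> points ?W \<Longrightarrow> p \<notin> K \<Longrightarrow> dir_deriv ?W X v p = 0"
    by (rule dir_deriv_zero[OF smW K(1) _ _ v0])
  have dd\<psi>0: "\<And>p. p \<in> points ?W \<Longrightarrow> p \<notin> K \<Longrightarrow> dir_deriv ?W X \<psi> p = 0"
    by (rule dir_deriv_zero[OF smW K(1) _ _ \<psi>0])
  have I_dd: "integrable \<mu> (dir_deriv ?W X \<psi>)"
    by (rule ic) (auto intro!: cdd \<psi>1 simp: dd\<psi>0)
  have I_k2: "integrable \<mu> (\<lambda>p. dir_deriv ?W X v p * k\<^sub>2 (fst p) * exp (h (fst p)))"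
    by (rule ic) (auto intro!: continuous_on_mult cdd v1 ck2 ch simp: dd0)

  have KN: "compact (snd ` K)" "snd ` K \<subseteq> points N"
    using K by (auto intro!: compact_continuous_image continuous_on_snd continuous_on_id simp: points_warped_end)
  \<comment> \<open>The partition lives on \<open>N\<close> and covers the projection of
    \<open>K\<close>. Its functions are therefore constant along rays and do not disturb the radial
    inequality, as cutoffs depending on \<open>r\<close> would.\<close>
  obtain J :: "'a set" and c \<eta> L where J: "finite J"
    and c: "\<And>q. q \<in> J \<Longrightarrow> c q \<in> chart_idx N" and L: "\<And>q. q \<in> J \<Longrightarrow> compact (L q)"
    "\<And>q. q \<in> J \<Longrightarrow> L q \<subseteq> chart_dom N (c q)" and \<eta>1: "\<And>q. q \<in> J \<Longrightarrow> C1_function N (\<eta> q)"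
    and \<eta>01: "\<And>q p. q \<in> J \<Longrightarrow> 0 \<le> \<eta> q p \<and> \<eta> q p \<le> 1"
    and \<eta>0: "\<And>q p. q \<in> J \<Longrightarrow> p \<notin> L q \<Longrightarrow> \<eta> q p = 0"
    and \<eta>_sum: "\<And>p. p \<in> snd ` K \<Longrightarrow> (\<Sum>q\<in>J. \<eta> q p) = 1"
    by (rule partition_of_unity[OF sm KN]) (rule that, assumption+)
  have c\<eta>: "continuous_on (points N) (\<eta> q)" if "q \<in> J" for q
    by (rule C1_function_continuous[OF sm \<eta>1[OF that]])

  \<comment> \<open>\<open>k\<^sub>1\<close> may be unbounded on \<open>K\<close>, so a dominating
    function is needed: a constant times \<open>\<bar>\<kappa>\<bar>\<close>, cut off by functions
    that sum to 1 on \<open>K\<close>. Here \<kappa> is \<open>k\<^sub>1\<close> truncated to an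
    interval containing all radii in \<open>K\<close>.\<close>
  have I_k1: "integrable \<mu> (\<lambda>p. (v p)\<^sup>2 * k\<^sub>1 (fst p) * exp (h (fst p)))"
  proof -
    define \<kappa> where "\<kappa> r = indicator {\<alpha>..\<beta>} r * k\<^sub>1 r" for r :: real
    have \<kappa>: "integrable lborel \<kappa>"
      using int_k1[OF \<alpha>\<beta>(1,2)] by (simp add: set_integrable_def \<kappa>_def[abs_def])
    then have a\<kappa>: "integrable lborel (\<lambda>r. \<bar>\<kappa> r\<bar>)" by simp
    have \<kappa>0: "\<bar>\<kappa> r\<bar> = 0" if "r \<notin> {\<alpha>..\<beta>}" for r using that by (auto simp: \<kappa>_def)
    have eq: "(v p)\<^sup>2 * k\<^sub>1 (fst p) * exp (h (fst p)) = (v p)\<^sup>2 * exp (h (fst p)) * \<kappa> (fst p)" if "p \<in> space \<mu>" for p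
      using that v0[of p] \<alpha>\<beta>(3)[of p] sp by (cases "p \<in> K") (auto simp: \<kappa>_def)
    have cve: "continuous_on (points ?W) (\<lambda>p. (v p)\<^sup>2 * exp (h (fst p)))"
      by (intro continuous_on_mult continuous_on_power cv ch)
    have "bounded ((\<lambda>p. (v p)\<^sup>2 * exp (h (fst p))) ` K)"
      by (intro compact_imp_bounded compact_continuous_image continuous_on_subset[OF cve] K)
    then obtain C where C: "\<And>p. p \<in> K \<Longrightarrow> norm ((v p)\<^sup>2 * exp (h (fst p))) \<le> C" "C > 0"
      unfolding bounded_pos by blast
    have "integrable \<mu> (\<lambda>p. \<bar>\<kappa> (fst p)\<bar> * \<eta> q (snd p))" if q: "q \<in> J" for q
      by (rule integrable_warped_mult[OF N(1) sigma mu c[OF q] a\<kappa> \<alpha>\<beta>(1) \<kappa>0 c\<eta>[OF q] L(1)[OF q] L(2)[OF q] \<eta>0[OF q]])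
    then have bnd: "integrable \<mu> (\<lambda>p. C * (\<Sum>q\<in>J. \<bar>\<kappa> (fst p)\<bar> * \<eta> q (snd p)))"
      by (intro integrable_mult_right Bochner_Integration.integrable_sum)
    have "integrable \<mu> (\<lambda>p. (v p)\<^sup>2 * exp (h (fst p)) * \<kappa> (fst p))"
    proof (rule Bochner_Integration.integrable_bound[OF bnd])
      have "(\<lambda>p. \<kappa> (fst p)) \<in> borel_measurable (restrict_space borel (points ?W))"
        using borel_measurable_integrable[OF \<kappa>]
        by (intro measurable_restrict_space1 measurable_compose[OF borel_measurable_continuous_onI[OF continuous_on_fst[OF continuous_on_id]]]) simp
      then have "(\<lambda>p. \<kappa> (fst p)) \<in> borel_measurable \<mu>"
        using sp(2) by (simp cong: measurable_cong_sets)
      then show "(\<lambda>p. (v p)\<^sup>2 * exp (h (fst p)) * \<kappa> (fst p)) \<in> borel_measurable \<mu>"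
        by (intro borel_measurable_times borel_measurable_riemannian_continuous[OF mu cve])
      show "AE p in \<mu>. norm ((v p)\<^sup>2 * exp (h (fst p)) * \<kappa> (fst p)) \<le> norm (C * (\<Sum>q\<in>J. \<bar>\<kappa> (fst p)\<bar> * \<eta> q (snd p)))"
      proof (rule AE_I2)
        fix p assume p: "p \<in> space \<mu>"
        show "norm ((v p)\<^sup>2 * exp (h (fst p)) * \<kappa> (fst p)) \<le> norm (C * (\<Sum>q\<in>J. \<bar>\<kappa> (fst p)\<bar> * \<eta> q (snd p)))"
        proof (cases "p \<in> K")
          case True
          then have "(\<Sum>q\<in>J. \<bar>\<kappa> (fst p)\<bar> * \<eta> q (snd p)) = \<bar>\<kappa> (fst p)\<bar>"
            using \<eta>_sum[of "snd p"] by (simp flip: sum_distrib_left)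
          then show ?thesis
            using mult_right_mono[OF C(1)[OF True], of "\<bar>\<kappa> (fst p)\<bar>"] C(2) by (simp add: abs_mult)
        next
          case False
          then show ?thesis using v0[of p] p sp by simp
        qed
      qed
    qed
    then show ?thesis
      by (subst Bochner_Integration.integrable_cong[OF refl eq]) auto
  qed

  \<comment> \<open>Nonnegativity of the integral of the defect \<open>E\<close>\<close>
  define E where "E p = - 2 * dir_deriv ?W X \<psi> p - T p - (v p)\<^sup>2 * k\<^sub>1 (fst p) * exp (h (fst p))
      - dir_deriv ?W X v p * k\<^sub>2 (fst p) * exp (h (fst p))" for p
  \<comment> \<open>\<open>E\<close> is the lower bound obtained from Green's formula minus the
    integrands of the left-hand side; \<open>T\<close> is the term
    \<open>b\<^sup>2 e\<^sup>h\<close> of the overview. Integrability allows \<open>E\<close> to be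
    cut into pieces and its integral to be split into separate terms.\<close>
  have I_E: "integrable \<mu> E"
    unfolding E_def
    by (intro Bochner_Integration.integrable_diff integrable_mult_right I_dd I_T I_k1 I_k2)
  have E0: "\<And>p. p \<in> points ?W \<Longrightarrow> p \<notin> K \<Longrightarrow> E p = 0"
    by (simp add: E_def T_def v0 vr0 dd0 dd\<psi>0)
  have E_radial: "0 \<le> (LINT r : {\<alpha>..\<beta>} | lborel. \<sigma> r ^ m * E (r, x))" if x: "x \<in> points N" for x
  proof -
    obtain q q1 where q:
      "\<And>r. r > r\<^sub>0 \<Longrightarrow> q r \<ge> 0"
      "\<And>r. r > r\<^sub>0 \<Longrightarrow> (q has_real_derivative q1 r) (at r)"
      "\<And>r. r > r\<^sub>0 \<Longrightarrow> dir_deriv ?W X v (r, x) = (vr (r, x))\<^sup>2 + q r / (\<sigma> r)\<^sup>2"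
      and q\<psi>: "\<And>r \<alpha> \<beta> \<alpha>' \<beta>'. r > r\<^sub>0 \<Longrightarrow> C1_on {r\<^sub>0<..} \<alpha> \<Longrightarrow> C1_on {r\<^sub>0<..} \<beta> \<Longrightarrow>
      (\<alpha> has_real_derivative \<alpha>') (at r) \<Longrightarrow> (\<beta> has_real_derivative \<beta>') (at r) \<Longrightarrow>
      dir_deriv ?W X (\<lambda>p. \<alpha> (fst p) * vr p + \<beta> (fst p) * v p) (r, x)
      = vr (r, x) * (\<alpha>' * vr (r, x) + \<alpha> r * radial_deriv vr (r, x)
          + \<beta>' * v (r, x) + \<beta> r * vr (r, x))
        + (\<alpha> r * q1 r / 2 + \<beta> r * q r) / (\<sigma> r)\<^sup>2"
      by (rule warped_gradient_radial[OF N(1) sigma v2 x, folded X_def vr_def]) (assumption | rule that)+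
    have in_r: "r > r\<^sub>0" if "r \<in> {\<alpha>..\<beta>}" for r using that \<alpha>\<beta>(1) by auto
    have min2: "k \<le> 2 * s \<and> k \<le> 2 * t" if "k \<le> 2 * min s t" for k s t :: real
      using that by (simp add: min_def split: if_splits)
    show ?thesis
    proof (rule carleman_radial[where m = m and \<sigma> = \<sigma> and ?\<sigma>1.0 = "deriv \<sigma>" and h = h and ?h1.0 = "deriv h"
          and F = F and ?F1.0 = "deriv F" and A = A and ?A1.0 = "deriv A" and k\<^sub>2 = k\<^sub>2 and ?k21.0 = "deriv k\<^sub>2"
          and ?G1.0 = "deriv G" and k\<^sub>1 = k\<^sub>1 and a = "\<lambda>r. v (r, x)" and ?a1.0 = "\<lambda>r. vr (r, x)"
          and ?a2.0 = "\<lambda>r. radial_deriv vr (r, x)" and q = q and ?q1.0 = q1])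
      show "\<alpha> \<le> \<beta>" using \<alpha>\<beta>(2) by simp
      fix r assume "r \<in> {\<alpha>..\<beta>}"
      then have r: "r > r\<^sub>0" by (rule in_r)
      show "\<sigma> r > 0" by (rule sigma(2)[OF r])
      show "(\<sigma> has_real_derivative deriv \<sigma> r) (at r)" by (rule d\<sigma>[OF r])
      show "(h has_real_derivative deriv h r) (at r)" by (rule dh[OF r])
      show "(F has_real_derivative deriv F r) (at r)" by (rule dF[OF r])
      show "(A has_real_derivative deriv A r) (at r)" by (rule dA[OF r])
      show "(k\<^sub>2 has_real_derivative deriv k\<^sub>2 r) (at r)" by (rule dk2[OF r])
      show "F r = 1/2 * (deriv h r + real m * deriv \<sigma> r / \<sigma> r - deriv G r)" by (rule F_eq)
      show "A r = F r ^ 3 - F r * (deriv F r + real m * F r * deriv \<sigma> r / \<sigma> r)" by (rule A_eq[OF r])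
      show "k\<^sub>2 r \<le> 2 * (2 * (F r)\<^sup>2 - 2 * real m * (F r * deriv \<sigma> r / \<sigma> r) + deriv F r + F r * deriv G r)"
        "k\<^sub>2 r \<le> 2 * (- deriv F r - F r * deriv G r + 2 * (F r * deriv \<sigma> r / \<sigma> r))"
        using min2[OF k2[OF r]] unfolding m by blast+
      show "k\<^sub>1 r \<le> 2 * (deriv A r + A r * deriv G r) - k\<^sub>2 r * (F r)\<^sup>2 - deriv G r * k\<^sub>2 r * F r
          - deriv k\<^sub>2 r * F r - k\<^sub>2 r * deriv F r" by (rule k1[OF r])
      show "((\<lambda>r. v (r, x)) has_real_derivative vr (r, x)) (at r)"
        unfolding vr_def by (rule radial_deriv_has_derivative[OF sm v1 x r])
      show "((\<lambda>r. vr (r, x)) has_real_derivative radial_deriv vr (r, x)) (at r)"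
        by (rule radial_deriv_has_derivative[OF sm vr1 x r])
      show "(q has_real_derivative q1 r) (at r)" by (rule q(2)[OF r])
      show "q r \<ge> 0" by (rule q(1)[OF r])
      have dd: "dir_deriv ?W X \<psi> (r, x) = vr (r, x) *
          (- 2 * (deriv F r + F r * deriv h r) * exp (h r) * vr (r, x) + a r * radial_deriv vr (r, x)
          + - 2 * (2 * F r * deriv F r + (F r)\<^sup>2 * deriv h r) * exp (h r) * v (r, x) + b r * vr (r, x))
        + (a r * q1 r / 2 + b r * q r) / (\<sigma> r)\<^sup>2"
        unfolding \<psi>_def by (rule q\<psi>[OF r a1 b1 da[OF r] db[OF r]])
      show "\<sigma> r ^ m * E (r, x) = \<sigma> r ^ m * exp (h r) *
      (4 * vr (r, x) * (deriv F r * (vr (r, x) + F r * v (r, x))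
          + F r * (radial_deriv vr (r, x) + deriv F r * v (r, x) + F r * vr (r, x))
          + F r * (vr (r, x) + F r * v (r, x)) * deriv h r)
       + 4 * F r * (q1 r / 2 + F r * q r) / (\<sigma> r)\<^sup>2 - 4 * (F r)\<^sup>2 * (vr (r, x) + F r * v (r, x))\<^sup>2
       - (v (r, x))\<^sup>2 * k\<^sub>1 r - ((vr (r, x))\<^sup>2 + q r / (\<sigma> r)\<^sup>2) * k\<^sub>2 r)"
        \<comment> \<open>\<open>divide_inverse\<close> turns the reciprocal into an atom, which
          makes the identity polynomial.\<close>
        unfolding E_def dd T_def q(3)[OF r] a_def b_def fst_conv divide_inverse by algebra
    next
      fix r assume r: "r \<in> {\<alpha>, \<beta>}"
      then have "(r, x) \<notin> K" "r > r\<^sub>0" using \<alpha>\<beta> by fastforce+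
      moreover from this have p: "(r, x) \<in> points ?W" using x by (simp add: points_warped_end)
      \<comment> \<open>Off \<open>K\<close> the function, its radial derivative and the derivative
        of \<open>v\<close> along its gradient vanish. As the last is
        \<open>vr\<^sup>2 + q / \<sigma>\<^sup>2\<close>, so does \<open>q\<close>.\<close>
      ultimately show "v (r, x) = 0 \<and> vr (r, x) = 0 \<and> q r = 0"
        using v0[OF p] vr0[OF p] dd0[OF p] q(3)[of r] sigma(2)[of r] by simp
    qed
  qed
  \<comment> \<open>The inequality on rays is applied to each \<open>\<eta> q (snd p) * E p\<close>
    in the chart \<open>c q\<close>. The pieces sum to \<open>E\<close>, since the cutoffs sum to 1
    over the projection of \<open>K\<close> and \<open>E\<close> vanishes off
    \<open>K\<close>.\<close>
  have E_nonneg: "0 \<le> (\<integral>p. E p \<partial>\<mu>)"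
  proof -
    have Em: "E \<in> borel_measurable \<mu>" using I_E by auto
    have \<eta>m: "(\<lambda>p. \<eta> q (snd p)) \<in> borel_measurable \<mu>" if "q \<in> J" for q
      by (rule borel_measurable_riemannian_continuous[OF mu
            continuous_on_compose2[OF c\<eta>[OF that] continuous_on_snd[OF continuous_on_id]]])
         (auto simp: points_warped_end)
    have int: "integrable \<mu> (\<lambda>p. \<eta> q (snd p) * E p)" if q: "q \<in> J" for q
    proof (rule Bochner_Integration.integrable_bound[OF I_E])
      show "(\<lambda>p. \<eta> q (snd p) * E p) \<in> borel_measurable \<mu>"
        by (rule borel_measurable_times[OF \<eta>m[OF q] Em])
      show "AE p in \<mu>. norm (\<eta> q (snd p) * E p) \<le> norm (E p)"
        using \<eta>01[OF q] by (intro AE_I2) (auto simp: abs_mult intro: mult_left_le_one_le)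
    qed
    have "0 \<le> (\<integral>p. \<eta> q (snd p) * E p \<partial>\<mu>)" if q: "q \<in> J" for q
    proof (rule riemannian_measure_warped_nonneg[OF N(1) sigma mu c[OF q]])
      show "(\<lambda>p. \<eta> q (snd p) * E p) \<in> borel_measurable (restrict_space borel (points ?W))"
        using borel_measurable_times[OF \<eta>m[OF q] Em] sp(2) by (simp cong: measurable_cong_sets)
      show "\<eta> q (snd p) * E p = 0" if "p \<in> points ?W" "p \<notin> chart_dom ?W (c q)" for p
        using that L(2)[OF q] \<eta>0[OF q, of "snd p"]
        by (cases "snd p \<in> L q") (auto simp: points_warped_end chart_dom_warped_end)
      fix x assume "x \<in> chart_dom N (c q)"
      then have x: "x \<in> points N" using chart_dom_subset_points[OF c[OF q]] by blast
      \<comment> \<open>On this ray the cutoff is the constant \<open>\<eta> q x\<close>. Beyond the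
        interval \<open>(r, x)\<close> is not in \<open>K\<close>, so \<open>E\<close> vanishes for
        \<open>r > r\<^sub>0\<close>; for the other \<open>r\<close> the left indicator is
        0.\<close>
      have *: "indicator {r\<^sub>0<..} r * (\<sigma> r ^ DIM('e) * (\<eta> q (snd (r, x)) * E (r, x)))
          = \<eta> q x * (indicator {\<alpha>..\<beta>} r *\<^sub>R (\<sigma> r ^ m * E (r, x)))" for r
      proof (cases "r \<in> {\<alpha>..\<beta>}")
        case True
        then show ?thesis using \<alpha>\<beta>(1) by (simp add: m_def)
      next
        case False
        then have "(r, x) \<notin> K" using \<alpha>\<beta>(3)[of "(r, x)"] by auto
        then have "E (r, x) = 0" if "r > r\<^sub>0" using E0[of "(r, x)"] that x by (simp add: points_warped_end)
        then show ?thesis using False by (auto simp: indicator_def)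
      qed
      have "(\<integral>r. indicator {r\<^sub>0<..} r * (\<sigma> r ^ DIM('e) * (\<eta> q (snd (r, x)) * E (r, x))) \<partial>lborel)
          = \<eta> q x * (LINT r : {\<alpha>..\<beta>} | lborel. \<sigma> r ^ m * E (r, x))"
        by (simp only: * set_lebesgue_integral_def integral_mult_right_zero)
      then show "0 \<le> (\<integral>r. indicator {r\<^sub>0<..} r * (\<sigma> r ^ DIM('e) * (\<eta> q (snd (r, x)) * E (r, x))) \<partial>lborel)"
        using E_radial[OF x] \<eta>01[OF q] by simp
    qed
    then have "0 \<le> (\<Sum>q\<in>J. \<integral>p. \<eta> q (snd p) * E p \<partial>\<mu>)" by (intro sum_nonneg)
    also have "\<dots> = (\<integral>p. (\<Sum>q\<in>J. \<eta> q (snd p) * E p) \<partial>\<mu>)"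
      by (rule Bochner_Integration.integral_sum[symmetric]) (rule int)
    also have "\<dots> = (\<integral>p. E p \<partial>\<mu>)"
    proof (rule Bochner_Integration.integral_cong[OF refl])
      fix p assume "p \<in> space \<mu>"
      then show "(\<Sum>q\<in>J. \<eta> q (snd p) * E p) = E p"
        using \<eta>_sum[of "snd p"] E0[of p] sp by (cases "p \<in> K") (auto simp flip: sum_distrib_right)
    qed
    finally show ?thesis .
  qed

  \<comment> \<open>Green's formula, the pointwise inequality and the conclusion\<close>
  have "(\<integral>p. E p \<partial>\<mu>) = - 2 * (\<integral>p. dir_deriv ?W X \<psi> p \<partial>\<mu>) - (\<integral>p. T p \<partial>\<mu>)
      - (\<integral>p. (v p)\<^sup>2 * k\<^sub>1 (fst p) * exp (h (fst p)) \<partial>\<mu>)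
      - (\<integral>p. dir_deriv ?W X v p * k\<^sub>2 (fst p) * exp (h (fst p)) \<partial>\<mu>)"
    unfolding E_def
    by (simp add: Bochner_Integration.integral_diff Bochner_Integration.integrable_diff I_dd I_T I_k1 I_k2)
  moreover have "(\<integral>p. \<psi> p * laplacian ?W v p \<partial>\<mu>) = - (\<integral>p. dir_deriv ?W X \<psi> p \<partial>\<mu>)"
    unfolding laplacian_def X_def[symmetric] by (rule divergence_theorem[OF W mu X \<psi>1 K \<psi>0])
  moreover have "(\<integral>p. 2 * (\<psi> p * laplacian ?W v p) - T p \<partial>\<mu>) \<le> (\<integral>p. (laplacian ?W v p)\<^sup>2 * exp (h (fst p)) \<partial>\<mu>)"
  proof (rule integral_mono)
    show "integrable \<mu> (\<lambda>p. 2 * (\<psi> p * laplacian ?W v p) - T p)" using I_psi I_T by simp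
    fix p
    define w where "w = vr p + F (fst p) * v p"
    \<comment> \<open>The discarded square: with the \<open>b\<close> of the overview equal to
      \<open>- 2 F w\<close>, it is \<open>(\<Delta>v - b)\<^sup>2 e\<^sup>h\<close>.\<close>
    have "(laplacian ?W v p)\<^sup>2 * exp (h (fst p)) - (2 * (\<psi> p * laplacian ?W v p) - T p)
        = (laplacian ?W v p + 2 * F (fst p) * w)\<^sup>2 * exp (h (fst p))"
      unfolding T_def \<psi>_def a_def b_def w_def by algebra
    also have "\<dots> \<ge> 0" by simp
    finally show "2 * (\<psi> p * laplacian ?W v p) - T p \<le> (laplacian ?W v p)\<^sup>2 * exp (h (fst p))" by simp
  qed (rule I_lap)
  moreover have "(\<integral>p. 2 * (\<psi> p * laplacian ?W v p) - T p \<partial>\<mu>)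
      = 2 * (\<integral>p. \<psi> p * laplacian ?W v p \<partial>\<mu>) - (\<integral>p. T p \<partial>\<mu>)"
    using I_psi I_T by simp
  moreover have "(\<integral>p. rnorm2 ?W (rgrad ?W v) p * k\<^sub>2 (fst p) * exp (h (fst p)) \<partial>\<mu>)
      = (\<integral>p. dir_deriv ?W X v p * k\<^sub>2 (fst p) * exp (h (fst p)) \<partial>\<mu>)"
    by (rule Bochner_Integration.integral_cong[OF refl]) (simp add: sp rnorm2_rgrad[OF W v1] X_def)
  ultimately show ?thesis using E_nonneg by simp
qed

end
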